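(* Let $d\ge1$ and $1\le i\le d$. The Cauchy problem $$\partial_tf=\mathcal R_if\quad\text{on }\mathbb R^+\times\mathbb R^d,\qquad f(0,x)=f_0(x),$$ where $\mathcal R_i$ is the $i$-th Riesz transform, is strongly ill-posed in $L^\infty(\mathbb R^d)$.
   Context: $\mathcal R_i$ is the Fourier multiplier with symbol $-\mathrm i\xi_i/|\xi|$. A Cauchy problem $\partial_tf=F(f)$, $f(0,x)=f_0(x)$, is called mildly ill-posed in a Banach space $X$ if there exist a Banach space $Y$ continuously embedded in $X$ and a constant $c>0$ such that for any $\varepsilon,\delta>0$ there exists $f_0\in Y$ with $\|f_0\|_X\le\varepsilon$ for which there exists a unique local solution $f\in L^\infty([0,T];Y)$ for some $T>0$, and $\|f(t)\|_X\ge c$ for some $0<t<\delta$. If $c$ can be taken to be equal to $1/\varepsilon$ (that is, the last condition reads $\|f(t)\|_X\ge 1/\varepsilon$ for some $0<t<\delta$), the Cauchy problem is called strongly ill-posed in $X$. *)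

theory Defs
  imports "HOL-Analysis.Analysis" "HOL-Probability.Essential_Supremum"
begin

text \<open>
  Functions on \<open>real^'n\<close> are complex valued, and elements of a function space are represented by
  Borel functions; two of them denote the same element iff they agree almost everywhere.
\<close>

type_synonym 'n cfun = "real^'n \<Rightarrow> complex"


subsection \<open>Fourier multipliers\<close>

primrec iterated_partial :: "'n::finite list \<Rightarrow> 'n cfun \<Rightarrow> 'n cfun" where
  "iterated_partial [] f = f"
| "iterated_partial (j # js) f =
     (\<lambda>x. frechet_derivative (iterated_partial js f) (at x) (axis j 1))"

definition schwartz :: "'n::finite cfun \<Rightarrow> bool" where
  "schwartz \<phi> \<longleftrightarrow>
     (\<forall>js. iterated_partial js \<phi> differentiable_on UNIV \<and>
           (\<forall>k::nat. \<exists>C. \<forall>x. norm x ^ k * norm (iterated_partial js \<phi> x) \<le> C))"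

definition fourier :: "'n::finite cfun \<Rightarrow> 'n cfun" where
  "fourier \<phi> \<xi> = (\<integral>x. exp (- \<i> * complex_of_real (x \<bullet> \<xi>)) * \<phi> x \<partial>lborel)"

text \<open>Functions that act as tempered distributions by integration.\<close>

definition tempered :: "'n::finite cfun \<Rightarrow> bool" where
  "tempered f \<longleftrightarrow> f \<in> borel_measurable lborel \<and>
     (\<forall>\<phi>. schwartz \<phi> \<longrightarrow> integrable lborel (\<lambda>x. f x * \<phi> x))"

text \<open>
  \<open>F\<close> is the Fourier transform of \<open>f\<close> in the sense of tempered distributions.
\<close>

definition is_fourier_transform :: "'n::finite cfun \<Rightarrow> 'n cfun \<Rightarrow> bool" where
  "is_fourier_transform f F \<longleftrightarrow> tempered f \<and> tempered F \<and>
     (\<forall>\<phi>. schwartz \<phi> \<longrightarrow>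
        (\<integral>x. f x * fourier \<phi> x \<partial>lborel) = (\<integral>\<xi>. F \<xi> * \<phi> \<xi> \<partial>lborel))"

text \<open>
  \<open>fourier_multiplier m f g\<close> says that \<open>g\<close> is the image of \<open>f\<close> under the multiplier with symbol
  \<open>m\<close>. It is a relation because the operator is only defined for those \<open>f\<close> whose Fourier transform
  is a function (in particular for \<open>f\<close> in \<open>L\<^sup>2\<close> when \<open>m\<close> is bounded and Borel), and \<open>g\<close> is
  determined up to a null set.
\<close>

definition fourier_multiplier :: "'n::finite cfun \<Rightarrow> 'n cfun \<Rightarrow> 'n cfun \<Rightarrow> bool" where
  "fourier_multiplier m f g \<longleftrightarrow>
     (\<exists>F. is_fourier_transform f F \<and> is_fourier_transform g (\<lambda>\<xi>. m \<xi> * F \<xi>))"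

definition riesz_transform :: "'n::finite \<Rightarrow> 'n cfun \<Rightarrow> 'n cfun \<Rightarrow> bool" where
  "riesz_transform i =
     fourier_multiplier (\<lambda>\<xi>. - \<i> * complex_of_real (\<xi> $ i / norm \<xi>))"


subsection \<open>Banach spaces of functions\<close>

definition banach_function_space :: "'n::finite cfun set \<Rightarrow> ('n cfun \<Rightarrow> real) \<Rightarrow> bool" where
  "banach_function_space Y N \<longleftrightarrow>
     Y \<subseteq> borel_measurable lborel \<and>
     (\<forall>f\<in>Y. \<forall>g\<in>borel_measurable lborel. (AE x in lborel. f x = g x) \<longrightarrow> g \<in> Y) \<and>
     (\<lambda>x. 0) \<in> Y \<and>
     (\<forall>f\<in>Y. \<forall>g\<in>Y. (\<lambda>x. f x + g x) \<in> Y) \<and>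
     (\<forall>c. \<forall>f\<in>Y. (\<lambda>x. c * f x) \<in> Y) \<and>
     (\<forall>f\<in>Y. 0 \<le> N f \<and> (N f = 0 \<longleftrightarrow> (AE x in lborel. f x = 0))) \<and>
     (\<forall>f\<in>Y. \<forall>g\<in>Y. N (\<lambda>x. f x + g x) \<le> N f + N g) \<and>
     (\<forall>c. \<forall>f\<in>Y. N (\<lambda>x. c * f x) = norm c * N f) \<and>
     (\<forall>u::nat \<Rightarrow> 'n cfun. (\<forall>n. u n \<in> Y) \<and>
        (\<forall>e>0. \<exists>n0. \<forall>m\<ge>n0. \<forall>n\<ge>n0. N (\<lambda>x. u m x - u n x) < e) \<longrightarrow>
        (\<exists>f\<in>Y. (\<lambda>n. N (\<lambda>x. u n x - f x)) \<longlonglongrightarrow> 0))"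

definition continuously_embedded ::
  "'n::finite cfun set \<Rightarrow> ('n cfun \<Rightarrow> real) \<Rightarrow> 'n cfun set \<Rightarrow> ('n cfun \<Rightarrow> real) \<Rightarrow> bool" where
  "continuously_embedded Y NY X NX \<longleftrightarrow> Y \<subseteq> X \<and> (\<exists>C. \<forall>f\<in>Y. NX f \<le> C * NY f)"

definition Linf :: "'n::finite cfun set" where
  "Linf = {f \<in> borel_measurable lborel. esssup lborel (\<lambda>x. ereal (norm (f x))) < \<infinity>}"

definition Linf_norm :: "'n::finite cfun \<Rightarrow> real" where
  "Linf_norm f = real_of_ereal (esssup lborel (\<lambda>x. ereal (norm (f x))))"

text \<open>
  \<open>L\<^sup>\<infinity>([0,T];Y)\<close> in the sense of Bochner: almost everywhere a limit in \<open>Y\<close> of simple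
  functions, and essentially bounded in \<open>Y\<close>.
\<close>

definition Linf_time :: "real \<Rightarrow> 'n::finite cfun set \<Rightarrow> ('n cfun \<Rightarrow> real) \<Rightarrow> (real \<Rightarrow> 'n cfun) set"
  where
  "Linf_time T Y N = {f.
     (AE t in lborel. t \<in> {0..T} \<longrightarrow> f t \<in> Y) \<and>
     (\<exists>s::nat \<Rightarrow> real \<Rightarrow> 'n cfun.
        (\<forall>n. finite (s n ` {0..T}) \<and> s n ` {0..T} \<subseteq> Y \<and>
             (\<forall>y. {t \<in> {0..T}. s n t = y} \<in> sets lborel)) \<and>
        (AE t in lborel. t \<in> {0..T} \<longrightarrow> (\<lambda>n. N (\<lambda>x. s n t x - f t x)) \<longlonglongrightarrow> 0)) \<and>
     (\<exists>M. AE t in lborel. t \<in> {0..T} \<longrightarrow> N (f t) \<le> M)}"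


subsection \<open>The Cauchy problem and strong ill-posedness\<close>

text \<open>
  \<open>F\<close> is a possibly partial operator, given as a relation as above. Since a member of
  \<open>L\<^sup>\<infinity>([0,T];Y)\<close> need not be differentiable in time, the equation
  \<open>\<partial>\<^sub>t f = F(f)\<close>, \<open>f(0) = f0\<close> is understood in the sense of tempered distributions in \<open>x\<close> and
  integrated in time. It is imposed at every \<open>t\<close>, not just almost every \<open>t\<close>: this selects the
  weakly continuous representative, so that \<open>f t\<close> is meaningful for each individual \<open>t\<close>.
\<close>

definition cauchy_solution ::
  "('n::finite cfun \<Rightarrow> 'n cfun \<Rightarrow> bool) \<Rightarrow> 'n cfun set \<Rightarrow> 'n cfun set \<Rightarrow> ('n cfun \<Rightarrow> real) \<Rightarrow>
   real \<Rightarrow> 'n cfun \<Rightarrow> (real \<Rightarrow> 'n cfun) \<Rightarrow> bool" where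
  "cauchy_solution F X Y NY T f0 f \<longleftrightarrow>
     f \<in> Linf_time T Y NY \<and> (\<forall>t\<in>{0..T}. f t \<in> X) \<and> (AE x in lborel. f 0 x = f0 x) \<and>
     (\<exists>g. (AE s in lborel. s \<in> {0..T} \<longrightarrow> F (f s) (g s) \<and> tempered (g s)) \<and>
        (\<forall>\<phi>. schwartz \<phi> \<longrightarrow>
           set_integrable lborel {0..T} (\<lambda>s. \<integral>x. g s x * \<phi> x \<partial>lborel) \<and>
           (\<forall>t\<in>{0..T}. (\<integral>x. f t x * \<phi> x \<partial>lborel) =
              (\<integral>x. f0 x * \<phi> x \<partial>lborel) +
              (LINT s:{0..t}|lborel. (\<integral>x. g s x * \<phi> x \<partial>lborel)))))"

definition unique_cauchy_solution ::
  "('n::finite cfun \<Rightarrow> 'n cfun \<Rightarrow> bool) \<Rightarrow> 'n cfun set \<Rightarrow> 'n cfun set \<Rightarrow> ('n cfun \<Rightarrow> real) \<Rightarrow>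
   real \<Rightarrow> 'n cfun \<Rightarrow> (real \<Rightarrow> 'n cfun) \<Rightarrow> bool" where
  "unique_cauchy_solution F X Y NY T f0 f \<longleftrightarrow>
     cauchy_solution F X Y NY T f0 f \<and>
     (\<forall>h. cauchy_solution F X Y NY T f0 h \<longrightarrow>
        (\<forall>t\<in>{0..T}. AE x in lborel. h t x = f t x))"

text \<open>
  \<open>Y\<close> is identified with its image in \<open>X\<close>, and \<open>F\<close> is required to be defined on all of \<open>Y\<close>, so
  that the uniqueness requirement really ranges over \<open>L\<^sup>\<infinity>([0,T];Y)\<close>.
\<close>

definition strongly_ill_posed ::
  "('n::finite cfun \<Rightarrow> 'n cfun \<Rightarrow> bool) \<Rightarrow> 'n cfun set \<Rightarrow> ('n cfun \<Rightarrow> real) \<Rightarrow> bool" where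
  "strongly_ill_posed F X NX \<longleftrightarrow>
     (\<exists>Y NY. banach_function_space Y NY \<and> continuously_embedded Y NY X NX \<and>
        (\<forall>u\<in>Y. \<exists>v. F u v) \<and>
        (\<forall>\<epsilon>>0. \<forall>\<delta>>0. \<exists>f0\<in>Y. NX f0 \<le> \<epsilon> \<and>
           (\<exists>T>0. \<exists>f. unique_cauchy_solution F X Y NY T f0 f \<and>
              (\<exists>t. 0 < t \<and> t < \<delta> \<and> t \<le> T \<and> NX (f t) \<ge> 1 / \<epsilon>))))"

end

theory Submission
  imports Defs "HOL-Probability.Probability"
begin

text \<open>
  On the Fourier side the equation is diagonal: \<open>\<partial>\<^sub>t F = m F\<close> with
  \<open>m(\<xi>) = - \<i> \<xi>\<^sub>i / |\<xi>|\<close>, solved by \<open>exp (t m) F\<close>. The multiplier \<open>exp (t m)\<close> has modulus one,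
  so the evolution is harmless for every norm that only sees the size of the spectrum. But it is
  homogeneous of degree zero and not constant, and such a multiplier is unbounded on \<open>L\<^sup>\<infinity>\<close>. The
  theorem makes this quantitative in a space that is invariant under the flow.

  The space. \<open>Y\<close> consists of the inverse Fourier transforms of Borel functions \<open>F\<close> for which
  \<open>(1 + |\<xi>|\<^sup>2)\<^sup>d |F(\<xi>)|\<close> is bounded, with the infimum of such bounds as the norm (\<open>decay_space\<close>). The weight
  makes \<open>F\<close> integrable, so \<open>Y\<close> embeds into \<open>L\<^sup>\<infinity>\<close>; multipliers with bounded symbol act on it. That
  \<open>F\<close> is the distributional Fourier transform of its inverse transform
  (\<open>is_fourier_transform_inv_fourier\<close>) amounts to Fourier inversion for Schwartz functions, proved by
  Gaussian regularisation.

  Existence and uniqueness. The curve \<open>t \<mapsto> inv_fourier (exp (t m) F)\<close> is Lipschitz in \<open>Y\<close> and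
  solves the integrated equation by Fubini (\<open>solution_cauchy\<close>). For two solutions, the spectrum
  \<open>V(t)\<close> of the difference satisfies \<open>V(t) = \<integral> m V(s) ds\<close> over \<open>[0,t]\<close>, tested against Schwartz
  functions. A bound \<open>|V(s)| \<le> M s\<^sup>n / n!\<close> therefore improves to \<open>|V(t)| \<le> M t\<^sup>n\<^sup>+\<^sup>1 / (n+1)!\<close>, and
  \<open>V = 0\<close> in the limit (\<open>cauchy_solution_unique\<close>). A supremum norm on the spectral side is convenient
  here because translated and scaled Gaussians detect it (\<open>bounded_by_gauss_tests\<close>).

  Inflation. A function \<open>exp (\<i> k x\<^sub>i)\<close>, cut off by a very wide Gaussian, has its spectrum close to
  \<open>k e\<^sub>i\<close>, where \<open>exp (t m)\<close> is \<open>exp (- \<i> t sgn k)\<close>. Hence the flow turns \<open>\<Sum> r\<^sup>k sin (k x\<^sub>i) / k\<close>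
  into \<open>\<Sum> r\<^sup>k sin (k x\<^sub>i - t) / k\<close> near the origin. The first sum is the imaginary part of
  \<open>- ln (1 - z)\<close> at \<open>z = r exp (\<i> x\<^sub>i)\<close> and stays bounded as \<open>r \<rightarrow> 1\<close>; the second equals
  \<open>sin t ln (1 - r)\<close> at the origin and is unbounded (\<open>norm_inflation\<close>).
\<close>

section \<open>Integrals over real^'n and the standard Gaussian\<close>

lemma prod_Basis_vec:
  fixes f :: "'n::finite \<Rightarrow> real \<Rightarrow> 'b::comm_monoid_mult"
  shows "(\<Prod>b\<in>(Basis :: (real^'n) set). f (axis_index b) (x b)) = (\<Prod>i\<in>UNIV. f i (x (axis i 1)))"
proof -
  have B: "(Basis :: (real^'n) set) = (\<lambda>i. axis i 1) ` UNIV"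
    by (auto simp: Basis_vec_def)
  have inj: "inj (\<lambda>i::'n. axis i (1::real))"
    by (auto simp: inj_on_def axis_eq_axis)
  show ?thesis
    unfolding B by (subst prod.reindex[OF inj]) (simp add: axis_index_axis)
qed

lemma
  fixes f :: "'n::finite \<Rightarrow> real \<Rightarrow> 'b::{real_normed_field,banach,second_countable_topology}"
  assumes f: "\<And>i. integrable lborel (f i)"
  shows integrable_lborel_prod: "integrable lborel (\<lambda>x::real^'n. \<Prod>i\<in>UNIV. f i (x $ i))"
    and integral_lborel_prod:
      "(\<integral>x. (\<Prod>i\<in>UNIV. f i (x $ i)) \<partial>(lborel :: (real^'n) measure)) = (\<Prod>i\<in>UNIV. \<integral>s. f i s \<partial>lborel)"
proof -
  interpret P: product_sigma_finite "\<lambda>b::real^'n. lborel :: real measure" ..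
  have [measurable]: "f i \<in> borel_measurable borel" for i
    using borel_measurable_integrable[OF f[of i]] by simp
  have F: "(\<Prod>i\<in>UNIV. f i ((\<Sum>b\<in>Basis. x b *\<^sub>R b) $ i)) = (\<Prod>b\<in>Basis. f (axis_index b) (x b))"
    for x :: "real^'n \<Rightarrow> real"
  proof -
    have "(\<Sum>b\<in>Basis. x b *\<^sub>R b) $ i = x (axis i 1)" for i
    proof -
      have "(\<Sum>b\<in>Basis. x b *\<^sub>R b) $ i = (\<Sum>b\<in>Basis. x b *\<^sub>R b) \<bullet> axis i 1"
        by (simp add: inner_axis)
      also have "\<dots> = x (axis i 1)"
        by (rule inner_sum_left_Basis) (simp add: axis_in_Basis_iff)
      finally show ?thesis .
    qed
    then show ?thesis by (simp add: prod_Basis_vec)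
  qed
  have meas: "(\<lambda>x::real^'n. \<Prod>i\<in>UNIV. f i (x $ i)) \<in> borel_measurable borel" by simp
  have int: "integrable (\<Pi>\<^sub>M b\<in>(Basis::(real^'n) set). lborel) (\<lambda>x. \<Prod>b\<in>Basis. f (axis_index b) (x b))"
    by (rule P.product_integrable_prod) (auto intro: f)
  show "integrable lborel (\<lambda>x::real^'n. \<Prod>i\<in>UNIV. f i (x $ i))"
    by (subst lborel_eq, subst integrable_distr_eq) (use int meas in \<open>simp_all only: F, simp_all\<close>)
  have "(\<integral>x. (\<Prod>i\<in>UNIV. f i (x $ i)) \<partial>(lborel :: (real^'n) measure))
      = (\<integral>x. (\<Prod>b\<in>Basis. f (axis_index b) (x b)) \<partial>(\<Pi>\<^sub>M b\<in>(Basis::(real^'n) set). lborel))"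
    by (subst lborel_eq, subst integral_distr) (use meas in \<open>simp_all only: F, simp_all\<close>)
  also have "\<dots> = (\<Prod>b\<in>(Basis::(real^'n) set). \<integral>s. f (axis_index b) s \<partial>lborel)"
    by (rule P.product_integral_prod) (auto intro: f)
  also have "\<dots> = (\<Prod>i\<in>UNIV. \<integral>s. f i s \<partial>lborel)"
    using prod_Basis_vec[of "\<lambda>i _. \<integral>s. f i s \<partial>lborel" "\<lambda>_. 0"] by simp
  finally show "(\<integral>x. (\<Prod>i\<in>UNIV. f i (x $ i)) \<partial>(lborel :: (real^'n) measure)) = (\<Prod>i\<in>UNIV. \<integral>s. f i s \<partial>lborel)" .
qed

lemma
  fixes f :: "'a::euclidean_space \<Rightarrow> 'b::{banach,second_countable_topology}"
  assumes f: "integrable lborel f" and c: "c \<noteq> 0"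
  shows integrable_lborel_affine: "integrable lborel (\<lambda>x. f (t + c *\<^sub>R x))"
    and integral_lborel_affine:
      "(\<integral>x. f (t + c *\<^sub>R x) \<partial>lborel) = (1 / \<bar>c\<bar> ^ DIM('a)) *\<^sub>R (\<integral>x. f x \<partial>lborel)"
proof -
  let ?D = "distr lborel borel (\<lambda>x. t + c *\<^sub>R x)"
  have [measurable]: "f \<in> borel_measurable borel"
    using borel_measurable_integrable[OF f] by simp
  have L: "lborel = density ?D (\<lambda>_. ennreal (\<bar>c\<bar> ^ DIM('a)))"
    using lborel_affine[OF c, of t] by (simp add: ennreal_power)
  have "integrable (density ?D (\<lambda>_. ennreal (\<bar>c\<bar> ^ DIM('a)))) f"
    using f L by simp
  then have "integrable ?D (\<lambda>x. \<bar>c\<bar> ^ DIM('a) *\<^sub>R f x)"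
    by (subst (asm) integrable_density) auto
  then have "integrable lborel (\<lambda>x. \<bar>c\<bar> ^ DIM('a) *\<^sub>R f (t + c *\<^sub>R x))"
    by (subst (asm) integrable_distr_eq) auto
  then have "integrable lborel (\<lambda>x. (1 / \<bar>c\<bar> ^ DIM('a)) *\<^sub>R \<bar>c\<bar> ^ DIM('a) *\<^sub>R f (t + c *\<^sub>R x))"
    by (rule integrable_scaleR_right)
  then show 1: "integrable lborel (\<lambda>x. f (t + c *\<^sub>R x))"
    using c by simp
  have "(\<integral>x. f x \<partial>lborel) = (\<integral>x. f x \<partial>density ?D (\<lambda>_. ennreal (\<bar>c\<bar> ^ DIM('a))))"
    using L by simp
  also have "\<dots> = (\<integral>x. \<bar>c\<bar> ^ DIM('a) *\<^sub>R f x \<partial>?D)"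
    by (subst integral_density) auto
  also have "\<dots> = \<bar>c\<bar> ^ DIM('a) *\<^sub>R (\<integral>x. f (t + c *\<^sub>R x) \<partial>lborel)"
    by (subst integral_distr) auto
  finally show "(\<integral>x. f (t + c *\<^sub>R x) \<partial>lborel) = (1 / \<bar>c\<bar> ^ DIM('a)) *\<^sub>R (\<integral>x. f x \<partial>lborel)"
    using c by simp
qed

definition std_gauss :: "real^'n::finite \<Rightarrow> real" where
  "std_gauss x = exp (- (norm x)\<^sup>2 / 2) / sqrt (2 * pi) ^ CARD('n)"

lemma norm_sq_vec: "(norm (x::real^'n::finite))\<^sup>2 = (\<Sum>i\<in>UNIV. (x $ i)\<^sup>2)"
  by (simp add: norm_vec_def L2_set_def sum_nonneg)

lemma std_gauss_prod: "std_gauss (x::real^'n::finite) = (\<Prod>i\<in>UNIV. std_normal_density (x $ i))"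
proof -
  have "(\<Prod>i\<in>UNIV. std_normal_density (x $ i)) =
      (\<Prod>i\<in>(UNIV::'n set). 1 / sqrt (2 * pi)) * (\<Prod>i\<in>UNIV. exp (- (x $ i)\<^sup>2 / 2))"
    unfolding std_normal_density_def by (rule prod.distrib)
  also have "(\<Prod>i\<in>UNIV. exp (- (x $ i)\<^sup>2 / 2)) = exp (- (norm x)\<^sup>2 / 2)"
    by (simp add: norm_sq_vec exp_sum[symmetric] sum_negf sum_divide_distrib)
  finally show ?thesis
    by (simp add: std_gauss_def power_divide)
qed

lemma std_gauss_pos: "std_gauss x > 0"
  by (simp add: std_gauss_def)

lemma std_gauss_borel [measurable]: "std_gauss \<in> borel_measurable borel"
  unfolding std_gauss_def[abs_def] by measurable

lemma integrable_std_gauss: "integrable lborel (std_gauss :: real^'n::finite \<Rightarrow> real)"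
  and integral_std_gauss: "(\<integral>x. std_gauss (x::real^'n::finite) \<partial>lborel) = 1"
proof -
  have i: "integrable lborel std_normal_density"
    by simp
  have "(std_gauss :: real^'n::finite \<Rightarrow> real) = (\<lambda>x. \<Prod>i\<in>UNIV. std_normal_density (x $ i))"
    by (simp add: std_gauss_prod fun_eq_iff)
  then have eq: "(std_gauss :: real^'n \<Rightarrow> real) = (\<lambda>x. \<Prod>i\<in>UNIV. std_normal_density (x $ i))" .
  show "integrable lborel (std_gauss :: real^'n \<Rightarrow> real)"
    unfolding eq by (rule integrable_lborel_prod) (rule i)
  show "(\<integral>x. std_gauss (x::real^'n) \<partial>lborel) = 1"
    unfolding eq by (subst integral_lborel_prod) (use i in simp_all)
qed

lemma fourier_std_gauss_line:
  "(\<integral>s. iexp (t * s) * of_real (std_normal_density s) \<partial>lborel)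
     = of_real (exp (- t\<^sup>2 / 2))"
proof -
  have "(\<integral>s. iexp (t * s) * of_real (std_normal_density s) \<partial>lborel)
     = char std_normal_distribution t"
    unfolding char_def
    by (subst integral_density) (auto simp: scaleR_conv_of_real mult.commute)
  then show ?thesis by (simp add: char_std_normal_distribution exp_of_real)
qed

lemma integrable_cexp_mult:
  fixes f :: "real^'n::finite \<Rightarrow> complex"
  assumes "integrable lborel f"
  shows "integrable lborel (\<lambda>x. iexp (x \<bullet> y) * f x)"
    "integrable lborel (\<lambda>x. exp (- \<i> * complex_of_real (x \<bullet> y)) * f x)"
    "integrable lborel (\<lambda>x. iexp (y \<bullet> x) * f x)"
    "integrable lborel (\<lambda>x. exp (- \<i> * complex_of_real (y \<bullet> x)) * f x)"
proof -
  have [measurable]: "f \<in> borel_measurable borel"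
    using borel_measurable_integrable[OF assms] by simp
  show "integrable lborel (\<lambda>x. iexp (x \<bullet> y) * f x)"
    "integrable lborel (\<lambda>x. exp (- \<i> * complex_of_real (x \<bullet> y)) * f x)"
    "integrable lborel (\<lambda>x. iexp (y \<bullet> x) * f x)"
    "integrable lborel (\<lambda>x. exp (- \<i> * complex_of_real (y \<bullet> x)) * f x)"
    by (rule Bochner_Integration.integrable_bound[OF assms]; simp add: norm_mult)+
qed

text \<open>
  The Gaussian is its own Fourier transform up to a constant: all factors are one-dimensional
  characteristic functions of the normal distribution.
\<close>

lemma fourier_std_gauss:
  fixes y :: "real^'n::finite"
  shows "(\<integral>x. iexp (x \<bullet> y) * of_real (std_gauss x) \<partial>lborel)
     = of_real (exp (- (norm y)\<^sup>2 / 2))"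
proof -
  let ?f = "\<lambda>i s. iexp ((y $ i) * s) * of_real (std_normal_density s)"
  have i: "integrable lborel (?f i)" for i
    by (rule Bochner_Integration.integrable_bound[of _ std_normal_density])
      (auto simp: norm_mult)
  have "(\<lambda>x. iexp (x \<bullet> y) * of_real (std_gauss x))
     = (\<lambda>x::real^'n. \<Prod>i\<in>UNIV. ?f i (x $ i))"
    by (simp add: fun_eq_iff prod.distrib std_gauss_prod inner_vec_def exp_sum sum_distrib_left mult.commute)
  then have "(\<integral>x. iexp (x \<bullet> y) * of_real (std_gauss x) \<partial>lborel)
     = (\<Prod>i\<in>UNIV. \<integral>s. ?f i s \<partial>lborel)"
    by (simp only: integral_lborel_prod[OF i])
  also have "\<dots> = (\<Prod>i\<in>UNIV. of_real (exp (- (y $ i)\<^sup>2 / 2)))"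
    by (simp only: fourier_std_gauss_line)
  also have "\<dots> = of_real (exp (- (norm y)\<^sup>2 / 2))"
    by (simp add: norm_sq_vec exp_sum[symmetric] sum_negf sum_divide_distrib flip: of_real_prod)
  finally show ?thesis .
qed

section \<open>An integrable weight\<close>

text \<open>
  The exponent is the dimension: \<open>(1 + |x|\<^sup>2)\<^sup>d\<close> dominates the product of all \<open>1 + x\<^sub>j\<^sup>2\<close>, so its inverse
  is integrable by reduction to one variable.
\<close>

definition weight :: "real^'n::finite \<Rightarrow> real" where
  "weight x = (1 + (norm x)\<^sup>2) ^ CARD('n)"

lemma weight_ge_1: "weight x \<ge> 1"
  by (simp add: weight_def)

lemma weight_pos: "weight x > 0"
  using weight_ge_1[of x] by linarith

lemma weight_borel [measurable]: "weight \<in> borel_measurable borel"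
  unfolding weight_def[abs_def] by measurable

lemma prod_le_weight: "(\<Prod>i\<in>UNIV. 1 + (x $ i)\<^sup>2) \<le> weight (x::real^'n::finite)"
proof -
  have "(x $ i)\<^sup>2 \<le> (norm x)\<^sup>2" for i
    unfolding norm_sq_vec by (rule member_le_sum) auto
  then have "(\<Prod>i\<in>UNIV. 1 + (x $ i)\<^sup>2) \<le> (\<Prod>i\<in>(UNIV::'n set). 1 + (norm x)\<^sup>2)"
    by (intro prod_mono) (auto intro: add_nonneg_nonneg)
  then show ?thesis by (simp add: weight_def)
qed

lemma integrable_inverse_weight: "integrable lborel (\<lambda>x::real^'n::finite. 1 / weight x)"
proof -
  have "integrable lborel (\<lambda>s::real. inverse (1 + s\<^sup>2))"
    using integrable_inverse_1_plus_square by (simp add: set_integrable_def)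
  from integrable_lborel_prod[of "\<lambda>_ s. inverse (1 + s\<^sup>2)", OF this]
  have P: "integrable lborel (\<lambda>x::real^'n. \<Prod>i\<in>UNIV. inverse (1 + (x $ i)\<^sup>2))" .
  show ?thesis
  proof (rule Bochner_Integration.integrable_bound[OF P])
    have "1 / weight x \<le> (\<Prod>i\<in>UNIV. inverse (1 + (x $ i)\<^sup>2))" for x :: "real^'n"
    proof -
      have "(\<Prod>i\<in>UNIV. 1 + (x $ i)\<^sup>2) > 0"
        by (intro prod_pos) (auto intro: add_pos_nonneg)
      then show ?thesis
        using prod_le_weight[of x] by (simp add: inverse_eq_divide frac_le prod_dividef)
    qed
    then have "norm (1 / weight x) \<le> norm (\<Prod>i\<in>UNIV. inverse (1 + (x $ i)\<^sup>2))" for x :: "real^'n"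
    proof -
      have "norm (1 / weight x) = 1 / weight x"
        using weight_pos[of x] by simp
      also have "\<dots> \<le> (\<Prod>i\<in>UNIV. inverse (1 + (x $ i)\<^sup>2))"
        by fact
      also have "\<dots> \<le> norm (\<Prod>i\<in>UNIV. inverse (1 + (x $ i)\<^sup>2))"
        unfolding real_norm_def by (rule abs_ge_self)
      finally show ?thesis .
    qed
    then show "AE x in lborel. norm (1 / weight (x::real^'n)) \<le> norm (\<Prod>i\<in>UNIV. inverse (1 + (x $ i)\<^sup>2))"
      by (intro AE_I2)
  qed measurable
qed

lemma integrable_of_weight_bound:
  fixes f :: "real^'n::finite \<Rightarrow> complex"
  assumes [measurable]: "f \<in> borel_measurable borel" and b: "\<And>x. norm (f x) * weight x \<le> C"
  shows "integrable lborel f"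
proof -
  have "integrable lborel (\<lambda>x::real^'n. C * (1 / weight x))"
    by (intro integrable_mult_right integrable_inverse_weight)
  then show ?thesis
  proof (rule Bochner_Integration.integrable_bound)
    have *: "norm (f x) \<le> norm (C * (1 / weight x))" for x
    proof -
      have "norm (f x) \<le> C / weight x" using b[of x] weight_pos[of x] by (simp add: field_simps)
      also have "\<dots> \<le> norm (C * (1 / weight x))"
        by (simp only: real_norm_def times_divide_eq_right mult_1_right abs_ge_self)
      finally show ?thesis .
    qed
    show "AE x in lborel. norm (f x) \<le> norm (C * (1 / weight x))" by (rule AE_I2) (rule *)
  qed simp
qed

section \<open>Decay of Schwartz functions and of their Fourier transforms\<close>

text \<open>
  The double integrals below are all of this form: a bounded kernel (an oscillating exponential, a
  Gaussian or the multiplier of the flow) between two integrable functions.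
\<close>

lemma fubini_bounded_kernel:
  fixes f :: "'a::euclidean_space \<Rightarrow> complex" and g :: "'b::euclidean_space \<Rightarrow> complex"
    and k :: "'a \<Rightarrow> 'b \<Rightarrow> complex"
  assumes f: "integrable lborel f" and g: "integrable lborel g"
    and k [measurable]: "case_prod k \<in> borel_measurable (borel \<Otimes>\<^sub>M borel)"
    and bound: "\<And>x y. norm (k x y) \<le> 1"
  shows "(\<integral>x. (\<integral>y. k x y * g y \<partial>lborel) * f x \<partial>lborel)
       = (\<integral>y. g y * (\<integral>x. k x y * f x \<partial>lborel) \<partial>lborel)"
    and "integrable lborel (\<lambda>x. (\<integral>y. k x y * g y \<partial>lborel) * f x)"
proof -
  have [measurable]: "f \<in> borel_measurable borel" "g \<in> borel_measurable borel"
    using borel_measurable_integrable[OF f] borel_measurable_integrable[OF g] by simp_all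
  have [measurable]: "(\<lambda>z. k (fst z) (snd z)) \<in> borel_measurable (borel \<Otimes>\<^sub>M borel)"
    using k by (simp add: case_prod_unfold)
  have "integrable (lborel \<Otimes>\<^sub>M lborel) (\<lambda>(x, y). f x * g y)"
  proof (rule lborel_pair.Fubini_integrable)
    show "integrable lborel (\<lambda>x. \<integral>y. norm (case (x, y) of (x, y) \<Rightarrow> f x * g y) \<partial>lborel)"
      using f by (simp add: norm_mult)
    show "AE x in lborel. integrable lborel (\<lambda>y. case (x, y) of (x, y) \<Rightarrow> f x * g y)"
      using g by simp
  qed measurable
  then have int: "integrable (lborel \<Otimes>\<^sub>M lborel) (\<lambda>(x, y). k x y * g y * f x)"
  proof (rule Bochner_Integration.integrable_bound)
    show "AE z in lborel \<Otimes>\<^sub>M lborel. norm (case z of (x, y) \<Rightarrow> k x y * g y * f x)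
      \<le> norm (case z of (x, y) \<Rightarrow> f x * g y)"
    proof (rule AE_I2, clarify)
      fix x y
      have "norm (k x y * g y * f x) = norm (k x y) * (norm (f x) * norm (g y))"
        by (simp add: norm_mult)
      also have "\<dots> \<le> 1 * (norm (f x) * norm (g y))"
        by (intro mult_right_mono bound) simp
      finally show "norm (k x y * g y * f x) \<le> norm (f x * g y)" by (simp add: norm_mult)
    qed
  qed measurable
  have A: "(\<integral>y. k x y * g y \<partial>lborel) * f x = (\<integral>y. k x y * g y * f x \<partial>lborel)" for x
    by simp
  have B: "g y * (\<integral>x. k x y * f x \<partial>lborel) = (\<integral>x. k x y * g y * f x \<partial>lborel)" for y
    by (subst integral_mult_right_zero[symmetric]) (simp add: mult_ac)
  show "(\<integral>x. (\<integral>y. k x y * g y \<partial>lborel) * f x \<partial>lborel)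
       = (\<integral>y. g y * (\<integral>x. k x y * f x \<partial>lborel) \<partial>lborel)"
    unfolding A B using lborel_pair.Fubini_integral[OF int] by simp
  show "integrable lborel (\<lambda>x. (\<integral>y. k x y * g y \<partial>lborel) * f x)"
    unfolding A using lborel_pair.integrable_fst[OF int] by simp
qed

lemma iterated_partial_append:
  "iterated_partial (ks @ js) \<phi> = iterated_partial ks (iterated_partial js \<phi>)"
  by (induction ks) auto

lemma schwartz_iterated_partial: "schwartz \<phi> \<Longrightarrow> schwartz (iterated_partial js \<phi>)"
  unfolding schwartz_def by (simp flip: iterated_partial_append)

lemma schwartz_differentiable: "schwartz \<phi> \<Longrightarrow> \<phi> differentiable (at x)"
  unfolding schwartz_def using iterated_partial.simps(1)
  by (metis UNIV_I differentiable_on_def)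

lemma schwartz_continuous: "schwartz \<phi> \<Longrightarrow> continuous_on UNIV \<phi>"
  using schwartz_differentiable differentiable_imp_continuous_within
  by (metis continuous_at_imp_continuous_on)

lemma schwartz_borel [measurable_dest]: "schwartz \<phi> \<Longrightarrow> \<phi> \<in> borel_measurable borel"
  by (intro borel_measurable_continuous_onI schwartz_continuous)

lemma power_one_plus_le:
  fixes s :: real
  assumes "s \<ge> 0" shows "(1 + s) ^ k \<le> 2 ^ k * (1 + s ^ k)"
proof (cases "s \<le> 1")
  case True
  have "(1 + s) ^ k \<le> 2 ^ k" using True assms by (intro power_mono) auto
  also have "\<dots> \<le> 2 ^ k * (1 + s ^ k)" using assms by simp
  finally show ?thesis .
next
  case False
  have "(1 + s) ^ k \<le> (2 * s) ^ k" using False assms by (intro power_mono) auto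
  also have "\<dots> \<le> 2 ^ k * (1 + s ^ k)" by (simp add: power_mult_distrib)
  finally show ?thesis .
qed

text \<open>
  The decay conditions of order \<open>0\<close> and \<open>2 d\<close> suffice, since \<open>(1 + s)\<^sup>d \<le> 2\<^sup>d (1 + s\<^sup>d)\<close>.
\<close>

lemma schwartz_weight_bound:
  fixes \<phi> :: "'n::finite cfun"
  assumes "schwartz \<phi>"
  obtains C where "\<And>x. norm (\<phi> x) * weight x \<le> C"
proof -
  let ?d = "CARD('n)"
  have "\<exists>C. \<forall>x. norm x ^ k * norm (\<phi> x) \<le> C" for k
    using assms unfolding schwartz_def by (metis iterated_partial.simps(1))
  from this[of 0] this[of "2 * ?d"]
  obtain C0 C1 where C: "\<And>x. norm (\<phi> x) \<le> C0" "\<And>x. norm x ^ (2 * ?d) * norm (\<phi> x) \<le> C1"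
    by auto
  have "norm (\<phi> x) * weight x \<le> 2 ^ ?d * (C0 + C1)" for x
  proof -
    have "norm (\<phi> x) * weight x \<le> norm (\<phi> x) * (2 ^ ?d * (1 + norm x ^ (2 * ?d)))"
      unfolding weight_def power_mult by (intro mult_left_mono power_one_plus_le) auto
    also have "\<dots> = 2 ^ ?d * (norm (\<phi> x) + norm x ^ (2 * ?d) * norm (\<phi> x))"
      by (simp add: algebra_simps)
    also have "\<dots> \<le> 2 ^ ?d * (C0 + C1)"
      by (intro mult_left_mono add_mono C) auto
    finally show ?thesis .
  qed
  then show ?thesis using that by blast
qed

lemma schwartz_integrable: "schwartz \<phi> \<Longrightarrow> integrable lborel (\<phi> :: 'n::finite cfun)"
  by (metis integrable_of_weight_bound schwartz_borel schwartz_weight_bound)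

text \<open>
  A shift by at most one changes the weight by a bounded factor only. This gives an integrable
  majorant for the difference quotients of a Schwartz function.
\<close>

lemma weight_near:
  fixes x y :: "real^'n::finite"
  assumes "norm (y - x) \<le> 1" shows "weight x \<le> 3 ^ CARD('n) * weight y"
proof -
  have *: "a \<le> 2 * b + 2 \<Longrightarrow> 1 + a \<le> 3 * (1 + b)" if "b \<ge> 0" for a b :: real
    using that by simp
  have "norm x \<le> norm y + 1"
    using assms norm_triangle_ineq2[of x y] by (simp add: norm_minus_commute)
  then have "(norm x)\<^sup>2 \<le> (norm y + 1)\<^sup>2" by (intro power_mono) auto
  also have "\<dots> \<le> 2 * (norm y)\<^sup>2 + 2"
    using sum_squares_bound[of "norm y" 1] by (simp add: power2_sum)
  finally have "1 + (norm x)\<^sup>2 \<le> 3 * (1 + (norm y)\<^sup>2)"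
    by (intro *) simp_all
  then have "weight x \<le> (3 * (1 + (norm y)\<^sup>2)) ^ CARD('n)"
    unfolding weight_def by (intro power_mono) (simp_all only: add_nonneg_nonneg zero_le_power2 zero_le_one)
  also have "\<dots> = 3 ^ CARD('n) * weight y" unfolding weight_def by (rule power_mult_distrib)
  finally show ?thesis .
qed

lemma schwartz_line_derivative:
  fixes \<phi> :: "'n::finite cfun"
  assumes "schwartz \<phi>"
  shows "((\<lambda>s. \<phi> (x + s *\<^sub>R axis j 1)) has_vector_derivative
      iterated_partial [j] \<phi> (x + s *\<^sub>R axis j 1)) (at s within S)"
proof -
  let ?D = "frechet_derivative \<phi> (at (x + s *\<^sub>R axis j 1))"
  have D: "(\<phi> has_derivative ?D) (at (x + s *\<^sub>R axis j 1))"
    using schwartz_differentiable[OF assms] frechet_derivative_works by blast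
  have "((\<lambda>s. x + s *\<^sub>R axis j 1) has_derivative (\<lambda>h. h *\<^sub>R axis j 1)) (at s within S)"
    by (auto intro!: derivative_eq_intros)
  from has_derivative_compose[OF this D]
  have "((\<lambda>s. \<phi> (x + s *\<^sub>R axis j 1)) has_derivative (\<lambda>h. ?D (h *\<^sub>R axis j 1))) (at s within S)" .
  moreover have "?D (h *\<^sub>R axis j 1) = h *\<^sub>R ?D (axis j 1)" for h
    using has_derivative_bounded_linear[OF D] by (simp add: linear_simps)
  ultimately show ?thesis
    by (simp add: has_vector_derivative_def)
qed

lemma fourier_norm_le: "norm (fourier \<phi> \<xi>) \<le> (\<integral>x. norm (\<phi> x) \<partial>lborel)"
proof -
  have "norm (fourier \<phi> \<xi>) \<le> (\<integral>x. norm (exp (- \<i> * complex_of_real (x \<bullet> \<xi>)) * \<phi> x) \<partial>lborel)"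
    unfolding fourier_def by (rule integral_norm_bound)
  then show ?thesis by (simp add: norm_mult)
qed

lemma fourier_borel [measurable]:
  assumes [measurable]: "\<phi> \<in> borel_measurable borel"
  shows "fourier \<phi> \<in> borel_measurable borel"
  unfolding fourier_def[abs_def] by measurable

text \<open>
  Instead of integrating by parts one coordinate at a time, the difference quotient of a translate is
  transformed: a translation by \<open>h\<close> multiplies the transform by \<open>exp (\<i> h \<xi>\<^sub>j)\<close>, and dominated
  convergence allows \<open>h \<rightarrow> 0\<close>.
\<close>

lemma fourier_partial:
  fixes \<phi> :: "'n::finite cfun"
  assumes \<phi>: "schwartz \<phi>"
  shows "fourier (iterated_partial [j] \<phi>) \<xi> = \<i> * of_real (\<xi> $ j) * fourier \<phi> \<xi>"
proof -
  let ?e = "axis j 1 :: real^'n"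
  let ?p = "iterated_partial [j] \<phi>"
  define h where "h n = inverse (real (Suc n))" for n
  have h0: "h \<longlonglongrightarrow> 0" unfolding h_def by (rule LIMSEQ_inverse_real_of_nat)
  have hp: "h n > 0" "h n \<le> 1" for n by (auto simp: h_def inverse_le_1_iff)
  define D where "D n x = (\<phi> (x + h n *\<^sub>R ?e) - \<phi> x) /\<^sub>R h n" for n x
  have sp: "schwartz ?p" by (rule schwartz_iterated_partial[OF \<phi>])
  note [measurable] = schwartz_borel[OF \<phi>] schwartz_borel[OF sp]
  have Dlim: "(\<lambda>n. D n x) \<longlonglongrightarrow> ?p x" for x
  proof -
    have "((\<lambda>s. \<phi> (x + s *\<^sub>R ?e)) has_vector_derivative ?p (x + 0 *\<^sub>R ?e)) (at 0)"
      by (rule schwartz_line_derivative[OF \<phi>])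
    then have "(\<lambda>s. norm (\<phi> (x + s *\<^sub>R ?e) - \<phi> x - s *\<^sub>R ?p x) / norm s) \<midarrow>0\<rightarrow> 0"
      by (simp add: has_vector_derivative_def has_derivative_at)
    moreover have "norm (\<phi> (x + s *\<^sub>R ?e) - \<phi> x - s *\<^sub>R ?p x) / norm s
        = norm ((\<phi> (x + s *\<^sub>R ?e) - \<phi> x) /\<^sub>R s - ?p x)" if "s \<noteq> 0" for s
    proof -
      have "(\<phi> (x + s *\<^sub>R ?e) - \<phi> x) /\<^sub>R s - ?p x = (\<phi> (x + s *\<^sub>R ?e) - \<phi> x - s *\<^sub>R ?p x) /\<^sub>R s"
        using that by (simp add: scaleR_right_diff_distrib)
      then show ?thesis by (simp add: divide_inverse mult.commute)
    qed
    ultimately have "(\<lambda>s. norm ((\<phi> (x + s *\<^sub>R ?e) - \<phi> x) /\<^sub>R s - ?p x)) \<midarrow>0\<rightarrow> 0"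
      by (subst (asm) tendsto_cong[of _ "\<lambda>s. norm ((\<phi> (x + s *\<^sub>R ?e) - \<phi> x) /\<^sub>R s - ?p x)"])
        (auto simp: eventually_at_filter)
    then have L: "((\<lambda>s. (\<phi> (x + s *\<^sub>R ?e) - \<phi> x) /\<^sub>R s) \<longlongrightarrow> ?p x) (at 0)"
      by (rule LIM_zero_cancel[OF tendsto_norm_zero_cancel])
    have "filterlim h (at 0) sequentially"
      using h0 hp by (auto simp: filterlim_at intro!: always_eventually) (metis less_irrefl)
    from filterlim_compose[OF L this] show ?thesis by (simp add: D_def)
  qed
  obtain C where C: "\<And>x. norm (?p x) * weight x \<le> C"
    using schwartz_weight_bound[OF sp] by blast
  have Dbound: "norm (D n x) \<le> (C * 3 ^ CARD('n)) * (1 / weight x)" for n x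
  proof -
    let ?B = "(C * 3 ^ CARD('n)) * (1 / weight x)"
    have pB: "norm (?p (x + s *\<^sub>R ?e)) \<le> ?B" if "s \<in> {0..h n}" for s
    proof -
      have "weight x \<le> 3 ^ CARD('n) * weight (x + s *\<^sub>R ?e)"
        using that hp[of n] by (intro weight_near) (auto simp: norm_axis_1)
      then have "norm (?p (x + s *\<^sub>R ?e)) * weight x
          \<le> norm (?p (x + s *\<^sub>R ?e)) * (3 ^ CARD('n) * weight (x + s *\<^sub>R ?e))"
        by (intro mult_left_mono) auto
      also have "\<dots> = 3 ^ CARD('n) * (norm (?p (x + s *\<^sub>R ?e)) * weight (x + s *\<^sub>R ?e))" by simp
      also have "\<dots> \<le> 3 ^ CARD('n) * C" by (intro mult_left_mono C) auto
      finally show ?thesis using weight_pos[of x] by (simp add: field_simps)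
    qed
    have "norm (\<phi> (x + h n *\<^sub>R ?e) - \<phi> (x + 0 *\<^sub>R ?e)) \<le> ?B * norm (h n - 0)"
    proof (rule differentiable_bound[of "{0..h n}" "\<lambda>s. \<phi> (x + s *\<^sub>R ?e)"
          "\<lambda>s u. u *\<^sub>R ?p (x + s *\<^sub>R ?e)"])
      show "((\<lambda>s. \<phi> (x + s *\<^sub>R ?e)) has_derivative (\<lambda>u. u *\<^sub>R ?p (x + s *\<^sub>R ?e)))
          (at s within {0..h n})" for s
        using schwartz_line_derivative[OF \<phi>, of x j s "{0..h n}"]
        by (simp add: has_vector_derivative_def)
      show "onorm (\<lambda>u. u *\<^sub>R ?p (x + s *\<^sub>R ?e)) \<le> ?B" if "s \<in> {0..h n}" for s
        using mult_left_mono[OF pB[OF that] abs_ge_zero] by (intro onorm_le) (simp only: norm_scaleR real_norm_def mult.commute)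
    qed (use hp[of n] in auto)
    then have "norm (\<phi> (x + h n *\<^sub>R ?e) - \<phi> x) / h n \<le> ?B"
      using hp[of n] by (simp add: divide_le_eq)
    then show ?thesis
      using hp[of n] by (simp add: D_def divide_inverse mult.commute)
  qed
  have "(\<lambda>n. \<integral>x. exp (- \<i> * complex_of_real (x \<bullet> \<xi>)) * D n x \<partial>lborel)
      \<longlonglongrightarrow> (\<integral>x. exp (- \<i> * complex_of_real (x \<bullet> \<xi>)) * ?p x \<partial>lborel)"
  proof (rule integral_dominated_convergence[where w = "\<lambda>x. (C * 3 ^ CARD('n)) * (1 / weight x)"])
    show "integrable lborel (\<lambda>x::real^'n. (C * 3 ^ CARD('n)) * (1 / weight x))"
      by (intro integrable_mult_right integrable_inverse_weight)
    show "AE x in lborel. (\<lambda>n. exp (- \<i> * complex_of_real (x \<bullet> \<xi>)) * D n x)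
        \<longlonglongrightarrow> exp (- \<i> * complex_of_real (x \<bullet> \<xi>)) * ?p x"
      by (intro AE_I2 tendsto_intros Dlim)
    show "AE x in lborel. norm (exp (- \<i> * complex_of_real (x \<bullet> \<xi>)) * D n x)
        \<le> (C * 3 ^ CARD('n)) * (1 / weight x)" for n
      using Dbound[of n] by (intro AE_I2) (simp add: norm_mult)
    show "(\<lambda>x. exp (- \<i> * complex_of_real (x \<bullet> \<xi>)) * D n x) \<in> borel_measurable lborel" for n
      unfolding D_def by measurable
  qed measurable
  then have lim1: "(\<lambda>n. \<integral>x. exp (- \<i> * complex_of_real (x \<bullet> \<xi>)) * D n x \<partial>lborel)
      \<longlonglongrightarrow> fourier ?p \<xi>" by (simp add: fourier_def)
  let ?g = "\<lambda>x. exp (- \<i> * complex_of_real (x \<bullet> \<xi>)) * \<phi> x"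
  have gi: "integrable lborel ?g"
    by (intro integrable_cexp_mult schwartz_integrable \<phi>)
  have eq: "(\<integral>x. exp (- \<i> * complex_of_real (x \<bullet> \<xi>)) * D n x \<partial>lborel)
      = ((exp (\<i> * of_real (\<xi> $ j) * of_real (h n)) - 1) / of_real (h n)) * fourier \<phi> \<xi>" for n
  proof -
    let ?E = "exp (\<i> * of_real (\<xi> $ j) * of_real (h n)) :: complex"
    have "exp (- \<i> * complex_of_real (x \<bullet> \<xi>)) * D n x
        = (?E * ?g (h n *\<^sub>R ?e + 1 *\<^sub>R x) - ?g x) / of_real (h n)" for x
    proof -
      have "?E * exp (- \<i> * complex_of_real ((h n *\<^sub>R ?e + x) \<bullet> \<xi>)) = exp (- \<i> * complex_of_real (x \<bullet> \<xi>))"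
        by (simp add: inner_add_left inner_axis' algebra_simps flip: exp_add)
      then have A: "?E * ?g (h n *\<^sub>R ?e + 1 *\<^sub>R x) = exp (- \<i> * complex_of_real (x \<bullet> \<xi>)) * \<phi> (x + h n *\<^sub>R ?e)"
        by (simp add: add.commute flip: mult.assoc)
      have d: "D n x = (\<phi> (x + h n *\<^sub>R ?e) - \<phi> x) / of_real (h n)"
        by (simp add: D_def scaleR_conv_of_real[of _ "_ :: complex"] divide_inverse mult.commute)
      show ?thesis
        unfolding A d by (simp only: right_diff_distrib times_divide_eq_right)
    qed
    then have "(\<integral>x. exp (- \<i> * complex_of_real (x \<bullet> \<xi>)) * D n x \<partial>lborel)
        = (\<integral>x. (?E * ?g (h n *\<^sub>R ?e + 1 *\<^sub>R x) - ?g x) / of_real (h n) \<partial>lborel)"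
      by simp
    also have "\<dots> = (?E * (\<integral>x. ?g (h n *\<^sub>R ?e + 1 *\<^sub>R x) \<partial>lborel) - (\<integral>x. ?g x \<partial>lborel)) / of_real (h n)"
      using integrable_lborel_affine[OF gi, of 1 "h n *\<^sub>R ?e"] gi by simp
    also have "(\<integral>x. ?g (h n *\<^sub>R ?e + 1 *\<^sub>R x) \<partial>lborel) = (\<integral>x. ?g x \<partial>lborel)"
      by (subst integral_lborel_affine[OF gi]) auto
    also have "(\<integral>x. ?g x \<partial>lborel) = fourier \<phi> \<xi>" by (simp add: fourier_def)
    finally show ?thesis by (simp add: algebra_simps diff_divide_distrib)
  qed
  have "((\<lambda>s. exp (\<i> * of_real (\<xi> $ j) * s)) has_field_derivative \<i> * of_real (\<xi> $ j)) (at 0)"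
    by (auto intro!: derivative_eq_intros)
  then have L: "((\<lambda>s. (exp (\<i> * of_real (\<xi> $ j) * s) - 1) / s) \<longlongrightarrow> \<i> * of_real (\<xi> $ j)) (at (0::complex))"
    by (simp add: DERIV_def)
  have "filterlim (\<lambda>n. complex_of_real (h n)) (at 0) sequentially"
    using h0 hp tendsto_of_real[OF h0, where 'a=complex]
    by (auto simp: filterlim_at intro!: always_eventually) (metis less_irrefl)
  from filterlim_compose[OF L this]
  have "(\<lambda>n. ((exp (\<i> * of_real (\<xi> $ j) * of_real (h n)) - 1) / of_real (h n)) * fourier \<phi> \<xi>)
      \<longlonglongrightarrow> \<i> * of_real (\<xi> $ j) * fourier \<phi> \<xi>"
    by (intro tendsto_mult_right)
  with lim1 show ?thesis
    unfolding eq using LIMSEQ_unique by blast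
qed

lemma fourier_iterated_partial:
  "schwartz \<phi> \<Longrightarrow> fourier (iterated_partial (replicate k j) \<phi>) \<xi> = (\<i> * of_real (\<xi> $ j)) ^ k * fourier \<phi> \<xi>"
proof (induction k)
  case (Suc k)
  have "iterated_partial (replicate (Suc k) j) \<phi> = iterated_partial [j] (iterated_partial (replicate k j) \<phi>)"
    by simp
  then show ?case
    using fourier_partial[OF schwartz_iterated_partial[OF Suc.prems], of j "replicate k j" \<xi>] Suc
    by (simp del: iterated_partial.simps)
qed simp

text \<open>
  It reduces decay of the transform to pure derivatives \<open>\<partial>\<^sub>j\<^sup>2\<^sup>d\<close> in a single coordinate: the largest
  coordinate alone controls the weight.
\<close>

lemma weight_le_coordinates:
  fixes \<xi> :: "real^'n::finite"
  shows "weight \<xi> \<le> (1 + CARD('n)) ^ CARD('n) * (1 + (\<Sum>j\<in>UNIV. \<bar>\<xi> $ j\<bar> ^ (2 * CARD('n))))"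
proof -
  let ?d = "CARD('n)"
  obtain k where k: "\<And>j. \<bar>\<xi> $ j\<bar> \<le> \<bar>\<xi> $ k\<bar>"
  proof -
    have "Max (range (\<lambda>j. \<bar>\<xi> $ j\<bar>)) \<in> range (\<lambda>j. \<bar>\<xi> $ j\<bar>)"
      by (intro Max_in) auto
    then obtain k where "Max (range (\<lambda>j. \<bar>\<xi> $ j\<bar>)) = \<bar>\<xi> $ k\<bar>" by (elim imageE)
    then show ?thesis using that[of k] Max_ge[of "range (\<lambda>j. \<bar>\<xi> $ j\<bar>)"] by auto
  qed
  have "(norm \<xi>)\<^sup>2 \<le> (\<Sum>j\<in>(UNIV::'n set). (\<xi> $ k)\<^sup>2)"
    unfolding norm_sq_vec by (intro sum_mono) (use k in \<open>simp add: abs_le_square_iff\<close>)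
  then have n: "(norm \<xi>)\<^sup>2 \<le> ?d * (\<xi> $ k)\<^sup>2" by simp
  have S: "((\<xi> $ k)\<^sup>2) ^ ?d \<le> (\<Sum>j\<in>UNIV. \<bar>\<xi> $ j\<bar> ^ (2 * ?d))"
    using member_le_sum[of k UNIV "\<lambda>j. \<bar>\<xi> $ j\<bar> ^ (2 * ?d)"] by (simp add: power_mult)
  define m where "m = max 1 ((\<xi> $ k)\<^sup>2)"
  have "1 + (norm \<xi>)\<^sup>2 \<le> (1 + ?d) * m"
  proof -
    have "?d * (\<xi> $ k)\<^sup>2 \<le> ?d * m" by (intro mult_left_mono) (auto simp: m_def)
    moreover have "1 \<le> m" by (simp add: m_def)
    ultimately have "1 + (norm \<xi>)\<^sup>2 \<le> m + ?d * m" using n by linarith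
    then show ?thesis by (simp add: algebra_simps)
  qed
  then have "weight \<xi> \<le> ((1 + ?d) * m) ^ ?d"
    unfolding weight_def by (intro power_mono) auto
  also have "\<dots> = (1 + ?d) ^ ?d * m ^ ?d" by (simp add: power_mult_distrib)
  also have "m ^ ?d \<le> 1 + (\<Sum>j\<in>UNIV. \<bar>\<xi> $ j\<bar> ^ (2 * ?d))"
  proof (cases "(\<xi> $ k)\<^sup>2 \<le> 1")
    case True then show ?thesis by (simp add: m_def max_def sum_nonneg)
  next
    case False then show ?thesis using S by (simp add: m_def max_def)
  qed
  finally show ?thesis by (simp add: mult_left_mono)
qed

lemma fourier_schwartz_weight_bound:
  fixes \<phi> :: "'n::finite cfun"
  assumes \<phi>: "schwartz \<phi>"
  obtains C where "\<And>\<xi>. norm (fourier \<phi> \<xi>) * weight \<xi> \<le> C"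
proof -
  let ?d = "CARD('n)"
  define c where "c j = (\<integral>x. norm (iterated_partial (replicate (2 * ?d) j) \<phi> x) \<partial>lborel)" for j
  have j: "norm (fourier \<phi> \<xi>) * \<bar>\<xi> $ j\<bar> ^ (2 * ?d) \<le> c j" for j \<xi>
    using fourier_norm_le[of "iterated_partial (replicate (2 * ?d) j) \<phi>" \<xi>]
    by (simp add: fourier_iterated_partial[OF \<phi>] c_def norm_mult norm_power mult.commute)
  let ?C = "(1 + ?d) ^ ?d * ((\<integral>x. norm (\<phi> x) \<partial>lborel) + (\<Sum>j\<in>UNIV. c j))"
  have "norm (fourier \<phi> \<xi>) * weight \<xi> \<le> ?C" for \<xi>
  proof -
    have "norm (fourier \<phi> \<xi>) * weight \<xi> \<le> norm (fourier \<phi> \<xi>) *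
        ((1 + ?d) ^ ?d * (1 + (\<Sum>j\<in>UNIV. \<bar>\<xi> $ j\<bar> ^ (2 * ?d))))"
      by (intro mult_left_mono weight_le_coordinates) auto
    also have "\<dots> = (1 + ?d) ^ ?d * (norm (fourier \<phi> \<xi>) +
        (\<Sum>j\<in>UNIV. norm (fourier \<phi> \<xi>) * \<bar>\<xi> $ j\<bar> ^ (2 * ?d)))"
      by (simp add: sum_distrib_left algebra_simps)
    also have "\<dots> \<le> ?C"
      by (intro mult_left_mono add_mono sum_mono j fourier_norm_le) auto
    finally show ?thesis .
  qed
  then show ?thesis using that by blast
qed

lemma fourier_integrable: "schwartz \<phi> \<Longrightarrow> integrable lborel (fourier (\<phi> :: 'n::finite cfun))"
  by (metis fourier_borel fourier_schwartz_weight_bound integrable_of_weight_bound schwartz_borel)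

section \<open>Fourier inversion\<close>

lemma borel_measurable_exp_inner:
  fixes c :: complex
  shows "(\<lambda>(x :: 'a::euclidean_space, y). exp (c * complex_of_real (x \<bullet> y))) \<in> borel_measurable (borel \<Otimes>\<^sub>M borel)"
    and "(\<lambda>(x :: 'a, y). exp (c * complex_of_real (y \<bullet> x))) \<in> borel_measurable (borel \<Otimes>\<^sub>M borel)"
  unfolding borel_prod case_prod_unfold
  by (intro borel_measurable_continuous_onI continuous_intros)+

lemma std_gauss_minus [simp]: "std_gauss (- x) = std_gauss x"
  by (simp add: std_gauss_def)

lemma std_gauss_le_1: "std_gauss (x :: real^'n::finite) \<le> 1"
proof -
  have "exp (- (norm x)\<^sup>2 / 2) \<le> 1" by simp
  moreover have "sqrt (2 * pi) ^ CARD('n) \<ge> 1"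
    using pi_ge_two by (intro one_le_power) (simp add: real_le_rsqrt)
  ultimately have "exp (- (norm x)\<^sup>2 / 2) \<le> sqrt (2 * pi) ^ CARD('n)" by linarith
  then show ?thesis unfolding std_gauss_def by (simp add: divide_le_eq)
qed

text \<open>
  Gaussians are an approximate identity at every point of continuity. This is used three times: for
  Fourier inversion, for recovering a function from its Gaussian averages, and for evaluating a
  multiplier on wave packets.
\<close>

lemma gauss_average_tendsto:
  fixes g :: "real^'n::finite \<Rightarrow> complex"
  assumes [measurable]: "g \<in> borel_measurable borel"
    and bound: "\<And>x. norm (g x) \<le> B" and cont: "isCont g \<xi>" and \<sigma>: "\<sigma> \<longlonglongrightarrow> 0"
  shows "(\<lambda>n. \<integral>\<eta>. g (\<xi> + \<sigma> n *\<^sub>R \<eta>) * of_real (std_gauss \<eta>) \<partial>lborel) \<longlonglongrightarrow> g \<xi>"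
proof -
  have "(\<lambda>n. \<integral>\<eta>. g (\<xi> + \<sigma> n *\<^sub>R \<eta>) * of_real (std_gauss \<eta>) \<partial>lborel)
      \<longlonglongrightarrow> (\<integral>\<eta>. g \<xi> * of_real (std_gauss (\<eta> :: real^'n)) \<partial>lborel)"
  proof (rule integral_dominated_convergence[where w = "\<lambda>\<eta>. B * std_gauss \<eta>"])
    show "integrable lborel (\<lambda>\<eta>::real^'n. B * std_gauss \<eta>)"
      by (intro integrable_mult_right integrable_std_gauss)
    have "(\<lambda>n. g (\<xi> + \<sigma> n *\<^sub>R \<eta>)) \<longlonglongrightarrow> g \<xi>" for \<eta>
    proof -
      have "(\<lambda>n. \<xi> + \<sigma> n *\<^sub>R \<eta>) \<longlonglongrightarrow> \<xi> + 0 *\<^sub>R \<eta>"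
        by (intro tendsto_intros \<sigma>)
      then show ?thesis using isCont_tendsto_compose[OF cont] by simp
    qed
    then show "AE \<eta> in lborel. (\<lambda>n. g (\<xi> + \<sigma> n *\<^sub>R \<eta>) * of_real (std_gauss \<eta>))
        \<longlonglongrightarrow> g \<xi> * of_real (std_gauss \<eta>)"
      by (intro AE_I2 tendsto_mult_right)
    have "norm (g (\<xi> + \<sigma> n *\<^sub>R \<eta>) * of_real (std_gauss \<eta>)) \<le> B * std_gauss \<eta>" for n \<eta>
      using std_gauss_pos[of \<eta>] bound by (simp add: norm_mult mult_right_mono)
    then show "AE \<eta> in lborel. norm (g (\<xi> + \<sigma> n *\<^sub>R \<eta>) * of_real (std_gauss \<eta>)) \<le> B * std_gauss \<eta>" for n
      by (intro AE_I2)
  qed measurable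
  moreover have "(\<integral>\<eta>. g \<xi> * of_real (std_gauss (\<eta> :: real^'n)) \<partial>lborel) = g \<xi>"
    by (simp only: integral_mult_right_zero integral_complex_of_real integral_std_gauss of_real_1 mult_1_right)
  ultimately show ?thesis by (simp only:)
qed

lemma gauss_rescale:
  fixes g :: "real^'n::finite \<Rightarrow> complex"
  assumes [measurable]: "g \<in> borel_measurable borel"
    and bound: "\<And>x. norm (g x) \<le> B" and \<sigma>: "\<sigma> > 0"
  shows "integrable lborel (\<lambda>x. g x * of_real (std_gauss ((1 / \<sigma>) *\<^sub>R (x - y))))"
    and "(\<integral>x. g x * of_real (std_gauss ((1 / \<sigma>) *\<^sub>R (x - y))) \<partial>lborel)
      = of_real (\<sigma> ^ CARD('n)) * (\<integral>\<eta>. g (y + \<sigma> *\<^sub>R \<eta>) * of_real (std_gauss \<eta>) \<partial>lborel)"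
proof -
  let ?h = "\<lambda>\<eta>. g (y + \<sigma> *\<^sub>R \<eta>) * of_real (std_gauss \<eta>)"
  have h: "integrable lborel ?h"
  proof (rule Bochner_Integration.integrable_bound)
    show "integrable lborel (\<lambda>\<eta>::real^'n. B * std_gauss \<eta>)"
      by (intro integrable_mult_right integrable_std_gauss)
    show "AE \<eta> in lborel. norm (?h \<eta>) \<le> norm (B * std_gauss \<eta>)"
    proof (rule AE_I2)
      fix \<eta> :: "real^'n"
      have "norm (?h \<eta>) \<le> B * std_gauss \<eta>"
        using std_gauss_pos[of \<eta>] bound by (simp add: norm_mult mult_right_mono)
      also have "\<dots> \<le> norm (B * std_gauss \<eta>)" unfolding real_norm_def by (rule abs_ge_self)
      finally show "norm (?h \<eta>) \<le> norm (B * std_gauss \<eta>)" .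
    qed
  qed measurable
  have e: "?h (- (1 / \<sigma>) *\<^sub>R y + (1 / \<sigma>) *\<^sub>R x) = g x * of_real (std_gauss ((1 / \<sigma>) *\<^sub>R (x - y)))" for x
  proof -
    have "y + \<sigma> *\<^sub>R (- (1 / \<sigma>) *\<^sub>R y + (1 / \<sigma>) *\<^sub>R x) = x"
      using \<sigma> by (simp add: scaleR_right_distrib scaleR_right_diff_distrib)
    moreover have "- (1 / \<sigma>) *\<^sub>R y + (1 / \<sigma>) *\<^sub>R x = (1 / \<sigma>) *\<^sub>R (x - y)"
      by (simp add: scaleR_right_diff_distrib)
    ultimately show ?thesis by simp
  qed
  have c: "1 / \<sigma> \<noteq> 0" using \<sigma> by simp
  show "integrable lborel (\<lambda>x. g x * of_real (std_gauss ((1 / \<sigma>) *\<^sub>R (x - y))))"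
    using integrable_lborel_affine[OF h c, of "- (1 / \<sigma>) *\<^sub>R y"] unfolding e .
  show "(\<integral>x. g x * of_real (std_gauss ((1 / \<sigma>) *\<^sub>R (x - y))) \<partial>lborel)
      = of_real (\<sigma> ^ CARD('n)) * (\<integral>\<eta>. ?h \<eta> \<partial>lborel)"
    using integral_lborel_affine[OF h c, of "- (1 / \<sigma>) *\<^sub>R y"] \<sigma> unfolding e
    by (simp add: power_divide scaleR_conv_of_real)
qed

lemma fourier_modulated_gauss:
  fixes z :: "real^'n::finite"
  assumes \<sigma>: "\<sigma> > 0"
  shows "(\<integral>x. iexp (x \<bullet> z) * of_real (std_gauss ((1 / \<sigma>) *\<^sub>R (x - y))) \<partial>lborel)
     = of_real (\<sigma> ^ CARD('n)) * iexp (y \<bullet> z) * of_real (exp (- (\<sigma> * norm z)\<^sup>2 / 2))"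
proof -
  have "(\<integral>x. iexp (x \<bullet> z) * of_real (std_gauss ((1 / \<sigma>) *\<^sub>R (x - y))) \<partial>lborel)
     = of_real (\<sigma> ^ CARD('n)) *
       (\<integral>\<eta>. iexp ((y + \<sigma> *\<^sub>R \<eta>) \<bullet> z) * of_real (std_gauss \<eta>) \<partial>lborel)"
    by (rule gauss_rescale[where B=1]) (use \<sigma> in auto)
  also have "(\<lambda>\<eta>. iexp ((y + \<sigma> *\<^sub>R \<eta>) \<bullet> z) * of_real (std_gauss \<eta>))
     = (\<lambda>\<eta>. iexp (y \<bullet> z) *
          (iexp (\<eta> \<bullet> (\<sigma> *\<^sub>R z)) * of_real (std_gauss \<eta>)))"
    by (simp add: fun_eq_iff inner_add_left distrib_left exp_add)
  also have "(\<integral>\<eta>. iexp (y \<bullet> z) *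
          (iexp (\<eta> \<bullet> (\<sigma> *\<^sub>R z)) * of_real (std_gauss \<eta>)) \<partial>lborel)
      = iexp (y \<bullet> z) * of_real (exp (- (norm (\<sigma> *\<^sub>R z))\<^sup>2 / 2))"
    unfolding integral_mult_right_zero fourier_std_gauss ..
  finally show ?thesis using \<sigma> by (simp add: mult.assoc)
qed

lemma sqrt_2pi_power: "sqrt (2 * pi) ^ k * sqrt (2 * pi) ^ k = (2 * pi) ^ k"
  by (subst power_mult_distrib[symmetric]) simp

lemma fourier_gauss_inverse:
  fixes z :: "real^'n::finite"
  assumes \<sigma>: "\<sigma> > 0"
  shows "(\<integral>x. iexp (x \<bullet> z) * of_real (exp (- (\<sigma> * norm x)\<^sup>2 / 2)) \<partial>lborel)
     = of_real ((2 * pi) ^ CARD('n) / \<sigma> ^ CARD('n) * std_gauss ((1 / \<sigma>) *\<^sub>R z))"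
proof -
  let ?s = "sqrt (2 * pi) ^ CARD('n)"
  have "of_real (exp (- (\<sigma> * norm x)\<^sup>2 / 2)) = of_real ?s * complex_of_real (std_gauss ((1 / (1 / \<sigma>)) *\<^sub>R (x - 0)))"
    for x :: "real^'n"
    using \<sigma> by (simp add: std_gauss_def power_mult_distrib)
  then have "(\<integral>x. iexp (x \<bullet> z) * of_real (exp (- (\<sigma> * norm x)\<^sup>2 / 2)) \<partial>lborel)
     = (\<integral>x. of_real ?s * (iexp (x \<bullet> z) *
          of_real (std_gauss ((1 / (1 / \<sigma>)) *\<^sub>R (x - 0)))) \<partial>lborel)"
    by (simp add: mult.left_commute)
  also have "\<dots> = of_real ?s * (of_real ((1 / \<sigma>) ^ CARD('n)) * of_real (exp (- ((1 / \<sigma>) * norm z)\<^sup>2 / 2)))"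
    using fourier_modulated_gauss[of "1 / \<sigma>" z 0] \<sigma> unfolding integral_mult_right_zero by simp
  also have "\<dots> = of_real (?s * ?s / \<sigma> ^ CARD('n) * std_gauss ((1 / \<sigma>) *\<^sub>R z))"
    using \<sigma> by (simp add: std_gauss_def power_divide)
  finally show ?thesis unfolding sqrt_2pi_power .
qed

text \<open>
  The integrand is damped by \<open>exp (- |\<sigma> x|\<^sup>2 / 2)\<close>. Fubini's theorem turns the damped integral into
  the average of \<open>\<phi>\<close> against a Gaussian of width \<open>\<sigma>\<close> around \<open>\<xi>\<close>; then \<open>\<sigma> \<rightarrow> 0\<close> on both sides.
\<close>

lemma schwartz_fourier_inversion:
  fixes \<phi> :: "'n::finite cfun"
  assumes \<phi>: "schwartz \<phi>"
  shows "(\<integral>x. iexp (x \<bullet> \<xi>) * fourier \<phi> x \<partial>lborel) = of_real ((2 * pi) ^ CARD('n)) * \<phi> \<xi>"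
proof -
  let ?P = "of_real ((2 * pi) ^ CARD('n)) :: complex"
  define \<sigma> where "\<sigma> n = inverse (real (Suc n))" for n
  have \<sigma>0: "\<sigma> \<longlonglongrightarrow> 0" unfolding \<sigma>_def by (rule LIMSEQ_inverse_real_of_nat)
  have \<sigma>p: "\<sigma> n > 0" for n by (simp add: \<sigma>_def)
  have [measurable]: "\<phi> \<in> borel_measurable borel" by (rule schwartz_borel[OF \<phi>])
  define A where "A n = (\<integral>x. iexp (x \<bullet> \<xi>) * fourier \<phi> x *
      of_real (exp (- (\<sigma> n * norm x)\<^sup>2 / 2)) \<partial>lborel)" for n
  have lim1: "A \<longlonglongrightarrow> (\<integral>x. iexp (x \<bullet> \<xi>) * fourier \<phi> x \<partial>lborel)"
    unfolding A_def
  proof (rule integral_dominated_convergence[where w = "\<lambda>x. norm (fourier \<phi> x)"])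
    show "integrable lborel (\<lambda>x. norm (fourier \<phi> x))"
      by (intro integrable_norm fourier_integrable \<phi>)
    have "(\<lambda>n. of_real (exp (- (\<sigma> n * norm x)\<^sup>2 / 2)) :: complex) \<longlonglongrightarrow> of_real (exp (- (0 * norm x)\<^sup>2 / 2))"
      for x :: "real^'n"
      by (intro tendsto_intros \<sigma>0) auto
    then have "(\<lambda>n. iexp (x \<bullet> \<xi>) * fourier \<phi> x * of_real (exp (- (\<sigma> n * norm x)\<^sup>2 / 2)))
        \<longlonglongrightarrow> iexp (x \<bullet> \<xi>) * fourier \<phi> x * of_real (exp (- (0 * norm x)\<^sup>2 / 2))" for x
      by (intro tendsto_mult_left)
    then show "AE x in lborel. (\<lambda>n. iexp (x \<bullet> \<xi>) * fourier \<phi> x *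
        of_real (exp (- (\<sigma> n * norm x)\<^sup>2 / 2))) \<longlonglongrightarrow> iexp (x \<bullet> \<xi>) * fourier \<phi> x"
      by simp
    show "AE x in lborel. norm (iexp (x \<bullet> \<xi>) * fourier \<phi> x *
        of_real (exp (- (\<sigma> n * norm x)\<^sup>2 / 2))) \<le> norm (fourier \<phi> x)" for n
      by (intro AE_I2) (simp add: norm_mult mult_left_le)
  qed measurable
  have eq: "A = (\<lambda>n. ?P * (\<integral>\<eta>. \<phi> (\<xi> + \<sigma> n *\<^sub>R \<eta>) * of_real (std_gauss \<eta>) \<partial>lborel))"
  proof
    fix n
    let ?f = "\<lambda>x. iexp (x \<bullet> \<xi>) * complex_of_real (exp (- (\<sigma> n * norm x)\<^sup>2 / 2))"
    have gi: "integrable lborel (\<lambda>x::real^'n. complex_of_real (exp (- (\<sigma> n * norm x)\<^sup>2 / 2)))"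
    proof -
      have "integrable lborel (\<lambda>x::real^'n. 1 * complex_of_real (std_gauss ((1 / (1 / \<sigma> n)) *\<^sub>R (x - 0))))"
        by (rule gauss_rescale[where B=1]) (use \<sigma>p in auto)
      then have "integrable lborel (\<lambda>x::real^'n. of_real (sqrt (2 * pi) ^ CARD('n)) *
          (1 * complex_of_real (std_gauss ((1 / (1 / \<sigma> n)) *\<^sub>R (x - 0)))))"
        by (rule integrable_mult_right)
      then show ?thesis using \<sigma>p[of n] by (simp add: std_gauss_def power_mult_distrib)
    qed
    have fi: "integrable lborel ?f" by (intro integrable_cexp_mult gi)
    have "A n = (\<integral>x. (\<integral>y. exp (- \<i> * complex_of_real (y \<bullet> x)) * \<phi> y \<partial>lborel) * ?f x \<partial>lborel)"
      unfolding A_def fourier_def by (simp add: mult_ac)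
    also have "\<dots> = (\<integral>y. \<phi> y * (\<integral>x. exp (- \<i> * complex_of_real (y \<bullet> x)) * ?f x \<partial>lborel) \<partial>lborel)"
      by (rule fubini_bounded_kernel(1)[OF fi schwartz_integrable[OF \<phi>]]) (auto simp: norm_exp_eq_Re intro!: borel_measurable_exp_inner[of "- \<i>", simplified] borel_measurable_exp_inner[of "\<i>"])
    also have "(\<lambda>y. \<integral>x. exp (- \<i> * complex_of_real (y \<bullet> x)) * ?f x \<partial>lborel)
        = (\<lambda>y. of_real ((2 * pi) ^ CARD('n) / \<sigma> n ^ CARD('n) * std_gauss ((1 / \<sigma> n) *\<^sub>R (\<xi> - y))))"
    proof
      fix y
      have "exp (- \<i> * complex_of_real (y \<bullet> x)) * ?f x
          = iexp (x \<bullet> (\<xi> - y)) * of_real (exp (- (\<sigma> n * norm x)\<^sup>2 / 2))" for x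
      proof -
        have "exp (- \<i> * complex_of_real (y \<bullet> x)) * iexp (x \<bullet> \<xi>)
            = iexp (x \<bullet> (\<xi> - y))"
          by (simp add: inner_diff_right inner_commute algebra_simps flip: exp_add)
        then show ?thesis by (simp only: mult.assoc[symmetric])
      qed
      then show "(\<integral>x. exp (- \<i> * complex_of_real (y \<bullet> x)) * ?f x \<partial>lborel)
          = of_real ((2 * pi) ^ CARD('n) / \<sigma> n ^ CARD('n) * std_gauss ((1 / \<sigma> n) *\<^sub>R (\<xi> - y)))"
        by (simp only: fourier_gauss_inverse[OF \<sigma>p[of n], of "\<xi> - y"])
    qed
    also have "(\<lambda>y. of_real ((2 * pi) ^ CARD('n) / \<sigma> n ^ CARD('n) * std_gauss ((1 / \<sigma> n) *\<^sub>R (\<xi> - y))))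
        = (\<lambda>y. ?P / of_real (\<sigma> n ^ CARD('n)) * of_real (std_gauss ((1 / \<sigma> n) *\<^sub>R (y - \<xi>))))"
    proof
      fix y
      have "std_gauss ((1 / \<sigma> n) *\<^sub>R (\<xi> - y)) = std_gauss ((1 / \<sigma> n) *\<^sub>R (y - \<xi>))"
        using std_gauss_minus[of "(1 / \<sigma> n) *\<^sub>R (y - \<xi>)"] by (simp flip: scaleR_minus_right)
      then show "of_real ((2 * pi) ^ CARD('n) / \<sigma> n ^ CARD('n) * std_gauss ((1 / \<sigma> n) *\<^sub>R (\<xi> - y)))
        = ?P / of_real (\<sigma> n ^ CARD('n)) * of_real (std_gauss ((1 / \<sigma> n) *\<^sub>R (y - \<xi>)))"
        by simp
    qed
    also have "(\<integral>y. \<phi> y * (?P / of_real (\<sigma> n ^ CARD('n)) * of_real (std_gauss ((1 / \<sigma> n) *\<^sub>R (y - \<xi>)))) \<partial>lborel)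
        = ?P / of_real (\<sigma> n ^ CARD('n)) * (\<integral>y. \<phi> y * of_real (std_gauss ((1 / \<sigma> n) *\<^sub>R (y - \<xi>))) \<partial>lborel)"
      unfolding integral_mult_right_zero[symmetric] by (simp only: mult_ac)
    also have "\<dots> = ?P * (\<integral>\<eta>. \<phi> (\<xi> + \<sigma> n *\<^sub>R \<eta>) * of_real (std_gauss \<eta>) \<partial>lborel)"
    proof -
      obtain C where C: "\<And>x. norm (\<phi> x) * weight x \<le> C" using schwartz_weight_bound[OF \<phi>] by blast
      have B: "norm (\<phi> x) \<le> C" for x
        using C[of x] mult_left_mono[OF weight_ge_1[of x], of "norm (\<phi> x)"] by simp
      show ?thesis
        by (subst gauss_rescale(2)[where B=C]) (use B \<sigma>p[of n] in auto)
    qed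
    finally show "A n = ?P * (\<integral>\<eta>. \<phi> (\<xi> + \<sigma> n *\<^sub>R \<eta>) * of_real (std_gauss \<eta>) \<partial>lborel)" .
  qed
  have lim2: "(\<lambda>n. ?P * (\<integral>\<eta>. \<phi> (\<xi> + \<sigma> n *\<^sub>R \<eta>) * of_real (std_gauss \<eta>) \<partial>lborel)) \<longlonglongrightarrow> ?P * \<phi> \<xi>"
  proof -
    obtain C where C: "\<And>x. norm (\<phi> x) * weight x \<le> C" using schwartz_weight_bound[OF \<phi>] by blast
    have B: "norm (\<phi> x) \<le> C" for x
      using C[of x] mult_left_mono[OF weight_ge_1[of x], of "norm (\<phi> x)"] by simp
    have "isCont \<phi> \<xi>" using schwartz_differentiable[OF \<phi>] differentiable_imp_continuous_within by blast
    then show ?thesis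
      by (intro tendsto_mult_left gauss_average_tendsto[where B=C] B \<sigma>0) auto
  qed
  have "A \<longlonglongrightarrow> ?P * \<phi> \<xi>"
    unfolding eq by (rule lim2)
  with lim1 show ?thesis by (rule LIMSEQ_unique)
qed

definition inv_fourier :: "'n::finite cfun \<Rightarrow> 'n cfun" where
  "inv_fourier F x = (\<integral>\<xi>. iexp (x \<bullet> \<xi>) * F \<xi> \<partial>lborel) / of_real ((2 * pi) ^ CARD('n))"

lemma inv_fourier_borel [measurable]:
  assumes [measurable]: "F \<in> borel_measurable borel"
  shows "inv_fourier F \<in> borel_measurable borel"
  unfolding inv_fourier_def[abs_def] by measurable

lemma inv_fourier_norm_le: "norm (inv_fourier F x) \<le> (\<integral>\<xi>. norm (F \<xi>) \<partial>lborel)"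
proof -
  have "norm (\<integral>\<xi>. iexp (x \<bullet> \<xi>) * F \<xi> \<partial>lborel)
      \<le> (\<integral>\<xi>. norm (iexp (x \<bullet> \<xi>) * F \<xi>) \<partial>lborel)"
    by (rule integral_norm_bound)
  also have "\<dots> = (\<integral>\<xi>. norm (F \<xi>) \<partial>lborel)" by (simp add: norm_mult)
  finally have *: "norm (\<integral>\<xi>. iexp (x \<bullet> \<xi>) * F \<xi> \<partial>lborel) \<le> (\<integral>\<xi>. norm (F \<xi>) \<partial>lborel)" .
  have "1 \<le> (2 * pi) ^ CARD('a)" using pi_ge_two by (intro one_le_power) simp
  then have "(\<integral>\<xi>. norm (F \<xi>) \<partial>lborel) * 1 \<le> (\<integral>\<xi>. norm (F \<xi>) \<partial>lborel) * (2 * pi) ^ CARD('a)"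
    by (intro mult_left_mono) auto
  with * show ?thesis by (simp add: inv_fourier_def norm_divide norm_power divide_le_eq norm_mult)
qed

lemma tempered_bounded:
  fixes f :: "'n::finite cfun"
  assumes [measurable]: "f \<in> borel_measurable borel" and B: "AE x in lborel. norm (f x) \<le> B"
  shows "tempered f"
  unfolding tempered_def
proof (intro conjI allI impI)
  fix \<phi> :: "'n cfun" assume \<phi>: "schwartz \<phi>"
  note [measurable] = schwartz_borel[OF \<phi>]
  show "integrable lborel (\<lambda>x. f x * \<phi> x)"
  proof (rule Bochner_Integration.integrable_bound)
    show "integrable lborel (\<lambda>x. of_real B * \<phi> x)"
      by (intro integrable_mult_right schwartz_integrable \<phi>)
    show "AE x in lborel. norm (f x * \<phi> x) \<le> norm (of_real B * \<phi> x)"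
      using B
    proof eventually_elim
      fix x assume "norm (f x) \<le> B"
      then show "norm (f x * \<phi> x) \<le> norm (of_real B * \<phi> x)"
        by (simp add: norm_mult mult_right_mono)
    qed
  qed measurable
qed simp

text \<open>
  Fubini's theorem moves the inverse transform from \<open>F\<close> to \<open>fourier \<phi>\<close>, where Fourier inversion for
  Schwartz functions applies.
\<close>

lemma is_fourier_transform_inv_fourier:
  fixes F f :: "'n::finite cfun"
  assumes [measurable]: "F \<in> borel_measurable borel" "f \<in> borel_measurable borel"
    and F: "\<And>\<xi>. norm (F \<xi>) * weight \<xi> \<le> C"
    and f: "AE x in lborel. f x = inv_fourier F x"
  shows "is_fourier_transform f F"
  unfolding is_fourier_transform_def
proof (intro conjI allI impI)
  have Fi: "integrable lborel F" by (rule integrable_of_weight_bound[OF _ F]) simp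
  have "AE x in lborel. norm (f x) \<le> (\<integral>\<xi>. norm (F \<xi>) \<partial>lborel)"
    using f by eventually_elim (simp add: inv_fourier_norm_le)
  then show "tempered f" by (rule tempered_bounded[rotated]) simp
  have "norm (F \<xi>) \<le> C" for \<xi>
    using F[of \<xi>] mult_left_mono[OF weight_ge_1[of \<xi>], of "norm (F \<xi>)"] by simp
  then show "tempered F" by (intro tempered_bounded[where B=C]) auto
  fix \<phi> :: "'n cfun" assume \<phi>: "schwartz \<phi>"
  note [measurable] = schwartz_borel[OF \<phi>]
  let ?P = "of_real ((2 * pi) ^ CARD('n)) :: complex"
  have "(\<integral>x. f x * fourier \<phi> x \<partial>lborel) = (\<integral>x. inv_fourier F x * fourier \<phi> x \<partial>lborel)"
    by (rule integral_cong_AE) (use f in auto)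
  also have "\<dots> = (\<integral>x. ((\<integral>\<xi>. iexp (x \<bullet> \<xi>) * F \<xi> \<partial>lborel) * fourier \<phi> x) / ?P \<partial>lborel)"
    by (simp add: inv_fourier_def)
  also have "\<dots> = (\<integral>x. (\<integral>\<xi>. iexp (x \<bullet> \<xi>) * F \<xi> \<partial>lborel) * fourier \<phi> x \<partial>lborel) / ?P"
    by (rule integral_divide_zero)
  also have "(\<integral>x. (\<integral>\<xi>. iexp (x \<bullet> \<xi>) * F \<xi> \<partial>lborel) * fourier \<phi> x \<partial>lborel)
      = (\<integral>\<xi>. F \<xi> * (\<integral>x. iexp (x \<bullet> \<xi>) * fourier \<phi> x \<partial>lborel) \<partial>lborel)"
    by (rule fubini_bounded_kernel(1)[OF fourier_integrable[OF \<phi>] Fi]) (auto simp: norm_exp_eq_Re intro!: borel_measurable_exp_inner[of "- \<i>", simplified] borel_measurable_exp_inner[of "\<i>"])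
  also have "\<dots> = (\<integral>\<xi>. ?P * (F \<xi> * \<phi> \<xi>) \<partial>lborel)"
    by (simp add: schwartz_fourier_inversion[OF \<phi>] mult.left_commute)
  finally show "(\<integral>x. f x * fourier \<phi> x \<partial>lborel) = (\<integral>\<xi>. F \<xi> * \<phi> \<xi> \<partial>lborel)"
    by simp
qed

section \<open>Gaussians as test functions\<close>

text \<open>
  Polynomial functions, given by closure rules so that closure under partial derivatives is an
  induction.
\<close>

inductive cpoly :: "'n::finite cfun \<Rightarrow> bool" where
  const: "cpoly (\<lambda>x. c)"
| coord: "cpoly (\<lambda>x. complex_of_real (x $ j))"
| add: "cpoly p \<Longrightarrow> cpoly q \<Longrightarrow> cpoly (\<lambda>x. p x + q x)"
| mult: "cpoly p \<Longrightarrow> cpoly q \<Longrightarrow> cpoly (\<lambda>x. p x * q x)"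

lemma cpoly_sum: "(\<And>i. i \<in> A \<Longrightarrow> cpoly (p i)) \<Longrightarrow> cpoly (\<lambda>x. \<Sum>i\<in>A. p i x)"
  by (induction A rule: infinite_finite_induct) (auto intro: cpoly.intros)

lemma cpoly_derivative:
  assumes "cpoly (p :: 'n::finite cfun)"
  obtains D where "\<And>x. (p has_derivative D x) (at x)" "\<And>v. cpoly (\<lambda>x. D x v)"
proof -
  have "\<exists>D. (\<forall>x. (p has_derivative D x) (at x)) \<and> (\<forall>v. cpoly (\<lambda>x. D x v))"
    using assms
  proof induction
    case (const c)
    show ?case by (intro exI[of _ "\<lambda>_ _. 0"]) (auto intro: cpoly.intros)
  next
    case (coord j)
    have "((\<lambda>x. complex_of_real (x $ j)) has_derivative (\<lambda>v. complex_of_real (v $ j))) (at x)" for x :: "real^'n"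
      by (intro bounded_linear_imp_has_derivative bounded_linear_compose[OF bounded_linear_of_real bounded_linear_vec_nth])
    then show ?case by (intro exI[of _ "\<lambda>_ v. complex_of_real (v $ j)"]) (auto intro: cpoly.intros)
  next
    case (add p q)
    then obtain D E where D: "\<And>x. (p has_derivative D x) (at x)" "\<And>v. cpoly (\<lambda>x. D x v)"
      "\<And>x. (q has_derivative E x) (at x)" "\<And>v. cpoly (\<lambda>x. E x v)" by metis
    show ?case
      by (intro exI[of _ "\<lambda>x v. D x v + E x v"] conjI allI cpoly.add has_derivative_add D)
  next
    case (mult p q)
    then obtain D E where D: "\<And>x. (p has_derivative D x) (at x)" "\<And>v. cpoly (\<lambda>x. D x v)"
      "\<And>x. (q has_derivative E x) (at x)" "\<And>v. cpoly (\<lambda>x. E x v)" by metis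
    show ?case
      by (intro exI[of _ "\<lambda>x v. p x * E x v + D x v * q x"] conjI allI cpoly.add cpoly.mult
          has_derivative_mult D mult.hyps)
  qed
  then show ?thesis using that by blast
qed

lemma cpoly_growth:
  assumes "cpoly (p :: 'n::finite cfun)"
  shows "\<exists>C m. \<forall>x. norm (p x) \<le> C * (1 + norm x) ^ m"
  using assms
proof induction
  case (const c)
  show ?case by (intro exI[of _ "norm c"] exI[of _ 0]) auto
next
  case (coord j)
  have "\<bar>x $ j\<bar> \<le> 1 * (1 + norm x) ^ 1" for x :: "real^'n"
    using component_le_norm_cart[of x j] by simp
  then show ?case by (intro exI[of _ 1] exI[of _ "1::nat"]) auto
next
  case (add p q)
  then obtain C m D k where b: "\<And>x. norm (p x) \<le> C * (1 + norm x) ^ m" "\<And>x. norm (q x) \<le> D * (1 + norm x) ^ k"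
    by blast
  have "norm (p x + q x) \<le> (\<bar>C\<bar> + \<bar>D\<bar>) * (1 + norm x) ^ (m + k)" for x
  proof -
    have "norm (p x + q x) \<le> C * (1 + norm x) ^ m + D * (1 + norm x) ^ k"
      using b by (meson add_mono norm_triangle_le)
    also have "\<dots> \<le> \<bar>C\<bar> * (1 + norm x) ^ (m + k) + \<bar>D\<bar> * (1 + norm x) ^ (m + k)"
      by (intro add_mono mult_mono power_increasing) auto
    finally show ?thesis by (simp add: algebra_simps)
  qed
  then show ?case by blast
next
  case (mult p q)
  then obtain C m D k where b: "\<And>x. norm (p x) \<le> C * (1 + norm x) ^ m" "\<And>x. norm (q x) \<le> D * (1 + norm x) ^ k"
    by blast
  have "norm (p x * q x) \<le> (C * D) * (1 + norm x) ^ (m + k)" for x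
  proof -
    have "norm (p x * q x) \<le> (C * (1 + norm x) ^ m) * (D * (1 + norm x) ^ k)"
      unfolding norm_mult using b by (intro mult_mono) (auto intro: order_trans[OF norm_ge_zero])
    then show ?thesis by (simp add: power_add mult_ac)
  qed
  then show ?case by blast
qed

text \<open>
  Products of a polynomial and the exponential of a polynomial are closed under partial derivatives.
  They decay if the exponent is dominated by a negative definite quadratic, because
  \<open>(1 + s)\<^sup>N \<le> exp (N s)\<close> only adds a linear term to the exponent.
\<close>

lemma schwartz_poly_exp:
  fixes p q :: "'n::finite cfun"
  assumes p: "cpoly p" and q: "cpoly q" and a: "a > 0"
    and decay: "\<And>x. Re (q x) \<le> - a * (norm x)\<^sup>2 + b * norm x"
  shows "schwartz (\<lambda>x. p x * exp (q x))"
proof -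
  obtain D where D: "\<And>x. (q has_derivative D x) (at x)" "\<And>v. cpoly (\<lambda>x. D x v)"
    using cpoly_derivative[OF q] by blast
  have step: "\<exists>s. cpoly s \<and> (\<lambda>x. frechet_derivative (\<lambda>x. r x * exp (q x)) (at x) v) = (\<lambda>x. s x * exp (q x))"
    and diff: "(\<lambda>x. r x * exp (q x)) differentiable (at x)"
    if r: "cpoly r" for r v x
  proof -
    obtain E where E: "\<And>x. (r has_derivative E x) (at x)" "\<And>v. cpoly (\<lambda>x. E x v)"
      using cpoly_derivative[OF r] by blast
    have d: "((\<lambda>x. r x * exp (q x)) has_derivative (\<lambda>v. r x * (exp (q x) * D x v) + E x v * exp (q x))) (at x)" for x
      by (intro has_derivative_mult E has_derivative_compose[OF D(1)])
        (use DERIV_exp has_field_derivative_imp_has_derivative in blast)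
    show "\<exists>s. cpoly s \<and> (\<lambda>x. frechet_derivative (\<lambda>x. r x * exp (q x)) (at x) v) = (\<lambda>x. s x * exp (q x))"
    proof (intro exI[of _ "\<lambda>x. r x * D x v + E x v"] conjI ext)
      show "cpoly (\<lambda>x. r x * D x v + E x v)" by (intro cpoly.intros r D E)
      show "frechet_derivative (\<lambda>x. r x * exp (q x)) (at x) v = (r x * D x v + E x v) * exp (q x)" for x
        using frechet_derivative_at[OF d[of x]] by (simp add: fun_eq_iff algebra_simps)
    qed
    show "(\<lambda>x. r x * exp (q x)) differentiable (at x)"
      using d differentiable_def by blast
  qed
  have iter: "\<exists>s. cpoly s \<and> iterated_partial js (\<lambda>x. p x * exp (q x)) = (\<lambda>x. s x * exp (q x))" for js
  proof (induction js)
    case Nil then show ?case using p by auto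
  next
    case (Cons j js)
    then show ?case using step[of _ "axis j 1"] by auto
  qed
  have bounded: "\<exists>C. \<forall>x. norm x ^ k * norm (s x * exp (q x)) \<le> C" if s: "cpoly s" for s k
  proof -
    obtain C m where C: "\<And>x. norm (s x) \<le> C * (1 + norm x) ^ m"
      using cpoly_growth[OF s] by blast
    have C0: "C \<ge> 0" using C[of 0] by (simp add: order_trans[OF norm_ge_zero])
    define N where "N = real (k + m)"
    have "norm x ^ k * norm (s x * exp (q x)) \<le> C * exp ((N + b)\<^sup>2 / (4 * a))" for x
    proof -
      let ?s = "norm x"
      have "norm x ^ k * norm (s x * exp (q x))
          \<le> (1 + ?s) ^ k * ((C * (1 + ?s) ^ m) * exp (- a * ?s\<^sup>2 + b * ?s))"
        unfolding norm_mult norm_exp_eq_Re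
        by (intro mult_mono power_mono C) (use decay C0 in auto)
      also have "\<dots> = C * ((1 + ?s) ^ (k + m) * exp (- a * ?s\<^sup>2 + b * ?s))"
        by (simp add: power_add mult_ac)
      also have "\<dots> \<le> C * (exp ?s ^ (k + m) * exp (- a * ?s\<^sup>2 + b * ?s))"
        by (intro mult_left_mono mult_right_mono power_mono C0) auto
      also have "exp ?s ^ (k + m) * exp (- a * ?s\<^sup>2 + b * ?s) = exp (- a * ?s\<^sup>2 + (N + b) * ?s)"
        by (simp add: N_def algebra_simps flip: exp_of_nat_mult exp_add)
      also have "- a * ?s\<^sup>2 + (N + b) * ?s \<le> (N + b)\<^sup>2 / (4 * a)"
      proof -
        have "0 \<le> (2 * a * ?s - (N + b))\<^sup>2" by simp
        then have "4 * a * (- a * ?s\<^sup>2 + (N + b) * ?s) \<le> (N + b)\<^sup>2"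
          by (simp add: power2_eq_square algebra_simps)
        then show ?thesis using a by (simp add: field_simps)
      qed
      finally show ?thesis using C0 by (simp add: mult_left_mono)
    qed
    then show ?thesis by blast
  qed
  show ?thesis
    unfolding schwartz_def
  proof (intro allI conjI)
    fix js
    obtain s where s: "cpoly s" and eq: "iterated_partial js (\<lambda>x. p x * exp (q x)) = (\<lambda>x. s x * exp (q x))"
      using iter by blast
    show "iterated_partial js (\<lambda>x. p x * exp (q x)) differentiable_on UNIV"
      unfolding eq using diff[OF s] by (simp add: differentiable_on_def)
    show "\<exists>C. \<forall>x. norm x ^ k * norm (iterated_partial js (\<lambda>x. p x * exp (q x)) x) \<le> C" for k
      unfolding eq by (rule bounded[OF s])
  qed
qed

text \<open>
  The bump of width \<open>\<sigma>\<close> around \<open>y\<close> is left without the factor \<open>1 / \<sigma>\<^sup>d\<close>; its integral is \<open>\<sigma>\<^sup>d\<close>.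
\<close>

definition gauss_bump :: "real \<Rightarrow> real^'n::finite \<Rightarrow> 'n cfun" where
  "gauss_bump \<sigma> y x = of_real (std_gauss ((1 / \<sigma>) *\<^sub>R (x - y)))"

lemma schwartz_gauss_exp:
  fixes z :: "'n::finite \<Rightarrow> complex"
  assumes a: "a > 0"
  shows "schwartz (\<lambda>x::real^'n. c * exp (- of_real (a * (norm x)\<^sup>2) + (\<Sum>j\<in>UNIV. z j * of_real (x $ j))))"
proof (rule schwartz_poly_exp[OF cpoly.const _ a])
  have n: "complex_of_real (a * (norm x)\<^sup>2) = of_real a * (\<Sum>j\<in>UNIV. of_real (x $ j) * of_real (x $ j))"
    for x :: "real^'n"
    unfolding norm_sq_vec by (simp add: power2_eq_square)
  have "(\<lambda>x::real^'n. - complex_of_real (a * (norm x)\<^sup>2) + (\<Sum>j\<in>UNIV. z j * of_real (x $ j)))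
      = (\<lambda>x. (- of_real a) * (\<Sum>j\<in>UNIV. of_real (x $ j) * of_real (x $ j)) + (\<Sum>j\<in>UNIV. z j * of_real (x $ j)))"
    by (simp only: n mult_minus_left)
  moreover have "cpoly \<dots>"
    by (intro cpoly.intros cpoly_sum)
  ultimately show "cpoly (\<lambda>x::real^'n. - complex_of_real (a * (norm x)\<^sup>2) + (\<Sum>j\<in>UNIV. z j * of_real (x $ j)))"
    by simp
  fix x :: "real^'n"
  have "Re (\<Sum>j\<in>UNIV. z j * of_real (x $ j)) \<le> (\<Sum>j\<in>UNIV. norm (z j) * norm x)"
    unfolding Re_sum
  proof (rule sum_mono)
    fix j
    have "Re (z j * of_real (x $ j)) \<le> norm (z j * of_real (x $ j))" by (rule complex_Re_le_cmod)
    also have "\<dots> \<le> norm (z j) * norm x"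
      using component_le_norm_cart[of x j] by (simp add: norm_mult mult_left_mono)
    finally show "Re (z j * of_real (x $ j)) \<le> norm (z j) * norm x" .
  qed
  then show "Re (- complex_of_real (a * (norm x)\<^sup>2) + (\<Sum>j\<in>UNIV. z j * of_real (x $ j)))
      \<le> - a * (norm x)\<^sup>2 + (\<Sum>j\<in>UNIV. norm (z j)) * norm x"
    by (simp add: sum_distrib_right)
qed

lemma sum_inner_of_real: "(\<Sum>j\<in>UNIV. c * of_real (y $ j) * of_real (x $ j)) = c * complex_of_real (y \<bullet> (x::real^'n::finite))"
  by (simp add: inner_vec_def sum_distrib_left mult.assoc)

lemma schwartz_modulated_gauss:
  fixes y :: "real^'n::finite"
  assumes "\<sigma> > 0"
  shows "schwartz (\<lambda>x. c * (exp (w * complex_of_real (y \<bullet> x)) * of_real (exp (- (\<sigma> * norm x)\<^sup>2 / 2))))"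
proof -
  have "schwartz (\<lambda>x::real^'n. c * exp (- of_real (\<sigma>\<^sup>2 / 2 * (norm x)\<^sup>2) + (\<Sum>j\<in>UNIV. (w * of_real (y $ j)) * of_real (x $ j))))"
    by (rule schwartz_gauss_exp) (use assms in simp)
  moreover have "exp (- of_real (\<sigma>\<^sup>2 / 2 * (norm x)\<^sup>2) + w * complex_of_real (y \<bullet> x))
     = exp (w * complex_of_real (y \<bullet> x)) * complex_of_real (exp (- (\<sigma> * norm x)\<^sup>2 / 2))" for x
    by (simp only: exp_add mult.commute exp_of_real power_mult_distrib of_real_minus[symmetric]) (simp add: mult.commute)
  ultimately show ?thesis
    by (simp only: sum_inner_of_real)
qed

lemma gauss_bump_eq:
  "gauss_bump \<sigma> y x = of_real (exp (- (norm y)\<^sup>2 / (2 * \<sigma>\<^sup>2)) / sqrt (2 * pi) ^ CARD('n)) *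
     (exp (of_real (1 / \<sigma>\<^sup>2) * complex_of_real (y \<bullet> x)) * of_real (exp (- ((1 / \<sigma>) * norm (x::real^'n::finite))\<^sup>2 / 2)))"
proof -
  have "(norm (x - y))\<^sup>2 = (norm x)\<^sup>2 - 2 * (y \<bullet> x) + (norm y)\<^sup>2"
    by (simp add: power2_norm_eq_inner inner_diff inner_commute)
  moreover have n: "(norm ((1 / \<sigma>) *\<^sub>R (x - y)))\<^sup>2 = (norm (x - y))\<^sup>2 / \<sigma>\<^sup>2"
    by (simp only: norm_scaleR power_mult_distrib) (simp add: power_divide)
  ultimately have E: "exp (- (norm ((1 / \<sigma>) *\<^sub>R (x - y)))\<^sup>2 / 2)
      = exp (- (norm y)\<^sup>2 / (2 * \<sigma>\<^sup>2) + (1 / \<sigma>\<^sup>2 * (y \<bullet> x) + - ((1 / \<sigma>) * norm x)\<^sup>2 / 2))"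
    unfolding n by (simp add: power_mult_distrib power_divide add_divide_distrib diff_divide_distrib)
  have c: "exp (of_real (1 / \<sigma>\<^sup>2) * complex_of_real (y \<bullet> x)) = of_real (exp (1 / \<sigma>\<^sup>2 * (y \<bullet> x)))"
    by (simp only: of_real_mult[symmetric] exp_of_real)
  show ?thesis
    unfolding gauss_bump_def std_gauss_def c
    by (simp only: E exp_add of_real_mult of_real_divide times_divide_eq_left)
qed

lemma schwartz_gauss_bump: "\<sigma> > 0 \<Longrightarrow> schwartz (gauss_bump \<sigma> y)"
  unfolding gauss_bump_eq[abs_def] by (rule schwartz_modulated_gauss) simp

lemma schwartz_fourier_gauss_bump:
  assumes "\<sigma> > 0" shows "schwartz (fourier (gauss_bump \<sigma> (y :: real^'n::finite)))"
proof -
  have "fourier (gauss_bump \<sigma> y) = (\<lambda>x. of_real (\<sigma> ^ CARD('n)) *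
      (exp ((- \<i>) * complex_of_real (y \<bullet> x)) * of_real (exp (- (\<sigma> * norm x)\<^sup>2 / 2))))"
    using fourier_modulated_gauss[OF assms, of "- _" y]
    by (simp add: fun_eq_iff fourier_def gauss_bump_def mult.assoc)
  then show ?thesis
    using schwartz_modulated_gauss[OF assms, of "of_real (\<sigma> ^ CARD('n))" "- \<i>" y] by (simp only:)
qed

text \<open>
  Every bump is a Fourier transform of a Schwartz function, so the defining identity of a
  distributional Fourier transform can also be tested with bumps on the spatial side.
\<close>

lemma gauss_bump_is_fourier:
  assumes \<sigma>: "\<sigma> > 0"
  obtains \<psi> where "schwartz \<psi>" "fourier \<psi> = gauss_bump \<sigma> (y :: real^'n::finite)"
proof -
  define c where "c = complex_of_real (\<sigma> ^ CARD('n) / (2 * pi) ^ CARD('n))"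
  define \<psi> where "\<psi> x = c * (iexp (y \<bullet> x) * of_real (exp (- (\<sigma> * norm x)\<^sup>2 / 2)))" for x
  have "schwartz \<psi>" unfolding \<psi>_def by (rule schwartz_modulated_gauss[OF \<sigma>])
  moreover have "fourier \<psi> = gauss_bump \<sigma> y"
  proof
    fix x
    have e: "exp (- \<i> * complex_of_real (\<xi> \<bullet> x)) * \<psi> \<xi>
        = c * (iexp (\<xi> \<bullet> (y - x)) * of_real (exp (- (\<sigma> * norm \<xi>)\<^sup>2 / 2)))" for \<xi>
    proof -
      have A: "exp (- \<i> * complex_of_real (\<xi> \<bullet> x)) * iexp (y \<bullet> \<xi>)
          = iexp (\<xi> \<bullet> (y - x))"
        by (simp add: inner_diff_right inner_commute algebra_simps flip: exp_add)
      show ?thesis unfolding \<psi>_def A[symmetric] by (simp only: mult_ac)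
    qed
    have "fourier \<psi> x = c * of_real ((2 * pi) ^ CARD('n) / \<sigma> ^ CARD('n) * std_gauss ((1 / \<sigma>) *\<^sub>R (y - x)))"
      unfolding fourier_def e integral_mult_right_zero by (simp only: fourier_gauss_inverse[OF \<sigma>])
    also have "\<dots> = of_real (std_gauss ((1 / \<sigma>) *\<^sub>R (y - x)))"
      using \<sigma> by (simp add: c_def)
    also have "\<dots> = gauss_bump \<sigma> y x"
      using std_gauss_minus[of "(1 / \<sigma>) *\<^sub>R (x - y)"] by (simp add: gauss_bump_def flip: scaleR_minus_right)
    finally show "fourier \<psi> x = gauss_bump \<sigma> y x" .
  qed
  ultimately show ?thesis using that by blast
qed

text \<open>
  Averaging the tests over the centres \<open>y\<close> in a box and letting the width tend to zero bounds the
  integral of \<open>H\<close> over the box by \<open>C\<close> times its volume. Lebesgue's differentiation theorem for boxes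
  then gives the bound at almost every point.
\<close>

lemma bounded_by_gauss_tests:
  fixes H :: "'n::finite cfun"
  assumes H: "integrable lborel H"
    and test: "\<And>\<sigma> y. \<sigma> > 0 \<Longrightarrow> norm (\<integral>x. H x * gauss_bump \<sigma> y x \<partial>lborel) \<le> C * \<sigma> ^ CARD('n)"
  shows "AE x in lborel. norm (H x) \<le> C"
proof -
  have [measurable]: "H \<in> borel_measurable borel" using borel_measurable_integrable[OF H] by simp
  have box: "norm (\<integral>x. H x * indicator (cbox a b) x \<partial>lborel) \<le> C * measure lborel (cbox a b)" for a b
  proof -
    let ?I = "indicator (cbox a b) :: real^'n \<Rightarrow> complex"
    have Ii: "integrable lborel ?I"
    proof -
      have "integrable lborel (\<lambda>x. complex_of_real (indicator (cbox a b) x))"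
        using emeasure_lborel_cbox_finite[of a b]
        by (intro integrable_of_real integrable_real_indicator) auto
      moreover have "(\<lambda>x. complex_of_real (indicator (cbox a b) x)) = ?I"
        by (auto simp: fun_eq_iff indicator_def)
      ultimately show ?thesis by (simp only:)
    qed
    define \<sigma> where "\<sigma> n = inverse (real (Suc n))" for n
    have \<sigma>0: "\<sigma> \<longlonglongrightarrow> 0" unfolding \<sigma>_def by (rule LIMSEQ_inverse_real_of_nat)
    have \<sigma>p: "\<sigma> n > 0" for n by (simp add: \<sigma>_def)
    \<comment> \<open>the indicator of the box, smoothed at scale \<open>\<sigma> n\<close>\<close>
    define q where "q n x = (\<integral>\<eta>. ?I (x + \<sigma> n *\<^sub>R \<eta>) * of_real (std_gauss \<eta>) \<partial>lborel)" for n x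
    have qm: "q n \<in> borel_measurable borel" for n
      unfolding q_def[abs_def] by measurable
    have qb: "norm (q n x) \<le> 1" for n x
    proof -
      have "norm (q n x) \<le> (\<integral>\<eta>. norm (?I (x + \<sigma> n *\<^sub>R \<eta>) * of_real (std_gauss (\<eta>::real^'n))) \<partial>lborel)"
        unfolding q_def by (rule integral_norm_bound)
      also have "\<dots> \<le> (\<integral>\<eta>. std_gauss (\<eta>::real^'n) \<partial>lborel)"
      proof (rule integral_mono')
        show "norm (?I (x + \<sigma> n *\<^sub>R \<eta>) * of_real (std_gauss \<eta>)) \<le> std_gauss \<eta>" for \<eta> :: "real^'n"
          using std_gauss_pos[of \<eta>] by (simp add: norm_mult indicator_def)
        show "0 \<le> std_gauss \<eta>" for \<eta> :: "real^'n"
          using std_gauss_pos[of \<eta>] by simp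
      qed (rule integrable_std_gauss)
      finally show ?thesis by (simp add: integral_std_gauss)
    qed
    have qlim: "(\<lambda>n. q n x) \<longlonglongrightarrow> ?I x" if "x \<notin> frontier (cbox a b)" for x
      unfolding q_def
    proof (rule gauss_average_tendsto[where B=1])
      show "isCont ?I x"
      proof -
        have "isCont (\<lambda>y. complex_of_real (indicator (cbox a b) y)) x"
          using isCont_indicator[of x "cbox a b"] that by (intro continuous_of_real) blast
        moreover have "(\<lambda>x. complex_of_real (indicator (cbox a b) x)) = ?I"
          by (auto simp: fun_eq_iff indicator_def)
        ultimately show ?thesis by (simp only:)
      qed
    qed (use \<sigma>0 in \<open>auto simp: indicator_def\<close>)
    have "negligible (frontier (cbox a b))"
      by (intro negligible_convex_frontier) auto
    then have "frontier (cbox a b) \<in> null_sets lebesgue" by (simp add: negligible_iff_null_sets)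
    then have "frontier (cbox a b) \<in> null_sets lborel"
      using null_sets_completion_iff[of "frontier (cbox a b)" lborel] by simp
    then have AEf: "AE x in lborel. x \<notin> frontier (cbox a b)" by (rule AE_not_in)
    have le: "norm (\<integral>x. H x * q n x \<partial>lborel) \<le> C * measure lborel (cbox a b)" for n
    proof -
      let ?k = "\<lambda>y x. gauss_bump (\<sigma> n) y x"
      have sym: "?k y x = ?k x y" for x y :: "real^'n"
        using std_gauss_minus[of "(1 / \<sigma> n) *\<^sub>R (x - y)"]
        by (simp add: gauss_bump_def flip: scaleR_minus_right)
      have kq: "(\<integral>y. ?k y x * ?I y \<partial>lborel) = of_real (\<sigma> n ^ CARD('n)) * q n x" for x
      proof -
        have "(\<integral>y. ?k y x * ?I y \<partial>lborel) = (\<integral>y. ?I y * of_real (std_gauss ((1 / \<sigma> n) *\<^sub>R (y - x))) \<partial>lborel)"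
          by (simp only: sym[of _ x]) (simp add: gauss_bump_def mult.commute)
        also have "\<dots> = of_real (\<sigma> n ^ CARD('n)) * q n x"
          unfolding q_def by (rule gauss_rescale(2)[where B=1]) (use \<sigma>p in \<open>auto simp: indicator_def\<close>)
        finally show ?thesis .
      qed
      have "(\<integral>y. (\<integral>x. ?k y x * H x \<partial>lborel) * ?I y \<partial>lborel) = (\<integral>x. H x * (\<integral>y. ?k y x * ?I y \<partial>lborel) \<partial>lborel)"
      proof (rule fubini_bounded_kernel(1)[OF Ii H])
        show "(\<lambda>(y, x). ?k y x) \<in> borel_measurable (borel \<Otimes>\<^sub>M borel)"
          unfolding gauss_bump_def case_prod_unfold by measurable
        show "norm (?k y x) \<le> 1" for y x :: "real^'n"
          unfolding gauss_bump_def norm_of_real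
          by (rule abs_leI) (use std_gauss_le_1 std_gauss_pos[of "(1 / \<sigma> n) *\<^sub>R (x - y)"] in \<open>auto intro: order_trans[of _ 0]\<close>)
      qed
      also have "\<dots> = (\<integral>x. of_real (\<sigma> n ^ CARD('n)) * (H x * q n x) \<partial>lborel)"
        by (simp only: kq mult.left_commute)
      also have "\<dots> = of_real (\<sigma> n ^ CARD('n)) * (\<integral>x. H x * q n x \<partial>lborel)"
        by (rule integral_mult_right_zero)
      finally have eq: "of_real (\<sigma> n ^ CARD('n)) * (\<integral>x. H x * q n x \<partial>lborel) =
          (\<integral>y. (\<integral>x. ?k y x * H x \<partial>lborel) * ?I y \<partial>lborel)" ..
      have "norm (\<integral>y. (\<integral>x. ?k y x * H x \<partial>lborel) * ?I y \<partial>lborel)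
          \<le> (\<integral>y. norm ((\<integral>x. ?k y x * H x \<partial>lborel) * ?I y) \<partial>lborel)"
        by (rule integral_norm_bound)
      also have "\<dots> \<le> (\<integral>y. C * \<sigma> n ^ CARD('n) * indicator (cbox a b) y \<partial>lborel)"
      proof (rule integral_mono')
        show "integrable lborel (\<lambda>y. C * \<sigma> n ^ CARD('n) * indicator (cbox a b) (y::real^'n))"
          using emeasure_lborel_cbox_finite[of a b]
          by (intro integrable_mult_right integrable_real_indicator) auto
        have t: "norm (\<integral>x. ?k y x * H x \<partial>lborel) \<le> C * \<sigma> n ^ CARD('n)" for y
          using test[OF \<sigma>p[of n], of y] by (simp add: mult.commute)
        show "norm ((\<integral>x. ?k y x * H x \<partial>lborel) * ?I y) \<le> C * \<sigma> n ^ CARD('n) * indicator (cbox a b) y" for y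
          using t[of y] by (simp add: norm_mult indicator_def)
        show "0 \<le> C * \<sigma> n ^ CARD('n) * indicator (cbox a b) y" for y
          using order_trans[OF norm_ge_zero t[of y]] by (simp add: indicator_def)
      qed
      also have "\<dots> = C * \<sigma> n ^ CARD('n) * measure lborel (cbox a b)" by simp
      finally have "norm (of_real (\<sigma> n ^ CARD('n)) * (\<integral>x. H x * q n x \<partial>lborel))
          \<le> \<sigma> n ^ CARD('n) * (C * measure lborel (cbox a b))"
        unfolding eq by (simp only: mult_ac)
      then have "\<sigma> n ^ CARD('n) * norm (\<integral>x. H x * q n x \<partial>lborel) \<le> \<sigma> n ^ CARD('n) * (C * measure lborel (cbox a b))"
        using \<sigma>p[of n] by (simp add: norm_mult norm_power)
      then show ?thesis using \<sigma>p[of n] by (simp only: mult_le_cancel_left_pos zero_less_power)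
    qed
    have "(\<lambda>n. \<integral>x. H x * q n x \<partial>lborel) \<longlonglongrightarrow> (\<integral>x. H x * ?I x \<partial>lborel)"
    proof (rule integral_dominated_convergence[where w = "\<lambda>x. norm (H x)"])
      show "integrable lborel (\<lambda>x. norm (H x))" by (intro integrable_norm H)
      show "AE x in lborel. (\<lambda>n. H x * q n x) \<longlonglongrightarrow> H x * ?I x"
        using AEf by eventually_elim (intro tendsto_mult_left qlim)
      show "AE x in lborel. norm (H x * q n x) \<le> norm (H x)" for n
        using qb[of n] by (intro AE_I2) (simp add: norm_mult mult_left_le)
      show "(\<lambda>x. H x * q n x) \<in> borel_measurable lborel" for n
        using qm[of n] by measurable
    qed measurable
    then have "(\<lambda>n. norm (\<integral>x. H x * q n x \<partial>lborel)) \<longlonglongrightarrow> norm (\<integral>x. H x * ?I x \<partial>lborel)"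
      by (rule tendsto_norm)
    then show ?thesis by (rule LIMSEQ_le_const2) (use le in auto)
  qed
  have set_int: "set_integrable lborel (cbox a b) H" for a b
    by (rule set_integrable_subset[of _ UNIV]) (use H in \<open>auto simp: set_integrable_def\<close>)
  have box': "norm (integral (cbox a b) H) \<le> C * measure lborel (cbox a b)" for a b
  proof -
    have "(LINT x:cbox a b|lborel. H x) = (\<integral>x. H x * indicator (cbox a b) x \<partial>lborel)"
      unfolding set_lebesgue_integral_def
      by (rule Bochner_Integration.integral_cong) (auto simp: indicator_def)
    then show ?thesis
      using set_borel_integral_eq_integral(2)[OF set_int[of a b]] box[of a b] by simp
  qed
  obtain N where N: "negligible N" and lim: "\<And>x e. \<lbrakk>x \<notin> N; 0 < e\<rbrakk> \<Longrightarrow> \<exists>d>0. \<forall>h. 0 < h \<and> h < d \<longrightarrow>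
      norm (integral (cbox x (x + h *\<^sub>R One)) H /\<^sub>R h ^ DIM(real^'n) - H x) < e"
    using integrable_ccontinuous_explicit[of H] set_borel_integral_eq_integral(1)[OF set_int] by metis
  have "norm (H x) \<le> C" if x: "x \<notin> N" for x
  proof (rule field_le_epsilon)
    fix e :: real assume "e > 0"
    from lim[OF x this] obtain d where d: "d > 0" and
      dl: "\<And>h. 0 < h \<Longrightarrow> h < d \<Longrightarrow> norm (integral (cbox x (x + h *\<^sub>R One)) H /\<^sub>R h ^ DIM(real^'n) - H x) < e"
      by blast
    define h where "h = d / 2"
    have h: "0 < h" "h < d" using d by (auto simp: h_def)
    let ?B = "cbox x (x + h *\<^sub>R One)"
    have "measure lborel ?B = (\<Prod>b\<in>(Basis :: (real^'n) set). h)"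
      by (subst measure_lborel_cbox_eq) (use h in \<open>auto simp: inner_add_left inner_sum_left_Basis\<close>)
    then have m: "measure lborel ?B = h ^ DIM(real^'n)" by simp
    have "norm (integral ?B H /\<^sub>R h ^ DIM(real^'n)) \<le> C"
      using box'[of x "x + h *\<^sub>R One"] h unfolding m by (simp add: field_simps norm_power)
    moreover have "norm (H x) \<le> norm (integral ?B H /\<^sub>R h ^ DIM(real^'n)) +
        norm (integral ?B H /\<^sub>R h ^ DIM(real^'n) - H x)"
      by (metis add.commute norm_minus_commute norm_triangle_sub)
    ultimately show "norm (H x) \<le> C + e" using dl[OF h] by linarith
  qed
  then have "{x. \<not> norm (H x) \<le> C} \<subseteq> N" by blast
  then have "negligible {x. \<not> norm (H x) \<le> C}" using N negligible_subset by blast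
  then have "{x. \<not> norm (H x) \<le> C} \<in> null_sets lebesgue" by (simp add: negligible_iff_null_sets)
  moreover have "{x. \<not> norm (H x) \<le> C} \<in> sets borel" by measurable
  ultimately have "{x. \<not> norm (H x) \<le> C} \<in> null_sets lborel"
    using null_sets_completion_iff[of "{x. \<not> norm (H x) \<le> C}" lborel] by simp
  then show ?thesis by (rule AE_I') auto
qed

text \<open>
  Completing the square. A tempered function becomes integrable when multiplied by the standard bump,
  and this identity shows that its Gaussian tests survive the multiplication.
\<close>

lemma gauss_bump_product:
  fixes y :: "real^'n::finite"
  assumes \<sigma>: "\<sigma> > 0"
  obtains c \<sigma>' y' where "\<sigma>' > 0" "\<And>x. gauss_bump 1 0 x * gauss_bump \<sigma> y x = c * gauss_bump \<sigma>' y' x"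
proof -
  define s where "s = 1 + 1 / \<sigma>\<^sup>2"
  have s: "s > 0" using \<sigma> by (simp add: s_def add_pos_pos)
  define y' where "y' = (1 / (s * \<sigma>\<^sup>2)) *\<^sub>R y"
  define K where "K = (norm y)\<^sup>2 / \<sigma>\<^sup>2 - s * (norm y')\<^sup>2"
  have *: "(norm x)\<^sup>2 + (norm ((1 / \<sigma>) *\<^sub>R (x - y)))\<^sup>2 = (norm ((1 / (1 / sqrt s)) *\<^sub>R (x - y')))\<^sup>2 + K" for x
  proof -
    have "(norm ((1 / \<sigma>) *\<^sub>R (x - y)))\<^sup>2 = ((norm x)\<^sup>2 - 2 * (y \<bullet> x) + (norm y)\<^sup>2) / \<sigma>\<^sup>2"
      unfolding norm_scaleR power_mult_distrib power2_norm_eq_inner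
      by (simp add: power_divide inner_diff inner_commute)
    moreover have "(norm ((1 / (1 / sqrt s)) *\<^sub>R (x - y')))\<^sup>2 = s * ((norm x)\<^sup>2 - 2 * (y' \<bullet> x) + (norm y')\<^sup>2)"
      unfolding norm_scaleR power_mult_distrib power2_norm_eq_inner
      using s by (simp add: inner_diff inner_commute)
    moreover have "s * (y' \<bullet> x) = (y \<bullet> x) / \<sigma>\<^sup>2"
      using s by (simp add: y'_def)
    moreover have "s * (norm x)\<^sup>2 = (norm x)\<^sup>2 + (norm x)\<^sup>2 / \<sigma>\<^sup>2"
      by (simp add: s_def distrib_right)
    ultimately show ?thesis
      by (simp add: K_def right_diff_distrib distrib_left add_divide_distrib diff_divide_distrib)
  qed
  have "std_gauss x * std_gauss ((1 / \<sigma>) *\<^sub>R (x - y))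
      = exp (- K / 2) / sqrt (2 * pi) ^ CARD('n) * std_gauss ((1 / (1 / sqrt s)) *\<^sub>R (x - y'))" for x
  proof -
    have "exp (- (norm x)\<^sup>2 / 2) * exp (- (norm ((1 / \<sigma>) *\<^sub>R (x - y)))\<^sup>2 / 2)
        = exp (- ((norm x)\<^sup>2 + (norm ((1 / \<sigma>) *\<^sub>R (x - y)))\<^sup>2) / 2)"
      by (simp add: add_divide_distrib flip: exp_add)
    also have "\<dots> = exp (- K / 2) * exp (- (norm ((1 / (1 / sqrt s)) *\<^sub>R (x - y')))\<^sup>2 / 2)"
      unfolding * by (simp only: add_divide_distrib minus_add exp_add mult.commute minus_divide_left[symmetric] minus_add_distrib)
    finally show ?thesis
      unfolding std_gauss_def by (simp only: times_divide_times_eq times_divide_eq_left times_divide_eq_right)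
  qed
  then have "gauss_bump 1 0 x * gauss_bump \<sigma> y x
      = of_real (exp (- K / 2) / sqrt (2 * pi) ^ CARD('n)) * gauss_bump (1 / sqrt s) y' x" for x
    by (simp add: gauss_bump_def del: of_real_divide flip: of_real_mult)
  then show ?thesis
    using s by (intro that[of "1 / sqrt s" "of_real (exp (- K / 2) / sqrt (2 * pi) ^ CARD('n))" y']) auto
qed

lemma gauss_bump_borel [measurable]: "gauss_bump \<sigma> y \<in> borel_measurable borel"
  unfolding gauss_bump_def[abs_def] by measurable

lemma gauss_bump_nonzero: "gauss_bump \<sigma> y x \<noteq> 0"
  using std_gauss_pos[of "(1 / \<sigma>) *\<^sub>R (x - y)"] by (simp add: gauss_bump_def)

text \<open>
  The difference times the standard bump is integrable and all its Gaussian tests vanish, so the case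
  \<open>C = 0\<close> of \<open>bounded_by_gauss_tests\<close> applies.
\<close>

lemma tempered_eq_by_gauss_tests:
  fixes f g :: "'n::finite cfun"
  assumes f: "tempered f" and g: "tempered g"
    and eq: "\<And>\<sigma> y. \<sigma> > 0 \<Longrightarrow> (\<integral>x. f x * gauss_bump \<sigma> y x \<partial>lborel) = (\<integral>x. g x * gauss_bump \<sigma> y x \<partial>lborel)"
  shows "AE x in lborel. f x = g x"
proof -
  let ?H = "\<lambda>x. (f x - g x) * gauss_bump 1 0 x"
  have i: "integrable lborel (\<lambda>x. f x * gauss_bump \<sigma> y x)" "integrable lborel (\<lambda>x. g x * gauss_bump \<sigma> y x)"
    if "\<sigma> > 0" for \<sigma> y
    using f g schwartz_gauss_bump[OF that, of y] unfolding tempered_def by blast+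
  have "AE x in lborel. norm (?H x) \<le> 0"
  proof (rule bounded_by_gauss_tests)
    show "integrable lborel ?H"
      unfolding left_diff_distrib using i[of 1 0] by simp
    fix \<sigma> :: real and y :: "real^'n" assume \<sigma>: "\<sigma> > 0"
    obtain c \<sigma>' y' where c: "\<sigma>' > 0" "\<And>x. gauss_bump 1 0 x * gauss_bump \<sigma> y x = c * gauss_bump \<sigma>' y' x"
      using gauss_bump_product[OF \<sigma>] by metis
    have "(\<integral>x. ?H x * gauss_bump \<sigma> y x \<partial>lborel)
        = (\<integral>x. c * (f x * gauss_bump \<sigma>' y' x) - c * (g x * gauss_bump \<sigma>' y' x) \<partial>lborel)"
      by (simp only: mult.assoc c) (simp add: algebra_simps)
    also have "\<dots> = 0"
      using i[OF c(1), of y'] eq[OF c(1), of y'] by simp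
    finally show "norm (\<integral>x. ?H x * gauss_bump \<sigma> y x \<partial>lborel) \<le> 0 * \<sigma> ^ CARD('n)" by simp
  qed
  then show ?thesis
    by eventually_elim (simp add: gauss_bump_nonzero)
qed

lemma fourier_transform_unique:
  fixes f F G :: "'n::finite cfun"
  assumes F: "is_fourier_transform f F" and G: "is_fourier_transform f G"
  shows "AE \<xi> in lborel. F \<xi> = G \<xi>"
proof (rule tempered_eq_by_gauss_tests)
  show "tempered F" "tempered G" using F G by (auto simp: is_fourier_transform_def)
  fix \<sigma> :: real and y :: "real^'n" assume "\<sigma> > 0"
  then have "schwartz (gauss_bump \<sigma> y)" by (rule schwartz_gauss_bump)
  then show "(\<integral>\<xi>. F \<xi> * gauss_bump \<sigma> y \<xi> \<partial>lborel) = (\<integral>\<xi>. G \<xi> * gauss_bump \<sigma> y \<xi> \<partial>lborel)"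
    using F G unfolding is_fourier_transform_def by metis
qed

lemma fourier_transform_inj:
  fixes f F g G :: "'n::finite cfun"
  assumes f: "is_fourier_transform f F" and g: "is_fourier_transform g G"
    and FG: "AE \<xi> in lborel. F \<xi> = G \<xi>"
  shows "AE x in lborel. f x = g x"
proof (rule tempered_eq_by_gauss_tests)
  show "tempered f" "tempered g" using f g by (auto simp: is_fourier_transform_def)
  fix \<sigma> :: real and y :: "real^'n" assume "\<sigma> > 0"
  then obtain \<psi> where \<psi>: "schwartz \<psi>" "fourier \<psi> = gauss_bump \<sigma> y"
    using gauss_bump_is_fourier by metis
  have [measurable]: "F \<in> borel_measurable borel" "G \<in> borel_measurable borel" "\<psi> \<in> borel_measurable borel"
    using f g schwartz_borel[OF \<psi>(1)] by (auto simp: is_fourier_transform_def tempered_def)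
  have "(\<integral>\<xi>. F \<xi> * \<psi> \<xi> \<partial>lborel) = (\<integral>\<xi>. G \<xi> * \<psi> \<xi> \<partial>lborel)"
    by (rule integral_cong_AE) (use FG in auto)
  then show "(\<integral>x. f x * gauss_bump \<sigma> y x \<partial>lborel) = (\<integral>x. g x * gauss_bump \<sigma> y x \<partial>lborel)"
    using f g \<psi> unfolding is_fourier_transform_def by metis
qed

section \<open>Functions with decaying spectrum\<close>

definition decaying :: "real \<Rightarrow> 'n::finite cfun \<Rightarrow> bool" where
  "decaying C F \<longleftrightarrow> F \<in> borel_measurable borel \<and> (\<forall>\<xi>. norm (F \<xi>) * weight \<xi> \<le> C)"

text \<open>
  A spectrum \<open>F\<close> is fixed everywhere and \<open>f\<close> only up to null sets. This avoids essential suprema on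
  the spectral side: \<open>F\<close> may be changed on a null set, and the norm below is an infimum over all
  choices.
\<close>

definition represents :: "real \<Rightarrow> 'n::finite cfun \<Rightarrow> 'n cfun \<Rightarrow> bool" where
  "represents C F f \<longleftrightarrow> decaying C F \<and> f \<in> borel_measurable borel \<and> (AE x in lborel. f x = inv_fourier F x)"

definition decay_space :: "'n::finite cfun set" where
  "decay_space = {f. \<exists>C F. represents C F f}"

definition decay_norm :: "'n::finite cfun \<Rightarrow> real" where
  "decay_norm f = Inf {C. \<exists>F. represents C F f}"

lemma decaying_integrable: "decaying C F \<Longrightarrow> integrable lborel F"
  unfolding decaying_def using integrable_of_weight_bound by blast

lemma decaying_nonneg: "decaying C F \<Longrightarrow> C \<ge> 0"
  unfolding decaying_def by (metis mult_nonneg_nonneg norm_ge_zero order_trans weight_pos less_imp_le)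

lemma decaying_bound: "decaying C F \<Longrightarrow> norm (F \<xi>) \<le> C"
  unfolding decaying_def using mult_left_mono[OF weight_ge_1[of \<xi>], of "norm (F \<xi>)"]
  by (metis mult.right_neutral norm_ge_zero order_trans)

lemma decaying_add: "decaying C F \<Longrightarrow> decaying D G \<Longrightarrow> decaying (C + D) (\<lambda>\<xi>. F \<xi> + G \<xi>)"
  unfolding decaying_def
proof (elim conjE, intro conjI allI)
  fix \<xi>
  assume "\<forall>\<xi>. norm (F \<xi>) * weight \<xi> \<le> C" "\<forall>\<xi>. norm (G \<xi>) * weight \<xi> \<le> D"
  then have b: "norm (F \<xi>) * weight \<xi> + norm (G \<xi>) * weight \<xi> \<le> C + D" by (intro add_mono) auto
  have "norm (F \<xi> + G \<xi>) * weight \<xi> \<le> (norm (F \<xi>) + norm (G \<xi>)) * weight \<xi>"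
    using weight_pos[of \<xi>] by (intro mult_right_mono norm_triangle_ineq) auto
  then show "norm (F \<xi> + G \<xi>) * weight \<xi> \<le> C + D" using b by (simp add: distrib_right)
qed simp

lemma decaying_cmult: "decaying C F \<Longrightarrow> decaying (norm c * C) (\<lambda>\<xi>. c * F \<xi>)"
  unfolding decaying_def by (auto simp: norm_mult mult.assoc mult_left_mono)

lemma decaying_mult:
  assumes "decaying C F" and [measurable]: "m \<in> borel_measurable borel" and b: "\<And>\<xi>. norm (m \<xi>) \<le> M"
  shows "decaying (M * C) (\<lambda>\<xi>. m \<xi> * F \<xi>)"
  unfolding decaying_def
proof (intro conjI allI)
  have F: "F \<in> borel_measurable borel" "\<And>\<xi>. norm (F \<xi>) * weight \<xi> \<le> C"
    using assms by (auto simp: decaying_def)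
  then show "(\<lambda>\<xi>. m \<xi> * F \<xi>) \<in> borel_measurable borel" by simp
  show "norm (m \<xi> * F \<xi>) * weight \<xi> \<le> M * C" for \<xi>
    unfolding norm_mult mult.assoc using b[of \<xi>] F(2)[of \<xi>] weight_pos[of \<xi>]
    by (intro mult_mono) (auto intro: order_trans[OF norm_ge_zero])
qed

lemma inv_fourier_add:
  assumes "integrable lborel F" "integrable lborel G"
  shows "inv_fourier (\<lambda>\<xi>. F \<xi> + G \<xi>) x = inv_fourier F x + inv_fourier G x"
  unfolding inv_fourier_def distrib_left
  by (simp only: Bochner_Integration.integral_add[OF integrable_cexp_mult(3)[OF assms(1)] integrable_cexp_mult(3)[OF assms(2)]]
      add_divide_distrib)

lemma inv_fourier_cmult: "inv_fourier (\<lambda>\<xi>. c * F \<xi>) x = c * inv_fourier F x"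
  unfolding inv_fourier_def mult.left_commute[of _ c] by simp

lemma represents_add:
  assumes f: "represents C F f" and g: "represents D G g"
  shows "represents (C + D) (\<lambda>\<xi>. F \<xi> + G \<xi>) (\<lambda>x. f x + g x)"
proof -
  have "AE x in lborel. f x = inv_fourier F x" "AE x in lborel. g x = inv_fourier G x"
    using f g by (auto simp: represents_def)
  then have "AE x in lborel. f x + g x = inv_fourier (\<lambda>\<xi>. F \<xi> + G \<xi>) x"
  proof eventually_elim
    case (elim x)
    then show ?case
      using f g by (subst inv_fourier_add) (auto simp: represents_def intro: decaying_integrable)
  qed
  then show ?thesis using f g by (auto simp: represents_def intro: decaying_add)
qed

lemma represents_cmult:
  assumes f: "represents C F f"
  shows "represents (norm c * C) (\<lambda>\<xi>. c * F \<xi>) (\<lambda>x. c * f x)"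
proof -
  have "AE x in lborel. f x = inv_fourier F x"
    using f by (auto simp: represents_def)
  then have "AE x in lborel. c * f x = inv_fourier (\<lambda>\<xi>. c * F \<xi>) x"
    by eventually_elim (simp add: inv_fourier_cmult)
  then show ?thesis using f by (auto simp: represents_def intro: decaying_cmult)
qed

lemma represents_diff:
  assumes f: "represents C F f" and g: "represents D G g"
  shows "represents (C + D) (\<lambda>\<xi>. F \<xi> - G \<xi>) (\<lambda>x. f x - g x)"
  using represents_add[OF f represents_cmult[OF g, of "-1"]] by simp

lemma represents_cong:
  assumes "represents C F f" "g \<in> borel_measurable borel" "AE x in lborel. f x = g x"
  shows "represents C F g"
proof -
  have "AE x in lborel. f x = inv_fourier F x" using assms(1) by (simp add: represents_def)
  with assms(3) have "AE x in lborel. g x = inv_fourier F x" by eventually_elim simp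
  then show ?thesis using assms by (simp add: represents_def)
qed

lemma represents_mono: "represents C F f \<Longrightarrow> C \<le> D \<Longrightarrow> represents D F f"
  unfolding represents_def decaying_def by (meson order_trans)

lemma represents_inv_fourier: "decaying C F \<Longrightarrow> represents C F (inv_fourier F)"
  unfolding represents_def by (auto simp: decaying_def)

lemma represents_fourier: "represents C F f \<Longrightarrow> is_fourier_transform f F"
  unfolding represents_def decaying_def using is_fourier_transform_inv_fourier by blast

lemma represents_sup_bound:
  fixes f :: "'n::finite cfun"
  assumes "represents C F f"
  shows "AE x in lborel. norm (f x) \<le> C * (\<integral>\<xi>. 1 / weight (\<xi>::real^'n) \<partial>lborel)"
proof -
  have F: "decaying C F" and ae: "AE x in lborel. f x = inv_fourier F x"
    using assms by (auto simp: represents_def)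
  have "(\<integral>\<xi>. norm (F \<xi>) \<partial>lborel) \<le> (\<integral>\<xi>. C * (1 / weight (\<xi>::real^'n)) \<partial>lborel)"
  proof (rule Bochner_Integration.integral_mono)
    show "integrable lborel (\<lambda>\<xi>. norm (F \<xi>))" by (intro integrable_norm decaying_integrable[OF F])
    show "integrable lborel (\<lambda>\<xi>::real^'n. C * (1 / weight \<xi>))"
      by (intro integrable_mult_right integrable_inverse_weight)
    show "norm (F \<xi>) \<le> C * (1 / weight \<xi>)" for \<xi>
      using F weight_pos[of \<xi>] by (simp add: decaying_def field_simps)
  qed
  then have I: "(\<integral>\<xi>. norm (F \<xi>) \<partial>lborel) \<le> C * (\<integral>\<xi>. 1 / weight (\<xi>::real^'n) \<partial>lborel)" by (simp only: integral_mult_right_zero)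
  from ae show ?thesis
    by eventually_elim (use inv_fourier_norm_le[of F] I in \<open>auto intro: order_trans\<close>)
qed

lemma decay_norm_le: "represents C F f \<Longrightarrow> decay_norm f \<le> C"
  unfolding decay_norm_def
  by (rule cInf_lower) (auto intro!: bdd_belowI[of _ 0] simp: represents_def decaying_nonneg)

lemma decay_space_representation:
  assumes "f \<in> decay_space" "e > 0"
  obtains F where "represents (decay_norm f + e) F f"
proof -
  have 1: "{C. \<exists>F. represents C F f} \<noteq> {}" using assms by (auto simp: decay_space_def)
  have 2: "Inf {C. \<exists>F. represents C F f} < decay_norm f + e" using assms by (simp add: decay_norm_def)
  from cInf_lessD[OF 1 2] obtain C where "C \<in> {C. \<exists>F. represents C F f}" and C: "C < decay_norm f + e"
    by (elim bexE) (rule that)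
  then obtain F where "represents C F f" by blast
  then show ?thesis using C by (intro that) (auto intro: represents_mono)
qed

lemma decay_norm_nonneg: "f \<in> decay_space \<Longrightarrow> decay_norm f \<ge> 0"
  unfolding decay_norm_def decay_space_def
  by (rule cInf_greatest) (auto simp: represents_def decaying_nonneg)

lemma decay_space_borel: "f \<in> decay_space \<Longrightarrow> f \<in> borel_measurable borel"
  by (auto simp: decay_space_def represents_def)

lemma represents_decay_space: "represents C F f \<Longrightarrow> f \<in> decay_space"
  by (auto simp: decay_space_def)

lemma decay_space_add: "f \<in> decay_space \<Longrightarrow> g \<in> decay_space \<Longrightarrow> (\<lambda>x. f x + g x) \<in> decay_space"
  unfolding decay_space_def using represents_add by blast

lemma decay_space_cmult: "f \<in> decay_space \<Longrightarrow> (\<lambda>x. c * f x) \<in> decay_space"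
  unfolding decay_space_def using represents_cmult by blast

lemma decay_space_diff: "f \<in> decay_space \<Longrightarrow> g \<in> decay_space \<Longrightarrow> (\<lambda>x. f x - g x) \<in> decay_space"
  unfolding decay_space_def using represents_diff by blast

lemma decay_norm_triangle:
  assumes "f \<in> decay_space" "g \<in> decay_space"
  shows "decay_norm (\<lambda>x. f x + g x) \<le> decay_norm f + decay_norm g"
proof (rule field_le_epsilon)
  fix e :: real assume "e > 0"
  then have "e / 2 > 0" by simp
  then obtain F G where "represents (decay_norm f + e/2) F f" "represents (decay_norm g + e/2) G g"
    using decay_space_representation assms by metis
  from decay_norm_le[OF represents_add[OF this]]
  show "decay_norm (\<lambda>x. f x + g x) \<le> decay_norm f + decay_norm g + e" by (simp add: algebra_simps)
qed

lemma represents_zero: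
  assumes "f \<in> borel_measurable borel" "AE x in lborel. f x = 0"
  shows "represents 0 (\<lambda>\<xi>. 0) f"
  using assms by (simp add: represents_def decaying_def inv_fourier_def)

text \<open>
  If the norm vanishes, there are spectra with arbitrarily small bounds, hence \<open>f\<close> is bounded by
  arbitrarily small constants.
\<close>

lemma decay_norm_zero_iff:
  assumes f: "f \<in> (decay_space :: 'n::finite cfun set)"
  shows "decay_norm f = 0 \<longleftrightarrow> (AE x in lborel. f x = 0)"
proof
  assume "AE x in lborel. f x = 0"
  then have "decay_norm f \<le> 0" using decay_norm_le represents_zero decay_space_borel[OF f] by blast
  then show "decay_norm f = 0" using decay_norm_nonneg[OF f] by simp
next
  assume 0: "decay_norm f = 0"
  let ?K = "\<integral>\<xi>. 1 / weight (\<xi>::real^'n) \<partial>lborel"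
  have "AE x in lborel. norm (f x) \<le> inverse (real (Suc n)) * ?K" for n
  proof -
    obtain F where "represents (decay_norm f + inverse (real (Suc n))) F f"
      using decay_space_representation[OF f, of "inverse (real (Suc n))"] by auto
    from represents_sup_bound[OF this] show ?thesis by (simp add: 0)
  qed
  then have "AE x in lborel. \<forall>n. norm (f x) \<le> inverse (real (Suc n)) * ?K"
    by (simp add: AE_all_countable)
  then show "AE x in lborel. f x = 0"
  proof eventually_elim
    case (elim x)
    have "(\<lambda>n. inverse (real (Suc n)) * ?K) \<longlonglongrightarrow> 0 * ?K"
      by (intro tendsto_mult_right LIMSEQ_inverse_real_of_nat)
    then have "norm (f x) \<le> 0 * ?K" by (rule LIMSEQ_le_const) (use elim in auto)
    then show ?case by simp
  qed
qed

lemma decay_norm_cmult: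
  fixes f :: "'n::finite cfun"
  assumes f: "f \<in> decay_space" shows "decay_norm (\<lambda>x. c * f x) = norm c * decay_norm f"
proof -
  have le: "decay_norm (\<lambda>x. c * f x) \<le> norm c * decay_norm f" if f: "f \<in> decay_space" for f :: "'n cfun" and c
  proof (rule field_le_epsilon)
    fix e :: real assume "e > 0"
    define d where "d = e / (norm c + 1)"
    have d: "d > 0" "norm c * d \<le> e"
      using \<open>e > 0\<close> by (auto simp: d_def field_simps add_pos_nonneg intro: add_nonneg_pos)
    obtain F where "represents (decay_norm f + d) F f" using decay_space_representation[OF f d(1)] by blast
    from decay_norm_le[OF represents_cmult[OF this, of c]]
    show "decay_norm (\<lambda>x. c * f x) \<le> norm c * decay_norm f + e" using d(2) by (simp add: distrib_left)
  qed
  show ?thesis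
  proof (cases "c = 0")
    case True
    have "represents 0 (\<lambda>\<xi>. 0) (\<lambda>x. 0)" by (rule represents_zero) auto
    then have "(\<lambda>x. 0) \<in> decay_space" by (rule represents_decay_space)
    then show ?thesis using True decay_norm_zero_iff[of "\<lambda>x. 0"] by simp
  next
    case False
    have "decay_norm f \<le> norm (inverse c) * decay_norm (\<lambda>x. c * f x)"
      using le[OF decay_space_cmult[OF f], of "inverse c" c] False by (simp flip: mult.assoc)
    then have "norm c * decay_norm f \<le> decay_norm (\<lambda>x. c * f x)"
      using False by (simp add: norm_inverse norm_divide field_simps)
    with le[OF f, of c] show ?thesis by simp
  qed
qed

text \<open>
  The usual argument for infimum norms: along a fast subsequence the increments have spectra bounded
  by \<open>2\<^sup>-\<^sup>k\<close> against the weight, and the series of these spectra converges pointwise with the matching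
  tail bound.
\<close>

lemma decay_space_complete:
  fixes u :: "nat \<Rightarrow> 'n::finite cfun"
  assumes u: "\<And>n. u n \<in> decay_space"
    and cauchy: "\<And>e. e > 0 \<Longrightarrow> \<exists>n0. \<forall>m\<ge>n0. \<forall>n\<ge>n0. decay_norm (\<lambda>x. u m x - u n x) < e"
  obtains f where "f \<in> decay_space" "(\<lambda>n. decay_norm (\<lambda>x. u n x - f x)) \<longlonglongrightarrow> 0"
proof -
  define t :: "nat \<Rightarrow> real" where "t k = (1/2) ^ k" for k
  have tp: "t k > 0" for k by (simp add: t_def)
  obtain nn where nn: "\<And>k m n. m \<ge> nn k \<Longrightarrow> n \<ge> nn k \<Longrightarrow> decay_norm (\<lambda>x. u m x - u n x) < t k"
    using cauchy[OF tp] by metis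
  \<comment> \<open>Summing makes \<open>r\<close> increasing, so that \<open>r k\<close> and \<open>r (Suc k)\<close> are at least \<open>nn k\<close>.\<close>
  define r where "r k = (\<Sum>j\<le>k. nn j)" for k
  have r: "r k \<ge> nn k" "r (Suc k) \<ge> nn k" for k
    unfolding r_def using member_le_sum[of k "{..k}" nn] member_le_sum[of k "{..Suc k}" nn] by auto
  have "\<exists>D. represents (t k) D (\<lambda>x. u (r (Suc k)) x - u (r k) x)" for k
  proof -
    let ?v = "\<lambda>x. u (r (Suc k)) x - u (r k) x"
    have "decay_norm ?v < t k" using nn r by blast
    then obtain D where "represents (decay_norm ?v + (t k - decay_norm ?v)) D ?v"
      using decay_space_representation[OF decay_space_diff[OF u[of "r (Suc k)"] u[of "r k"]], of "t k - decay_norm ?v"] by auto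
    then show ?thesis by auto
  qed
  then obtain D where D: "\<And>k. represents (t k) (D k) (\<lambda>x. u (r (Suc k)) x - u (r k) x)" by metis
  obtain C0 F0 where F0: "represents C0 F0 (u (r 0))" using u[of "r 0"] by (auto simp: decay_space_def)
  have Dm [measurable]: "D k \<in> borel_measurable borel" for k
    using D[of k] by (simp add: represents_def decaying_def)
  have F0m [measurable]: "F0 \<in> borel_measurable borel"
    using F0 by (simp add: represents_def decaying_def)
  have Db: "norm (D k \<xi>) * weight \<xi> \<le> t k" for k \<xi>
    using D[of k] by (simp add: represents_def decaying_def)
  have Db': "norm (D k \<xi>) \<le> t k / weight \<xi>" for k \<xi>
    using Db[of k \<xi>] weight_pos[of \<xi>] by (simp add: field_simps)
  have ts: "summable (\<lambda>j. t (j + k) / weight \<xi>)" for k and \<xi> :: "real^'n"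
    unfolding t_def by (intro summable_divide summable_ignore_initial_segment summable_geometric) simp
  have tsum: "(\<Sum>j. t (j + k) / weight \<xi>) = 2 * t k / weight \<xi>" for k and \<xi> :: "real^'n"
  proof -
    have "(\<Sum>j. t (j + k) / weight \<xi>) = (\<Sum>j. (t k / weight \<xi>) * (1/2) ^ j)"
      by (simp add: t_def power_add mult_ac)
    also have "\<dots> = (t k / weight \<xi>) * (\<Sum>j. (1/2) ^ j)"
      by (intro suminf_mult summable_geometric) simp
    also have "(\<Sum>j. (1/2) ^ j) = (2 :: real)" by (subst suminf_geometric) auto
    finally show ?thesis by simp
  qed
  have Dsn: "summable (\<lambda>j. norm (D (j + k) \<xi>))" for k \<xi>
    by (rule summable_comparison_test[OF _ ts[of k \<xi>]]) (use Db' in auto)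
  have Ds: "summable (\<lambda>j. D j \<xi>)" for \<xi>
    using summable_norm_cancel[OF Dsn[of 0 \<xi>, simplified]] .
  define G where "G \<xi> = F0 \<xi> + (\<Sum>j. D j \<xi>)" for \<xi>
  define P where "P k \<xi> = F0 \<xi> + (\<Sum>j<k. D j \<xi>)" for k \<xi>
  have Gm [measurable]: "G \<in> borel_measurable borel"
    unfolding G_def[abs_def] by measurable
  have rep: "\<exists>C. represents C (P k) (u (r k))" for k
  proof (induction k)
    case 0 then show ?case using F0 by (auto simp: P_def[abs_def])
  next
    case (Suc k)
    then obtain C where "represents C (P k) (u (r k))" by blast
    from represents_add[OF this D[of k]]
    have "represents (C + t k) (\<lambda>\<xi>. P k \<xi> + D k \<xi>) (u (r (Suc k)))" by simp
    moreover have "(\<lambda>\<xi>. P k \<xi> + D k \<xi>) = P (Suc k)" by (simp add: P_def fun_eq_iff)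
    ultimately show ?case by auto
  qed
  have tail: "decaying (2 * t k) (\<lambda>\<xi>. G \<xi> - P k \<xi>)" for k
    unfolding decaying_def
  proof (intro conjI allI)
    show "(\<lambda>\<xi>. G \<xi> - P k \<xi>) \<in> borel_measurable borel" unfolding P_def by measurable
    fix \<xi>
    have "G \<xi> - P k \<xi> = (\<Sum>j. D (j + k) \<xi>)"
      unfolding G_def P_def by (simp add: suminf_minus_initial_segment[OF Ds])
    also have "norm \<dots> \<le> (\<Sum>j. norm (D (j + k) \<xi>))" by (rule summable_norm[OF Dsn])
    also have "\<dots> \<le> (\<Sum>j. t (j + k) / weight \<xi>)" by (intro suminf_le Db' Dsn ts)
    also have "\<dots> = 2 * t k / weight \<xi>" by (rule tsum)
    finally show "norm (G \<xi> - P k \<xi>) * weight \<xi> \<le> 2 * t k" using weight_pos[of \<xi>] by (simp add: field_simps)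
  qed
  have "decaying (C0 + 2 * t 0) G"
    using decaying_add[of C0 F0, OF _ tail[of 0]] F0 by (simp add: P_def represents_def)
  then have Grep: "represents (C0 + 2 * t 0) G (inv_fourier G)" by (rule represents_inv_fourier)
  let ?f = "inv_fourier G"
  have fFS: "?f \<in> decay_space" using Grep by (rule represents_decay_space)
  \<comment> \<open>\<open>represents_diff\<close> only gives a crude constant; the tail estimate replaces it.\<close>
  have close: "decay_norm (\<lambda>x. u (r k) x - ?f x) \<le> 2 * t k" for k
  proof -
    obtain C where C: "represents C (P k) (u (r k))" using rep by blast
    have "represents (C + (C0 + 2 * t 0)) (\<lambda>\<xi>. P k \<xi> - G \<xi>) (\<lambda>x. u (r k) x - ?f x)"
      by (rule represents_diff[OF C Grep])
    moreover have "decaying (2 * t k) (\<lambda>\<xi>. P k \<xi> - G \<xi>)"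
      using decaying_cmult[OF tail[of k], of "-1"] by simp
    ultimately have "represents (2 * t k) (\<lambda>\<xi>. P k \<xi> - G \<xi>) (\<lambda>x. u (r k) x - ?f x)"
      by (simp add: represents_def)
    then show ?thesis by (rule decay_norm_le)
  qed
  have bound: "decay_norm (\<lambda>x. u n x - ?f x) \<le> 3 * t k" if "n \<ge> nn k" for n k
  proof -
    have "decay_norm (\<lambda>x. (u n x - u (r k) x) + (u (r k) x - ?f x)) \<le>
        decay_norm (\<lambda>x. u n x - u (r k) x) + decay_norm (\<lambda>x. u (r k) x - ?f x)"
      by (intro decay_norm_triangle decay_space_diff u fFS)
    also have "\<dots> \<le> t k + 2 * t k"
      using nn[OF that r(1)] close[of k] by (intro add_mono) auto
    finally show ?thesis by simp
  qed
  have "(\<lambda>n. decay_norm (\<lambda>x. u n x - ?f x)) \<longlonglongrightarrow> 0"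
  proof (rule LIMSEQ_I)
    fix e :: real assume "e > 0"
    then obtain k where k: "(1/2 :: real) ^ k < e / 3" using real_arch_pow_inv[of "e/3" "1/2"] by auto
    have "norm (decay_norm (\<lambda>x. u n x - ?f x) - 0) < e" if "n \<ge> nn k" for n
      using bound[OF that] k decay_norm_nonneg[OF decay_space_diff[OF u fFS], of n] by (simp add: t_def)
    then show "\<exists>n0. \<forall>n\<ge>n0. norm (decay_norm (\<lambda>x. u n x - ?f x) - 0) < e" by blast
  qed
  with fFS show ?thesis by (rule that)
qed

lemma banach_decay_space: "banach_function_space (decay_space :: 'n::finite cfun set) decay_norm"
  unfolding banach_function_space_def
proof (intro conjI ballI allI impI)
  show "decay_space \<subseteq> borel_measurable lborel" using decay_space_borel by auto
  show "g \<in> decay_space" if "f \<in> decay_space" "g \<in> borel_measurable lborel" "AE x in lborel. f x = g x" for f g :: "'n cfun"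
  proof -
    obtain C F where "represents C F f" using \<open>f \<in> decay_space\<close> by (auto simp: decay_space_def)
    then have "represents C F g" by (rule represents_cong) (use that in auto)
    then show ?thesis by (rule represents_decay_space)
  qed
  show "(\<lambda>x. 0) \<in> decay_space"
    by (rule represents_decay_space[OF represents_zero]) auto
  show "\<exists>f\<in>decay_space. (\<lambda>n. decay_norm (\<lambda>x. u n x - f x)) \<longlonglongrightarrow> 0"
    if h: "(\<forall>n. u n \<in> decay_space) \<and> (\<forall>e>0. \<exists>n0. \<forall>m\<ge>n0. \<forall>n\<ge>n0. decay_norm (\<lambda>x. u m x - u n x) < e)"
    for u :: "nat \<Rightarrow> 'n cfun"
  proof -
    obtain f where "f \<in> decay_space" "(\<lambda>n. decay_norm (\<lambda>x. u n x - f x)) \<longlonglongrightarrow> 0"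
      by (rule decay_space_complete[of u]) (use h in auto)
    then show ?thesis by blast
  qed
qed (simp_all add: decay_space_add decay_space_cmult decay_norm_nonneg decay_norm_zero_iff decay_norm_triangle decay_norm_cmult)

section \<open>Comparison with the supremum norm\<close>

lemma Linf_bound:
  assumes [measurable]: "f \<in> borel_measurable borel" and b: "AE x in lborel. norm (f x) \<le> B" and B: "B \<ge> 0"
  shows "f \<in> Linf" "Linf_norm f \<le> B"
proof -
  have "esssup lborel (\<lambda>x. ereal (norm (f x))) \<le> ereal B"
    by (rule esssup_I) (use b in auto)
  then show "f \<in> Linf" "Linf_norm f \<le> B"
    using B by (cases "esssup lborel (\<lambda>x. ereal (norm (f x)))"; auto simp: Linf_def Linf_norm_def)+
qed

lemma Linf_AE_bound:
  fixes f :: "'n::finite cfun"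
  assumes "f \<in> Linf"
  shows "f \<in> borel_measurable borel" "AE x in lborel. norm (f x) \<le> Linf_norm f"
proof -
  let ?E = "esssup lborel (\<lambda>x. ereal (norm (f x)))"
  show "f \<in> borel_measurable borel" using assms by (simp add: Linf_def)
  have fin: "?E \<noteq> \<infinity>" using assms by (auto simp: Linf_def)
  have "AE x in lborel. ereal (norm (f x)) \<le> ?E" by (rule esssup_AE)
  then show "AE x in lborel. norm (f x) \<le> Linf_norm f"
  proof eventually_elim
    case (elim x)
    then show ?case using fin by (cases ?E) (auto simp: Linf_norm_def)
  qed
qed

text \<open>
  For a continuous function the set where a bound is violated is open, so it is empty once it is null.
\<close>

lemma Linf_norm_ge_continuous:
  fixes f :: "'n::finite cfun"
  assumes f: "f \<in> Linf" and c: "continuous_on UNIV f"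
  shows "norm (f x) \<le> Linf_norm f"
proof -
  have "\<not> (norm (f x) > Linf_norm f)"
  proof
    assume g: "norm (f x) > Linf_norm f"
    let ?S = "{y. norm (f y) > Linf_norm f}"
    have "AE y in lborel. y \<notin> ?S"
      using Linf_AE_bound(2)[OF f] by eventually_elim simp
    moreover have S: "open ?S"
      by (intro open_Collect_less continuous_intros c)
    ultimately have "?S \<in> null_sets lborel"
      by (subst (asm) AE_iff_null_sets[symmetric]) auto
    then have "negligible ?S"
      using null_sets_completionI negligible_iff_null_sets by blast
    then have "?S = {}" using open_not_negligible[OF S] by blast
    then show False using g by blast
  qed
  then show ?thesis by simp
qed

lemma
  fixes f :: "'n::finite cfun"
  shows decay_space_subset_Linf: "decay_space \<subseteq> (Linf :: 'n cfun set)"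
    and Linf_norm_le_decay_norm: "f \<in> decay_space \<Longrightarrow> Linf_norm f \<le> (\<integral>\<xi>. 1 / weight (\<xi>::real^'n) \<partial>lborel) * decay_norm f"
proof -
  let ?K = "\<integral>\<xi>. 1 / weight (\<xi>::real^'n) \<partial>lborel"
  have K: "?K \<ge> 0" by (intro integral_nonneg_AE AE_I2) (simp add: weight_pos less_imp_le)
  have rep: "f \<in> Linf \<and> Linf_norm f \<le> C * ?K" if "represents C F f" for C F and f :: "'n cfun"
    using Linf_bound[OF _ represents_sup_bound[OF that]] that K
    by (auto simp: represents_def decaying_nonneg)
  then show "decay_space \<subseteq> (Linf :: 'n cfun set)" by (auto simp: decay_space_def)
  assume f: "f \<in> decay_space"
  show "Linf_norm f \<le> ?K * decay_norm f"
  proof (rule field_le_epsilon)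
    fix e :: real assume "e > 0"
    define d where "d = e / (?K + 1)"
    have d: "d > 0" "?K * d \<le> e"
      using \<open>e > 0\<close> K by (auto simp: d_def field_simps)
    obtain F where "represents (decay_norm f + d) F f" using decay_space_representation[OF f d(1)] by blast
    from rep[OF this] d(2) show "Linf_norm f \<le> ?K * decay_norm f + e" by (simp add: algebra_simps)
  qed
qed

lemma decay_space_embedded: "continuously_embedded decay_space decay_norm Linf Linf_norm"
  unfolding continuously_embedded_def using decay_space_subset_Linf Linf_norm_le_decay_norm by blast

section \<open>Existence of solutions\<close>

definition direction_cosine :: "'n::finite \<Rightarrow> real^'n \<Rightarrow> real" where
  "direction_cosine i \<xi> = \<xi> $ i / norm \<xi>"

lemma direction_cosine_bound: "\<bar>direction_cosine i \<xi>\<bar> \<le> 1"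
  using component_le_norm_cart[of \<xi> i] by (simp add: direction_cosine_def divide_le_eq)

lemma direction_cosine_borel [measurable]: "direction_cosine i \<in> borel_measurable borel"
  unfolding direction_cosine_def[abs_def] by measurable

definition riesz_symbol :: "'n::finite \<Rightarrow> 'n cfun" where
  "riesz_symbol i \<xi> = - \<i> * complex_of_real (direction_cosine i \<xi>)"

lemma riesz_symbol_bound: "norm (riesz_symbol i \<xi>) \<le> 1"
  using direction_cosine_bound[of i \<xi>] by (simp add: riesz_symbol_def norm_mult)

lemma riesz_symbol_borel [measurable]: "riesz_symbol i \<in> borel_measurable borel"
  unfolding riesz_symbol_def[abs_def] by measurable

definition flow :: "'n::finite \<Rightarrow> real \<Rightarrow> 'n cfun" where
  "flow i t \<xi> = exp (of_real t * riesz_symbol i \<xi>)"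

lemma flow_norm: "norm (flow i t \<xi>) = 1"
  by (simp add: flow_def riesz_symbol_def)

lemma flow_borel [measurable]: "flow i t \<in> borel_measurable borel"
  unfolding flow_def[abs_def] by measurable

lemma flow_0: "flow i 0 \<xi> = 1"
  by (simp add: flow_def)

lemma flow_lipschitz: "norm (flow i t \<xi> - flow i s \<xi>) \<le> \<bar>t - s\<bar>"
proof -
  have "flow i t \<xi> - flow i s \<xi> = flow i s \<xi> * (iexp (- ((t - s) * direction_cosine i \<xi>)) - 1)"
    by (simp add: flow_def riesz_symbol_def algebra_simps flip: exp_add)
  then have "norm (flow i t \<xi> - flow i s \<xi>) = norm (iexp (- ((t - s) * direction_cosine i \<xi>)) - 1)"
    by (simp only: norm_mult flow_norm mult_1_left)
  also have "\<dots> \<le> \<bar>- ((t - s) * direction_cosine i \<xi>)\<bar>"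
    using iexp_approx1[of "- ((t - s) * direction_cosine i \<xi>)" 0] by simp
  also have "\<dots> \<le> \<bar>t - s\<bar>"
    using direction_cosine_bound[of i \<xi>] by (simp add: abs_mult mult_left_le)
  finally show ?thesis .
qed

lemma riesz_transform_represents:
  assumes f: "represents C F f"
  shows "riesz_transform i f (inv_fourier (\<lambda>\<xi>. riesz_symbol i \<xi> * F \<xi>))"
proof -
  have F: "decaying C F" using f by (simp add: represents_def)
  have "is_fourier_transform (inv_fourier (\<lambda>\<xi>. riesz_symbol i \<xi> * F \<xi>)) (\<lambda>\<xi>. riesz_symbol i \<xi> * F \<xi>)"
    by (rule represents_fourier[OF represents_inv_fourier[OF decaying_mult[OF F riesz_symbol_borel riesz_symbol_bound]]])
  with represents_fourier[OF f] show ?thesis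
    unfolding riesz_transform_def fourier_multiplier_def riesz_symbol_def direction_cosine_def by blast
qed

definition solution :: "'n::finite \<Rightarrow> 'n cfun \<Rightarrow> real \<Rightarrow> 'n cfun" where
  "solution i F t = inv_fourier (\<lambda>\<xi>. flow i t \<xi> * F \<xi>)"

lemma decaying_flow: "decaying C F \<Longrightarrow> decaying C (\<lambda>\<xi>. flow i t \<xi> * F \<xi>)"
  using decaying_mult[of C F "flow i t" 1] by (simp add: flow_norm)

lemma represents_solution: "decaying C F \<Longrightarrow> represents C (\<lambda>\<xi>. flow i t \<xi> * F \<xi>) (solution i F t)"
  unfolding solution_def by (intro represents_inv_fourier decaying_flow)

lemma solution_lipschitz:
  assumes F: "decaying C F"
  shows "decay_norm (\<lambda>x. solution i F s x - solution i F t x) \<le> \<bar>s - t\<bar> * C"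
proof (rule decay_norm_le)
  have "represents (C + C) (\<lambda>\<xi>. flow i s \<xi> * F \<xi> - flow i t \<xi> * F \<xi>) (\<lambda>x. solution i F s x - solution i F t x)"
    by (intro represents_diff represents_solution F)
  moreover have "decaying (\<bar>s - t\<bar> * C) (\<lambda>\<xi>. (flow i s \<xi> - flow i t \<xi>) * F \<xi>)"
    by (rule decaying_mult[OF F _ flow_lipschitz]) measurable
  ultimately show "represents (\<bar>s - t\<bar> * C) (\<lambda>\<xi>. flow i s \<xi> * F \<xi> - flow i t \<xi> * F \<xi>)
      (\<lambda>x. solution i F s x - solution i F t x)"
    by (simp add: represents_def left_diff_distrib)
qed

text \<open>
  The curve is Lipschitz in time, so freezing it on a grid of mesh \<open>1 / n\<close> gives simple functions that
  converge to it at every time.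
\<close>

lemma solution_Linf_time:
  fixes F :: "'n::finite cfun"
  assumes F: "decaying C F"
  shows "solution i F \<in> Linf_time T decay_space decay_norm"
  unfolding Linf_time_def mem_Collect_eq
proof (intro conjI exI)
  let ?f = "solution i F"
  have f: "?f t \<in> decay_space" for t using represents_solution[OF F] by (rule represents_decay_space)
  then show "AE t in lborel. t \<in> {0..T} \<longrightarrow> ?f t \<in> decay_space" by simp
  show "AE t in lborel. t \<in> {0..T} \<longrightarrow> decay_norm (?f t) \<le> C"
    using decay_norm_le[OF represents_solution[OF F]] by simp
  define s where "s n t = ?f (of_int \<lfloor>real n * t\<rfloor> / real n)" for n :: nat and t
  show "\<forall>n. finite (s n ` {0..T}) \<and> s n ` {0..T} \<subseteq> decay_space \<and> (\<forall>y. {t \<in> {0..T}. s n t = y} \<in> sets lborel)"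
  proof (intro allI conjI)
    fix n
    have "s n ` {0..T} \<subseteq> (\<lambda>k. ?f (of_int k / real n)) ` {0..\<lfloor>real n * T\<rfloor>}"
      by (auto simp: s_def intro!: imageI floor_mono mult_left_mono)
    then show "finite (s n ` {0..T})" by (rule finite_subset) simp
    show "s n ` {0..T} \<subseteq> decay_space" using f by (auto simp: s_def)
    fix y
    have "(\<lambda>t. \<lfloor>real n * t\<rfloor>) \<in> borel \<rightarrow>\<^sub>M count_space UNIV" by measurable
    then have "(\<lambda>t. \<lfloor>real n * t\<rfloor>) -` {k. ?f (of_int k / real n) = y} \<inter> space borel \<in> sets borel"
      by (rule measurable_sets) simp
    then have "{0..T} \<inter> ((\<lambda>t. \<lfloor>real n * t\<rfloor>) -` {k. ?f (of_int k / real n) = y}) \<in> sets borel"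
      by (intro sets.Int) auto
    moreover have "{t \<in> {0..T}. s n t = y} = {0..T} \<inter> ((\<lambda>t. \<lfloor>real n * t\<rfloor>) -` {k. ?f (of_int k / real n) = y})"
      by (auto simp: s_def)
    ultimately show "{t \<in> {0..T}. s n t = y} \<in> sets lborel" by simp
  qed
  have "(\<lambda>n. decay_norm (\<lambda>x. s n t x - ?f t x)) \<longlonglongrightarrow> 0" for t
  proof (rule tendsto_sandwich)
    show "\<forall>\<^sub>F n in sequentially. 0 \<le> decay_norm (\<lambda>x. s n t x - ?f t x)"
      unfolding s_def by (intro always_eventually allI decay_norm_nonneg decay_space_diff f)
    show "\<forall>\<^sub>F n in sequentially. decay_norm (\<lambda>x. s n t x - ?f t x) \<le> C / real n"
      using eventually_gt_at_top[of 0]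
    proof eventually_elim
      fix n :: nat assume n: "n > 0"
      have "\<bar>of_int \<lfloor>real n * t\<rfloor> - real n * t\<bar> \<le> 1" by linarith
      then have "\<bar>of_int \<lfloor>real n * t\<rfloor> / real n - t\<bar> \<le> 1 / real n"
      proof -
        have "of_int \<lfloor>real n * t\<rfloor> / real n - t = (of_int \<lfloor>real n * t\<rfloor> - real n * t) / real n"
          using n by (simp add: diff_divide_distrib)
        then have "\<bar>of_int \<lfloor>real n * t\<rfloor> / real n - t\<bar> = \<bar>of_int \<lfloor>real n * t\<rfloor> - real n * t\<bar> / real n"
          by (simp add: abs_divide)
        with \<open>\<bar>of_int \<lfloor>real n * t\<rfloor> - real n * t\<bar> \<le> 1\<close> show ?thesis by (simp add: divide_right_mono)
      qed
      then have "\<bar>of_int \<lfloor>real n * t\<rfloor> / real n - t\<bar> * C \<le> 1 / real n * C"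
        by (rule mult_right_mono) (rule decaying_nonneg[OF F])
      with solution_lipschitz[OF F, of i "of_int \<lfloor>real n * t\<rfloor> / real n" t]
      show "decay_norm (\<lambda>x. s n t x - ?f t x) \<le> C / real n" by (simp add: s_def)
    qed
    show "(\<lambda>n. C / real n) \<longlonglongrightarrow> 0" by (rule lim_const_over_n)
  qed simp
  then show "AE t in lborel. t \<in> {0..T} \<longrightarrow> (\<lambda>n. decay_norm (\<lambda>x. s n t x - ?f t x)) \<longlonglongrightarrow> 0" by simp
qed

lemma inv_fourier_pairing:
  fixes F \<phi> :: "'n::finite cfun"
  assumes F: "integrable lborel F" and \<phi>: "integrable lborel \<phi>"
  shows "(\<integral>x. inv_fourier F x * \<phi> x \<partial>lborel) = (\<integral>\<xi>. F \<xi> * inv_fourier \<phi> \<xi> \<partial>lborel)"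
proof -
  let ?P = "of_real ((2 * pi) ^ CARD('n)) :: complex"
  have "(\<integral>x. inv_fourier F x * \<phi> x \<partial>lborel)
      = (\<integral>x. ((\<integral>\<xi>. iexp (x \<bullet> \<xi>) * F \<xi> \<partial>lborel) * \<phi> x) / ?P \<partial>lborel)"
    by (simp add: inv_fourier_def)
  also have "\<dots> = (\<integral>x. (\<integral>\<xi>. iexp (x \<bullet> \<xi>) * F \<xi> \<partial>lborel) * \<phi> x \<partial>lborel) / ?P"
    by (rule integral_divide_zero)
  also have "(\<integral>x. (\<integral>\<xi>. iexp (x \<bullet> \<xi>) * F \<xi> \<partial>lborel) * \<phi> x \<partial>lborel)
      = (\<integral>\<xi>. F \<xi> * (\<integral>x. iexp (x \<bullet> \<xi>) * \<phi> x \<partial>lborel) \<partial>lborel)"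
    by (rule fubini_bounded_kernel(1)[OF \<phi> F]) (auto intro!: borel_measurable_exp_inner)
  also have "\<dots> / ?P = (\<integral>\<xi>. F \<xi> * inv_fourier \<phi> \<xi> \<partial>lborel)"
    by (simp add: inv_fourier_def inner_commute)
  finally show ?thesis .
qed

lemma flow_integral:
  assumes "t \<ge> 0"
  shows "(\<integral>s. (riesz_symbol i \<xi> * flow i s \<xi>) * indicator {0..t} s \<partial>lborel) = flow i t \<xi> - 1"
proof -
  have "((\<lambda>s. flow i s \<xi>) has_vector_derivative riesz_symbol i \<xi> * flow i s \<xi>) (at s within {0..t})" for s
  proof -
    have "((\<lambda>s. exp (of_real s * riesz_symbol i \<xi>)) has_vector_derivative riesz_symbol i \<xi> * exp (of_real s * riesz_symbol i \<xi>)) (at s within {0..t})"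
      by (rule has_vector_derivative_real_field) (auto intro!: derivative_eq_intros)
    then show ?thesis by (simp add: flow_def)
  qed
  moreover have "continuous_on {0..t} (\<lambda>s. riesz_symbol i \<xi> * flow i s \<xi>)"
    unfolding flow_def by (intro continuous_intros)
  ultimately have "(\<integral>s. indicator {0..t} s *\<^sub>R (riesz_symbol i \<xi> * flow i s \<xi>) \<partial>lborel) = flow i t \<xi> - flow i 0 \<xi>"
    by (intro integral_FTC_Icc) (use assms in auto)
  also have "(\<lambda>s. indicator {0..t} s *\<^sub>R (riesz_symbol i \<xi> * flow i s \<xi>)) = (\<lambda>s. (riesz_symbol i \<xi> * flow i s \<xi>) * indicator {0..t} s)"
    by (auto simp: indicator_def fun_eq_iff)
  finally show ?thesis by (simp add: flow_0)
qed

text \<open>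
  Paired with a test function, both sides become integrals over the spectrum, and the equation reduces
  to the fundamental theorem of calculus for \<open>s \<mapsto> exp (s m(\<xi>))\<close> at each frequency.
\<close>

lemma solution_cauchy:
  fixes F :: "'n::finite cfun"
  assumes F: "decaying C F"
  shows "cauchy_solution (riesz_transform i) Linf decay_space decay_norm T (inv_fourier F) (solution i F)"
  unfolding cauchy_solution_def
proof (intro conjI ballI)
  show "solution i F \<in> Linf_time T decay_space decay_norm" by (rule solution_Linf_time[OF F])
  show "solution i F t \<in> Linf" for t
    using decay_space_subset_Linf represents_decay_space[OF represents_solution[OF F]] by blast
  show "AE x in lborel. solution i F 0 x = inv_fourier F x" by (simp add: solution_def flow_0)
  define g where "g s = inv_fourier (\<lambda>\<xi>. riesz_symbol i \<xi> * (flow i s \<xi> * F \<xi>))" for s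
  have Fs: "decaying (1 * C) (\<lambda>\<xi>. riesz_symbol i \<xi> * (flow i s \<xi> * F \<xi>))" for s
    by (rule decaying_mult[OF decaying_flow[OF F] riesz_symbol_borel riesz_symbol_bound])
  show "\<exists>g. (AE s in lborel. s \<in> {0..T} \<longrightarrow> riesz_transform i (solution i F s) (g s) \<and> tempered (g s)) \<and>
        (\<forall>\<phi>. schwartz \<phi> \<longrightarrow>
           set_integrable lborel {0..T} (\<lambda>s. \<integral>x. g s x * \<phi> x \<partial>lborel) \<and>
           (\<forall>t\<in>{0..T}. (\<integral>x. solution i F t x * \<phi> x \<partial>lborel) =
              (\<integral>x. inv_fourier F x * \<phi> x \<partial>lborel) +
              (LINT s:{0..t}|lborel. (\<integral>x. g s x * \<phi> x \<partial>lborel))))"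
  proof (intro exI[of _ g] conjI allI impI ballI)
    have "riesz_transform i (solution i F s) (g s)" for s
      unfolding g_def by (rule riesz_transform_represents[OF represents_solution[OF F]])
    moreover have "tempered (g s)" for s
      using represents_fourier[OF represents_inv_fourier[OF Fs]] by (simp add: g_def is_fourier_transform_def)
    ultimately show "AE s in lborel. s \<in> {0..T} \<longrightarrow> riesz_transform i (solution i F s) (g s) \<and> tempered (g s)"
      by simp
    fix \<phi> :: "'n cfun" assume \<phi>: "schwartz \<phi>"
    have \<phi>i: "integrable lborel \<phi>" by (rule schwartz_integrable[OF \<phi>])
    have [measurable]: "\<phi> \<in> borel_measurable borel" "F \<in> borel_measurable borel"
      using schwartz_borel[OF \<phi>] F by (auto simp: decaying_def)
    define L where "L \<xi> = F \<xi> * inv_fourier \<phi> \<xi>" for \<xi>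
    have L: "integrable lborel L"
    proof (rule Bochner_Integration.integrable_bound)
      let ?B = "\<integral>x. norm (\<phi> x) \<partial>lborel"
      show "integrable lborel (\<lambda>\<xi>. F \<xi> * of_real ?B)"
        by (intro integrable_mult_left decaying_integrable[OF F])
      have "norm (inv_fourier \<phi> \<xi>) \<le> norm (complex_of_real ?B)" for \<xi>
        using inv_fourier_norm_le[of \<phi> \<xi>] by simp
      then show "AE \<xi> in lborel. norm (L \<xi>) \<le> norm (F \<xi> * of_real ?B)"
        unfolding L_def norm_mult by (intro AE_I2 mult_left_mono) auto
      show "L \<in> borel_measurable lborel" unfolding L_def by measurable
    qed
    let ?k = "\<lambda>s \<xi>. riesz_symbol i \<xi> * flow i s \<xi>"
    have km: "(\<lambda>(s, \<xi>). ?k s \<xi>) \<in> borel_measurable (borel \<Otimes>\<^sub>M borel)"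
      unfolding flow_def case_prod_unfold by measurable
    have kb: "norm (?k s \<xi>) \<le> 1" for s \<xi>
      using riesz_symbol_bound[of i \<xi>] by (simp add: norm_mult flow_norm)
    have gs: "(\<integral>x. g s x * \<phi> x \<partial>lborel) = (\<integral>\<xi>. ?k s \<xi> * L \<xi> \<partial>lborel)" for s
      unfolding g_def L_def
      by (subst inv_fourier_pairing[OF decaying_integrable[OF Fs] \<phi>i]) (simp add: mult.assoc)
    have fs: "(\<integral>x. solution i F t x * \<phi> x \<partial>lborel) = (\<integral>\<xi>. flow i t \<xi> * L \<xi> \<partial>lborel)" for t
      unfolding solution_def L_def
      by (subst inv_fourier_pairing[OF decaying_integrable[OF decaying_flow[OF F]] \<phi>i]) (simp add: mult.assoc)
    have f0: "(\<integral>x. inv_fourier F x * \<phi> x \<partial>lborel) = (\<integral>\<xi>. L \<xi> \<partial>lborel)"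
      unfolding L_def by (rule inv_fourier_pairing[OF decaying_integrable[OF F] \<phi>i])
    have Ii: "integrable lborel (indicator {0..t} :: real \<Rightarrow> complex)" for t
    proof -
      have "integrable lborel (\<lambda>x. complex_of_real (indicator {0..t} x))"
        by (intro integrable_of_real integrable_real_indicator) (auto simp: emeasure_lborel_Icc_eq)
      moreover have "(\<lambda>x. complex_of_real (indicator {0..t} x)) = indicator {0..t}"
        by (auto simp: fun_eq_iff indicator_def)
      ultimately show ?thesis by (simp only:)
    qed
    have ind: "indicator {0..t} s *\<^sub>R z = z * indicator {0..t} s" for t s :: real and z :: complex
      by (auto simp: indicator_def)
    show "set_integrable lborel {0..T} (\<lambda>s. \<integral>x. g s x * \<phi> x \<partial>lborel)"
      unfolding set_integrable_def gs ind by (rule fubini_bounded_kernel(2)[OF Ii L km kb])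
    fix t assume t: "t \<in> {0..T}"
    have "(LINT s:{0..t}|lborel. (\<integral>x. g s x * \<phi> x \<partial>lborel)) = (\<integral>s. (\<integral>\<xi>. ?k s \<xi> * L \<xi> \<partial>lborel) * indicator {0..t} s \<partial>lborel)"
      unfolding set_lebesgue_integral_def gs ind ..
    also have "\<dots> = (\<integral>\<xi>. L \<xi> * (\<integral>s. ?k s \<xi> * indicator {0..t} s \<partial>lborel) \<partial>lborel)"
      by (rule fubini_bounded_kernel(1)[OF Ii L km kb])
    also have "\<dots> = (\<integral>\<xi>. flow i t \<xi> * L \<xi> - L \<xi> \<partial>lborel)"
    proof -
      have "t \<ge> 0" using t by simp
      then show ?thesis by (simp only: flow_integral) (simp add: algebra_simps)
    qed
    also have "\<dots> = (\<integral>\<xi>. flow i t \<xi> * L \<xi> \<partial>lborel) - (\<integral>\<xi>. L \<xi> \<partial>lborel)"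
    proof (rule Bochner_Integration.integral_diff[OF _ L])
      have [measurable]: "L \<in> borel_measurable borel" unfolding L_def by measurable
      show "integrable lborel (\<lambda>\<xi>. flow i t \<xi> * L \<xi>)"
        by (rule Bochner_Integration.integrable_bound[OF L]) (auto simp: norm_mult flow_norm)
    qed
    finally show "(\<integral>x. solution i F t x * \<phi> x \<partial>lborel) = (\<integral>x. inv_fourier F x * \<phi> x \<partial>lborel) +
        (LINT s:{0..t}|lborel. (\<integral>x. g s x * \<phi> x \<partial>lborel))"
      unfolding fs f0 by simp
  qed
qed

section \<open>Uniqueness of solutions\<close>

lemma is_fourier_transform_cong:
  fixes G G' :: "'n::finite cfun"
  assumes g: "is_fourier_transform g G" and [measurable]: "G' \<in> borel_measurable borel"
    and eq: "AE \<xi> in lborel. G \<xi> = G' \<xi>"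
  shows "is_fourier_transform g G'"
  unfolding is_fourier_transform_def
proof (intro conjI allI impI)
  show "tempered g" using g by (simp add: is_fourier_transform_def)
  have tG: "tempered G" using g by (simp add: is_fourier_transform_def)
  then have [measurable]: "G \<in> borel_measurable borel" by (simp add: tempered_def)
  have ae: "AE \<xi> in lborel. G \<xi> * \<phi> \<xi> = G' \<xi> * \<phi> \<xi>" for \<phi> :: "'n cfun"
    using eq by eventually_elim simp
  show "tempered G'"
    unfolding tempered_def
  proof (intro conjI allI impI)
    fix \<phi> :: "'n cfun" assume \<phi>: "schwartz \<phi>"
    note [measurable] = schwartz_borel[OF \<phi>]
    have "integrable lborel (\<lambda>\<xi>. G \<xi> * \<phi> \<xi>)" using tG \<phi> by (simp add: tempered_def)
    then show "integrable lborel (\<lambda>\<xi>. G' \<xi> * \<phi> \<xi>)"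
      by (rule integrable_cong_AE_imp[OF _ _ ae]) simp
  qed simp
  fix \<phi> :: "'n cfun" assume \<phi>: "schwartz \<phi>"
  note [measurable] = schwartz_borel[OF \<phi>]
  have "(\<integral>x. g x * fourier \<phi> x \<partial>lborel) = (\<integral>\<xi>. G \<xi> * \<phi> \<xi> \<partial>lborel)"
    using g \<phi> by (simp add: is_fourier_transform_def)
  also have "\<dots> = (\<integral>\<xi>. G' \<xi> * \<phi> \<xi> \<partial>lborel)"
    by (rule integral_cong_AE) (use ae[of \<phi>] in auto)
  finally show "(\<integral>x. g x * fourier \<phi> x \<partial>lborel) = (\<integral>\<xi>. G' \<xi> * \<phi> \<xi> \<partial>lborel)" .
qed

text \<open>
  A solution carries, at almost every time, a spectrum bounded uniformly in time. The transform that
  witnesses the Riesz transform in the equation agrees with it almost everywhere, by uniqueness of the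
  Fourier transform.
\<close>

lemma solution_spectrum:
  fixes h :: "real \<Rightarrow> 'n::finite cfun"
  assumes h: "cauchy_solution (riesz_transform i) Linf decay_space decay_norm T f0 h"
  obtains M H g where
    "AE s in lborel. s \<in> {0..T} \<longrightarrow> decaying M (H s) \<and> is_fourier_transform (h s) (H s) \<and>
       is_fourier_transform (g s) (\<lambda>\<xi>. riesz_symbol i \<xi> * H s \<xi>)"
    "\<And>\<phi>. schwartz \<phi> \<Longrightarrow> set_integrable lborel {0..T} (\<lambda>s. \<integral>x. g s x * \<phi> x \<partial>lborel)"
    "\<And>\<phi> t. schwartz \<phi> \<Longrightarrow> t \<in> {0..T} \<Longrightarrow> (\<integral>x. h t x * \<phi> x \<partial>lborel) =
       (\<integral>x. f0 x * \<phi> x \<partial>lborel) + (LINT s:{0..t}|lborel. (\<integral>x. g s x * \<phi> x \<partial>lborel))"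
proof -
  obtain g where
    gF: "AE s in lborel. s \<in> {0..T} \<longrightarrow> riesz_transform i (h s) (g s) \<and> tempered (g s)" and
    gi: "\<And>\<phi>. schwartz \<phi> \<Longrightarrow> set_integrable lborel {0..T} (\<lambda>s. \<integral>x. g s x * \<phi> x \<partial>lborel)" and
    ge: "\<And>\<phi> t. schwartz \<phi> \<Longrightarrow> t \<in> {0..T} \<Longrightarrow> (\<integral>x. h t x * \<phi> x \<partial>lborel) =
       (\<integral>x. f0 x * \<phi> x \<partial>lborel) + (LINT s:{0..t}|lborel. (\<integral>x. g s x * \<phi> x \<partial>lborel))"
    using h unfolding cauchy_solution_def by blast
  have hT: "h \<in> Linf_time T decay_space decay_norm" using h by (simp add: cauchy_solution_def)
  then have hFS: "AE s in lborel. s \<in> {0..T} \<longrightarrow> h s \<in> decay_space"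
    unfolding Linf_time_def by blast
  obtain M where hM: "AE s in lborel. s \<in> {0..T} \<longrightarrow> decay_norm (h s) \<le> M"
    using hT unfolding Linf_time_def by blast
  define H where "H s = (SOME F. represents (M + 1) F (h s))" for s
  have "AE s in lborel. s \<in> {0..T} \<longrightarrow> decaying (M + 1) (H s) \<and> is_fourier_transform (h s) (H s) \<and>
       is_fourier_transform (g s) (\<lambda>\<xi>. riesz_symbol i \<xi> * H s \<xi>)"
    using hFS hM gF
  proof eventually_elim
    fix s
    assume s: "s \<in> {0..T} \<longrightarrow> h s \<in> decay_space" "s \<in> {0..T} \<longrightarrow> decay_norm (h s) \<le> M"
      "s \<in> {0..T} \<longrightarrow> riesz_transform i (h s) (g s) \<and> tempered (g s)"
    show "s \<in> {0..T} \<longrightarrow> decaying (M + 1) (H s) \<and> is_fourier_transform (h s) (H s) \<and>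
       is_fourier_transform (g s) (\<lambda>\<xi>. riesz_symbol i \<xi> * H s \<xi>)"
    proof
      assume "s \<in> {0..T}"
      with s have hs: "h s \<in> decay_space" "decay_norm (h s) \<le> M" "riesz_transform i (h s) (g s)" by auto
      obtain F where "represents (decay_norm (h s) + 1) F (h s)"
        using decay_space_representation[OF hs(1), of 1] by auto
      then have "represents (M + 1) F (h s)" by (rule represents_mono) (use hs(2) in simp)
      then have rep: "represents (M + 1) (H s) (h s)" unfolding H_def by (rule someI[where P = "\<lambda>F. represents (M + 1) F (h s)"])
      then have FT: "is_fourier_transform (h s) (H s)" by (rule represents_fourier)
      have dec: "decaying (M + 1) (H s)" using rep by (simp add: represents_def)
      then have [measurable]: "H s \<in> borel_measurable borel" by (simp add: decaying_def)
      obtain F' where F': "is_fourier_transform (h s) F'" "is_fourier_transform (g s) (\<lambda>\<xi>. riesz_symbol i \<xi> * F' \<xi>)"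
        using hs(3) unfolding riesz_transform_def fourier_multiplier_def riesz_symbol_def direction_cosine_def by blast
      have "AE \<xi> in lborel. F' \<xi> = H s \<xi>" by (rule fourier_transform_unique[OF F'(1) FT])
      then have "AE \<xi> in lborel. riesz_symbol i \<xi> * F' \<xi> = riesz_symbol i \<xi> * H s \<xi>" by eventually_elim simp
      then have "is_fourier_transform (g s) (\<lambda>\<xi>. riesz_symbol i \<xi> * H s \<xi>)"
        by (rule is_fourier_transform_cong[OF F'(2), rotated]) measurable
      with dec FT show "decaying (M + 1) (H s) \<and> is_fourier_transform (h s) (H s) \<and>
         is_fourier_transform (g s) (\<lambda>\<xi>. riesz_symbol i \<xi> * H s \<xi>)" by blast
    qed
  qed
  then show ?thesis using gi ge that by blast
qed

lemma gauss_bump_test_bound: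
  fixes G :: "'n::finite cfun"
  assumes [measurable]: "G \<in> borel_measurable borel" and B: "AE \<xi> in lborel. norm (G \<xi>) \<le> B" and \<sigma>: "\<sigma> > 0"
  shows "norm (\<integral>\<xi>. G \<xi> * gauss_bump \<sigma> y \<xi> \<partial>lborel) \<le> B * \<sigma> ^ CARD('n)"
proof -
  let ?b = "\<lambda>\<xi>::real^'n. std_gauss ((1 / \<sigma>) *\<^sub>R (\<xi> - y))"
  have "integrable lborel (\<lambda>\<xi>. 1 * complex_of_real (?b \<xi>))"
    and "(\<integral>\<xi>. 1 * complex_of_real (?b \<xi>) \<partial>lborel) = of_real (\<sigma> ^ CARD('n)) * (\<integral>\<eta>. 1 * of_real (std_gauss (\<eta>::real^'n)) \<partial>lborel)"
    by (rule gauss_rescale[where B=1]; use \<sigma> in simp)+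
  then have bi: "integrable lborel ?b" and b1: "(\<integral>\<xi>. ?b \<xi> \<partial>lborel) = \<sigma> ^ CARD('n)"
    by (simp_all only: mult_1_left complex_of_real_integrable_eq integral_complex_of_real integral_std_gauss
        of_real_1 mult_1_right of_real_eq_iff)
  have n: "norm (gauss_bump \<sigma> y \<xi>) = ?b \<xi>" for \<xi>
    using std_gauss_pos[of "(1 / \<sigma>) *\<^sub>R (\<xi> - y)"] by (simp add: gauss_bump_def)
  have "norm (\<integral>\<xi>. G \<xi> * gauss_bump \<sigma> y \<xi> \<partial>lborel) \<le> (\<integral>\<xi>. norm (G \<xi> * gauss_bump \<sigma> y \<xi>) \<partial>lborel)"
    by (rule integral_norm_bound)
  also have "\<dots> \<le> (\<integral>\<xi>. B * ?b \<xi> \<partial>lborel)"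
  proof (rule integral_mono_AE)
    show Bi: "integrable lborel (\<lambda>\<xi>. B * ?b \<xi>)" by (intro integrable_mult_right bi)
    show le: "AE \<xi> in lborel. norm (G \<xi> * gauss_bump \<sigma> y \<xi>) \<le> B * ?b \<xi>"
      using B by eventually_elim (simp add: norm_mult n mult_right_mono less_imp_le std_gauss_pos)
    show "integrable lborel (\<lambda>\<xi>. norm (G \<xi> * gauss_bump \<sigma> y \<xi>))"
    proof (rule Bochner_Integration.integrable_bound[OF Bi])
      show "AE \<xi> in lborel. norm (norm (G \<xi> * gauss_bump \<sigma> y \<xi>)) \<le> norm (B * ?b \<xi>)"
        using le
      proof eventually_elim
        case (elim \<xi>)
        then show ?case
          unfolding real_norm_def abs_norm_cancel using abs_ge_self[of "B * ?b \<xi>"] by linarith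
      qed
    qed measurable
  qed
  also have "\<dots> = B * \<sigma> ^ CARD('n)" by (simp only: integral_mult_right_zero b1)
  finally show ?thesis .
qed

text \<open>
  Picard iteration for the spectrum \<open>V\<close> of the difference of two solutions. The explicit bounds
  \<open>M s\<^sup>n / n!\<close> are integrated in time rather than the norm of \<open>V(s)\<close>, which is not known to be
  measurable in \<open>s\<close>.
\<close>

lemma cauchy_solution_unique:
  fixes h k :: "real \<Rightarrow> 'n::finite cfun"
  assumes h: "cauchy_solution (riesz_transform i) Linf decay_space decay_norm T f0 h"
    and k: "cauchy_solution (riesz_transform i) Linf decay_space decay_norm T f0 k"
    and t: "t \<in> {0..T}"
  shows "AE x in lborel. h t x = k t x"
proof -
  obtain M1 H g where
    H: "AE s in lborel. s \<in> {0..T} \<longrightarrow> decaying M1 (H s) \<and> is_fourier_transform (h s) (H s) \<and>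
       is_fourier_transform (g s) (\<lambda>\<xi>. riesz_symbol i \<xi> * H s \<xi>)" and
    gi: "\<And>\<phi>. schwartz \<phi> \<Longrightarrow> set_integrable lborel {0..T} (\<lambda>s. \<integral>x. g s x * \<phi> x \<partial>lborel)" and
    ge: "\<And>\<phi> t. schwartz \<phi> \<Longrightarrow> t \<in> {0..T} \<Longrightarrow> (\<integral>x. h t x * \<phi> x \<partial>lborel) =
       (\<integral>x. f0 x * \<phi> x \<partial>lborel) + (LINT s:{0..t}|lborel. (\<integral>x. g s x * \<phi> x \<partial>lborel))"
    using solution_spectrum[OF h] by blast
  obtain M2 K l where
    K: "AE s in lborel. s \<in> {0..T} \<longrightarrow> decaying M2 (K s) \<and> is_fourier_transform (k s) (K s) \<and>
       is_fourier_transform (l s) (\<lambda>\<xi>. riesz_symbol i \<xi> * K s \<xi>)" and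
    li: "\<And>\<phi>. schwartz \<phi> \<Longrightarrow> set_integrable lborel {0..T} (\<lambda>s. \<integral>x. l s x * \<phi> x \<partial>lborel)" and
    le: "\<And>\<phi> t. schwartz \<phi> \<Longrightarrow> t \<in> {0..T} \<Longrightarrow> (\<integral>x. k t x * \<phi> x \<partial>lborel) =
       (\<integral>x. f0 x * \<phi> x \<partial>lborel) + (LINT s:{0..t}|lborel. (\<integral>x. l s x * \<phi> x \<partial>lborel))"
    using solution_spectrum[OF k] by blast
  define V where "V s \<xi> = H s \<xi> - K s \<xi>" for s \<xi>
  define M where "M = M1 + M2"
  define D where "D \<phi> s = (\<integral>x. g s x * \<phi> x \<partial>lborel) - (\<integral>x. l s x * \<phi> x \<partial>lborel)" for \<phi> s
  have Di: "set_integrable lborel {0..t} (D \<phi>)" if "schwartz \<phi>" "t \<in> {0..T}" for \<phi> t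
  proof -
    have "set_integrable lborel {0..T} (D \<phi>)"
      unfolding D_def by (intro set_integral_diff gi li that)
    then show ?thesis by (rule set_integrable_subset) (use that in auto)
  qed
  have diff: "(\<integral>x. h t x * \<phi> x \<partial>lborel) - (\<integral>x. k t x * \<phi> x \<partial>lborel) = (LINT s:{0..t}|lborel. D \<phi> s)"
    if \<phi>: "schwartz \<phi>" and t: "t \<in> {0..T}" for \<phi> t
  proof -
    have "set_integrable lborel {0..t} (\<lambda>s. \<integral>x. g s x * \<phi> x \<partial>lborel)"
      "set_integrable lborel {0..t} (\<lambda>s. \<integral>x. l s x * \<phi> x \<partial>lborel)"
      by (rule set_integrable_subset[OF gi[OF \<phi>]], use t in auto)
        (rule set_integrable_subset[OF li[OF \<phi>]], use t in auto)
    then show ?thesis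
      unfolding D_def by (simp add: ge[OF \<phi> t] le[OF \<phi> t] set_integral_diff)
  qed
  \<comment> \<open>The times at which both spectra exist and all identities can be tested; almost every time is good.\<close>
  define good where "good s \<longleftrightarrow> decaying M (V s) \<and>
      (\<forall>\<phi>. schwartz \<phi> \<longrightarrow>
        (\<integral>x. h s x * fourier \<phi> x \<partial>lborel) - (\<integral>x. k s x * fourier \<phi> x \<partial>lborel) = (\<integral>\<xi>. V s \<xi> * \<phi> \<xi> \<partial>lborel) \<and>
        D (fourier \<phi>) s = (\<integral>\<xi>. (riesz_symbol i \<xi> * V s \<xi>) * \<phi> \<xi> \<partial>lborel)) \<and>
      is_fourier_transform (h s) (H s) \<and> is_fourier_transform (k s) (K s) \<and>
      is_fourier_transform (g s) (\<lambda>\<xi>. riesz_symbol i \<xi> * H s \<xi>) \<and> is_fourier_transform (l s) (\<lambda>\<xi>. riesz_symbol i \<xi> * K s \<xi>)" for s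
  have good: "AE s in lborel. s \<in> {0..T} \<longrightarrow> good s"
    using H K
  proof eventually_elim
    fix s
    assume a: "s \<in> {0..T} \<longrightarrow> decaying M1 (H s) \<and> is_fourier_transform (h s) (H s) \<and>
        is_fourier_transform (g s) (\<lambda>\<xi>. riesz_symbol i \<xi> * H s \<xi>)"
      "s \<in> {0..T} \<longrightarrow> decaying M2 (K s) \<and> is_fourier_transform (k s) (K s) \<and>
        is_fourier_transform (l s) (\<lambda>\<xi>. riesz_symbol i \<xi> * K s \<xi>)"
    show "s \<in> {0..T} \<longrightarrow> good s"
    proof
      assume "s \<in> {0..T}"
      with a have b: "decaying M1 (H s)" "is_fourier_transform (h s) (H s)"
        "is_fourier_transform (g s) (\<lambda>\<xi>. riesz_symbol i \<xi> * H s \<xi>)" "decaying M2 (K s)"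
        "is_fourier_transform (k s) (K s)" "is_fourier_transform (l s) (\<lambda>\<xi>. riesz_symbol i \<xi> * K s \<xi>)" by auto
      have "decaying (M1 + norm (-1::complex) * M2) (\<lambda>\<xi>. H s \<xi> + (-1) * K s \<xi>)"
        by (intro decaying_add decaying_cmult b)
      then have V: "decaying M (V s)" by (simp add: M_def V_def[abs_def])
      have *: "(\<integral>x. p x * fourier \<phi> x \<partial>lborel) - (\<integral>x. q x * fourier \<phi> x \<partial>lborel)
          = (\<integral>\<xi>. (P \<xi> - Q \<xi>) * \<phi> \<xi> \<partial>lborel)"
        if "is_fourier_transform p P" "is_fourier_transform q Q" "schwartz \<phi>" for p q P Q \<phi> :: "'n cfun"
      proof -
        have "integrable lborel (\<lambda>\<xi>. P \<xi> * \<phi> \<xi>)" "integrable lborel (\<lambda>\<xi>. Q \<xi> * \<phi> \<xi>)"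
          using that by (auto simp: is_fourier_transform_def tempered_def)
        then show ?thesis
          using that by (simp add: is_fourier_transform_def left_diff_distrib)
      qed
      show "good s"
        unfolding good_def
        using V b *[OF b(2) b(5)] *[OF b(3) b(6)]
        by (auto simp: V_def D_def right_diff_distrib)
    qed
  qed
  \<comment> \<open>One Picard step at a good time; for \<open>n = 0\<close> the bound is the uniform bound on the spectra.\<close>
  have step: "AE \<xi> in lborel. norm (V t \<xi>) \<le> M * t ^ n / fact n" if t: "t \<in> {0..T}" and gt: "good t"
    and bound: "\<And>m. n = Suc m \<Longrightarrow> AE s in lborel. s \<in> {0..T} \<longrightarrow> (AE \<xi> in lborel. norm (V s \<xi>) \<le> M * s ^ m / fact m)"
    for n t
  proof (cases n)
    case 0
    then show ?thesis using gt decaying_bound[of M "V t"] by (simp add: good_def)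
  next
    case (Suc m)
    show ?thesis
    proof (rule bounded_by_gauss_tests)
      show "integrable lborel (V t)" using gt by (auto simp: good_def intro: decaying_integrable)
      fix \<sigma> :: real and y :: "real^'n" assume \<sigma>: "\<sigma> > 0"
      let ?c = "\<sigma> ^ CARD('n)"
      let ?b = "gauss_bump \<sigma> y"
      have b: "schwartz ?b" "schwartz (fourier ?b)"
        by (rule schwartz_gauss_bump[OF \<sigma>], rule schwartz_fourier_gauss_bump[OF \<sigma>])
      have "(\<integral>\<xi>. V t \<xi> * ?b \<xi> \<partial>lborel) = (LINT s:{0..t}|lborel. D (fourier ?b) s)"
      proof -
        have "(\<integral>x. h t x * fourier ?b x \<partial>lborel) - (\<integral>x. k t x * fourier ?b x \<partial>lborel)
            = (\<integral>\<xi>. V t \<xi> * ?b \<xi> \<partial>lborel)"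
          using gt b(1) unfolding good_def by blast
        with diff[OF b(2) t] show ?thesis by simp
      qed
      also have "norm \<dots> \<le> (LINT s:{0..t}|lborel. norm (D (fourier ?b) s))"
        unfolding set_lebesgue_integral_def
        by (rule order_trans[OF integral_norm_bound]) simp
      also have "\<dots> \<le> (LINT s:{0..t}|lborel. (M * ?c / fact m) * s ^ m)"
      proof (rule set_integral_mono_AE)
        show "set_integrable lborel {0..t} (\<lambda>s. norm (D (fourier ?b) s))"
          by (intro set_integrable_norm Di b t)
        show "set_integrable lborel {0..t} (\<lambda>s. (M * ?c / fact m) * s ^ m)"
          by (intro borel_integrable_atLeastAtMost' continuous_intros)
        show "AE s\<in>{0..t} in lborel. norm (D (fourier ?b) s) \<le> (M * ?c / fact m) * s ^ m"
          using good bound[OF Suc]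
        proof eventually_elim
          fix s assume s: "s \<in> {0..T} \<longrightarrow> good s" "s \<in> {0..T} \<longrightarrow> (AE \<xi> in lborel. norm (V s \<xi>) \<le> M * s ^ m / fact m)"
          show "s \<in> {0..t} \<longrightarrow> norm (D (fourier ?b) s) \<le> (M * ?c / fact m) * s ^ m"
          proof
            assume "s \<in> {0..t}"
            with t s have gs: "good s" and ae: "AE \<xi> in lborel. norm (V s \<xi>) \<le> M * s ^ m / fact m" by auto
            have [measurable]: "V s \<in> borel_measurable borel" using gs by (simp add: good_def decaying_def)
            have "D (fourier ?b) s = (\<integral>\<xi>. (riesz_symbol i \<xi> * V s \<xi>) * ?b \<xi> \<partial>lborel)"
              using gs b unfolding good_def by blast
            also have "norm \<dots> \<le> (M * s ^ m / fact m) * ?c"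
            proof (rule gauss_bump_test_bound[OF _ _ \<sigma>])
              show "AE \<xi> in lborel. norm (riesz_symbol i \<xi> * V s \<xi>) \<le> M * s ^ m / fact m"
                using ae
              proof eventually_elim
                fix \<xi> assume "norm (V s \<xi>) \<le> M * s ^ m / fact m"
                then show "norm (riesz_symbol i \<xi> * V s \<xi>) \<le> M * s ^ m / fact m"
                  using mult_right_mono[OF riesz_symbol_bound[of i \<xi>], of "norm (V s \<xi>)"] by (simp add: norm_mult)
              qed
            qed measurable
            finally show "norm (D (fourier ?b) s) \<le> (M * ?c / fact m) * s ^ m" by (simp add: mult_ac)
          qed
        qed
      qed
      also have "\<dots> = (M * ?c / fact m) * (LINT s:{0..t}|lborel. s ^ m)"
        by (rule set_integral_mult_right)
      also have "(LINT s:{0..t}|lborel. s ^ m) = t ^ Suc m / Suc m"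
        using integral_power[of 0 t m] t unfolding set_lebesgue_integral_def
        by (simp add: mult.commute)
      also have "(M * ?c / fact m) * (t ^ Suc m / Suc m) = (M * t ^ n / fact n) * ?c"
        unfolding Suc fact_Suc by (simp add: field_simps)
      finally show "norm (\<integral>\<xi>. V t \<xi> * ?b \<xi> \<partial>lborel) \<le> (M * t ^ n / fact n) * ?c" .
    qed
  qed
  have Vn: "AE s in lborel. s \<in> {0..T} \<longrightarrow> (AE \<xi> in lborel. norm (V s \<xi>) \<le> M * s ^ n / fact n)" for n
  proof (induction n)
    case 0
    show ?case using good by eventually_elim (use step[where n = 0] in simp)
  next
    case (Suc n)
    show ?case
      using good
    proof eventually_elim
      case (elim s)
      show ?case
      proof
        assume "s \<in> {0..T}"
        with elim show "AE \<xi> in lborel. norm (V s \<xi>) \<le> M * s ^ Suc n / fact (Suc n)"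
          using Suc.IH by (intro step) simp_all
      qed
    qed
  qed
  \<comment> \<open>The spectra agree at almost every time, so the right hand sides of the equation agree at every time.\<close>
  have V0: "AE s in lborel. s \<in> {0..T} \<longrightarrow> (AE \<xi> in lborel. H s \<xi> = K s \<xi>)"
  proof -
    have "AE s in lborel. \<forall>n. s \<in> {0..T} \<longrightarrow> (AE \<xi> in lborel. norm (V s \<xi>) \<le> M * s ^ n / fact n)"
      unfolding AE_all_countable using Vn by blast
    then show ?thesis
    proof eventually_elim
      fix s assume a: "\<forall>n. s \<in> {0..T} \<longrightarrow> (AE \<xi> in lborel. norm (V s \<xi>) \<le> M * s ^ n / fact n)"
      show "s \<in> {0..T} \<longrightarrow> (AE \<xi> in lborel. H s \<xi> = K s \<xi>)"
      proof
        assume s: "s \<in> {0..T}"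
        have "AE \<xi> in lborel. \<forall>n. norm (V s \<xi>) \<le> M * s ^ n / fact n"
          using a s by (simp only: AE_all_countable) blast
        then show "AE \<xi> in lborel. H s \<xi> = K s \<xi>"
        proof eventually_elim
          case (elim \<xi>)
          have "(\<lambda>n. M * (inverse (fact n) * s ^ n)) \<longlonglongrightarrow> M * 0"
            by (intro tendsto_mult_left summable_LIMSEQ_zero summable_exp)
          then have "norm (V s \<xi>) \<le> M * 0"
            by (rule LIMSEQ_le_const) (use elim in \<open>auto simp: divide_inverse mult_ac\<close>)
          then show ?case by (simp add: V_def)
        qed
      qed
    qed
  qed
  have tempered: "tempered (f t)" if "cauchy_solution (riesz_transform i) Linf decay_space decay_norm T f0 f"
    for f :: "real \<Rightarrow> 'n cfun"
  proof -
    have "f t \<in> Linf" using that t by (simp add: cauchy_solution_def)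
    then obtain B where "f t \<in> borel_measurable borel" "AE x in lborel. norm (f t x) \<le> B"
      using Linf_AE_bound by blast
    then show ?thesis by (rule tempered_bounded)
  qed
  show ?thesis
  proof (rule tempered_eq_by_gauss_tests)
    show "tempered (h t)" "tempered (k t)" using tempered h k by auto
    fix \<sigma> :: real and y :: "real^'n" assume "\<sigma> > 0"
    then have b: "schwartz (gauss_bump \<sigma> y)" by (rule schwartz_gauss_bump)
    have "AE s in lborel. indicator {0..t} s *\<^sub>R D (gauss_bump \<sigma> y) s = 0"
      using good V0
    proof eventually_elim
      fix s assume s: "s \<in> {0..T} \<longrightarrow> good s" "s \<in> {0..T} \<longrightarrow> (AE \<xi> in lborel. H s \<xi> = K s \<xi>)"
      show "indicator {0..t} s *\<^sub>R D (gauss_bump \<sigma> y) s = 0"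
      proof (cases "s \<in> {0..t}")
        case True
        with s t have gs: "good s" and eq: "AE \<xi> in lborel. H s \<xi> = K s \<xi>" by auto
        have "AE \<xi> in lborel. riesz_symbol i \<xi> * H s \<xi> = riesz_symbol i \<xi> * K s \<xi>"
          using eq by eventually_elim simp
        then have gl: "AE x in lborel. g s x = l s x"
          using gs fourier_transform_inj unfolding good_def by blast
        have [measurable]: "g s \<in> borel_measurable borel" "l s \<in> borel_measurable borel"
          using gs by (auto simp: good_def is_fourier_transform_def tempered_def)
        have "(\<integral>x. g s x * gauss_bump \<sigma> y x \<partial>lborel) = (\<integral>x. l s x * gauss_bump \<sigma> y x \<partial>lborel)"
          by (rule integral_cong_AE) (use gl in auto)
        then show ?thesis by (simp add: D_def)
      qed simp
    qed
    then have "(LINT s:{0..t}|lborel. D (gauss_bump \<sigma> y) s) = 0"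
      unfolding set_lebesgue_integral_def by (rule integral_eq_zero_AE)
    then show "(\<integral>x. h t x * gauss_bump \<sigma> y x \<partial>lborel) = (\<integral>x. k t x * gauss_bump \<sigma> y x \<partial>lborel)"
      using diff[OF b t] by simp
  qed
qed

section \<open>Norm inflation\<close>

lemma inv_fourier_continuous:
  fixes F :: "'n::finite cfun"
  assumes F: "integrable lborel F"
  shows "continuous_on UNIV (inv_fourier F)"
proof (rule continuous_at_imp_continuous_on, rule ballI, rule continuous_at_sequentiallyI)
  have [measurable]: "F \<in> borel_measurable borel" using borel_measurable_integrable[OF F] by simp
  fix u and a :: "real^'n"
  assume u: "u \<longlonglongrightarrow> a"
  have "(\<lambda>n. \<integral>\<xi>. iexp (u n \<bullet> \<xi>) * F \<xi> \<partial>lborel)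
      \<longlonglongrightarrow> (\<integral>\<xi>. iexp (a \<bullet> \<xi>) * F \<xi> \<partial>lborel)"
  proof (rule integral_dominated_convergence[where w = "\<lambda>\<xi>. norm (F \<xi>)"])
    show "integrable lborel (\<lambda>\<xi>. norm (F \<xi>))" by (intro integrable_norm F)
    show "AE \<xi> in lborel. (\<lambda>n. iexp (u n \<bullet> \<xi>) * F \<xi>)
        \<longlonglongrightarrow> iexp (a \<bullet> \<xi>) * F \<xi>"
      by (intro AE_I2 tendsto_intros u)
    show "AE \<xi> in lborel. norm (iexp (u n \<bullet> \<xi>) * F \<xi>) \<le> norm (F \<xi>)" for n
      by (intro AE_I2) (simp add: norm_mult)
  qed measurable
  then show "(\<lambda>n. inv_fourier F (u n)) \<longlonglongrightarrow> inv_fourier F a"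
    unfolding inv_fourier_def by (intro tendsto_divide) auto
qed

lemma schwartz_decaying: "schwartz F \<Longrightarrow> \<exists>C. decaying C (F :: 'n::finite cfun)"
  unfolding decaying_def by (metis schwartz_borel schwartz_weight_bound)

lemma decaying_sum:
  assumes "\<And>k. k \<in> S \<Longrightarrow> \<exists>C. decaying C (F k)"
  shows "\<exists>C. decaying C (\<lambda>\<xi>. \<Sum>k\<in>S. F k \<xi>)"
  using assms
proof (induction S rule: infinite_finite_induct)
  case (insert k S)
  then obtain C D where "decaying C (F k)" "decaying D (\<lambda>\<xi>. \<Sum>k\<in>S. F k \<xi>)" by blast
  from decaying_add[OF this] show ?case using insert.hyps by auto
qed (auto simp: decaying_def)

lemma inv_fourier_sum:
  assumes "finite S" "\<And>k. k \<in> S \<Longrightarrow> integrable lborel (F k)"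
  shows "inv_fourier (\<lambda>\<xi>. \<Sum>k\<in>S. c k * F k \<xi>) x = (\<Sum>k\<in>S. c k * inv_fourier (F k) x)"
  using assms
proof (induction S rule: finite_induct)
  case empty
  show ?case by (simp add: inv_fourier_def)
next
  case (insert k S)
  have i: "integrable lborel (\<lambda>\<xi>. \<Sum>k\<in>S. c k * F k \<xi>)" "integrable lborel (\<lambda>\<xi>. c k * F k \<xi>)"
    using insert.prems by auto
  have "inv_fourier (\<lambda>\<xi>. c k * F k \<xi> + (\<Sum>k\<in>S. c k * F k \<xi>)) x
      = c k * inv_fourier (F k) x + (\<Sum>k\<in>S. c k * inv_fourier (F k) x)"
    using insert by (simp add: inv_fourier_add[OF i(2) i(1)] inv_fourier_cmult)
  then show ?case using insert.hyps by simp
qed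

text \<open>
  The spectrum of the plane wave with frequency \<open>y\<close>, cut off at length \<open>1 / \<sigma>\<close>.
\<close>

definition wave_packet :: "real \<Rightarrow> real^'n::finite \<Rightarrow> 'n cfun" where
  "wave_packet \<sigma> y \<xi> = of_real ((2 * pi) ^ CARD('n) / \<sigma> ^ CARD('n)) * gauss_bump \<sigma> y \<xi>"

lemma decaying_wave_packet: "\<sigma> > 0 \<Longrightarrow> \<exists>C. decaying C (wave_packet \<sigma> y)"
  unfolding wave_packet_def[abs_def] using schwartz_decaying[OF schwartz_gauss_bump] decaying_cmult by blast

lemma inv_fourier_wave_packet:
  assumes \<sigma>: "\<sigma> > 0"
  shows "inv_fourier (wave_packet \<sigma> y) x = iexp (y \<bullet> x) * of_real (exp (- (\<sigma> * norm x)\<^sup>2 / 2))"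
proof -
  have I: "(\<integral>\<xi>. iexp (x \<bullet> \<xi>) * gauss_bump \<sigma> y \<xi> \<partial>lborel)
      = of_real (\<sigma> ^ CARD('a)) * iexp (y \<bullet> x) * of_real (exp (- (\<sigma> * norm x)\<^sup>2 / 2))"
    using fourier_modulated_gauss[OF \<sigma>, of x y] unfolding gauss_bump_def by (simp only: inner_commute[of x])
  show ?thesis
    unfolding wave_packet_def[abs_def] inv_fourier_cmult inv_fourier_def[of "gauss_bump \<sigma> y"] I
    using \<sigma> by simp
qed

lemma flow_continuous:
  assumes "\<xi> \<noteq> 0" shows "isCont (flow i t) \<xi>"
  unfolding flow_def[abs_def] riesz_symbol_def direction_cosine_def
  using assms by (intro continuous_intros) auto

text \<open>
  As the packet widens, its spectrum concentrates at \<open>y\<close>, where the symbol is continuous; so the packet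
  becomes an eigenfunction of the flow.
\<close>

lemma flow_wave_packet_origin:
  fixes y :: "real^'n::finite"
  assumes y: "y \<noteq> 0" and \<sigma>: "\<sigma> \<longlonglongrightarrow> 0" and \<sigma>p: "\<And>n. \<sigma> n > 0"
  shows "(\<lambda>n. solution i (wave_packet (\<sigma> n) y) t 0) \<longlonglongrightarrow> flow i t y"
proof -
  have "solution i (wave_packet (\<sigma> n) y) t 0 = (\<integral>\<eta>. flow i t (y + \<sigma> n *\<^sub>R \<eta>) * of_real (std_gauss \<eta>) \<partial>lborel)" for n
  proof -
    let ?P = "of_real ((2 * pi) ^ CARD('n)) :: complex"
    let ?s = "of_real (\<sigma> n ^ CARD('n)) :: complex"
    have "(\<integral>\<xi>. flow i t \<xi> * wave_packet (\<sigma> n) y \<xi> \<partial>lborel) = (\<integral>\<xi>. ?P / ?s * (flow i t \<xi> * gauss_bump (\<sigma> n) y \<xi>) \<partial>lborel)"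
      by (simp add: wave_packet_def mult.left_commute)
    also have "\<dots> = ?P / ?s * (\<integral>\<xi>. flow i t \<xi> * gauss_bump (\<sigma> n) y \<xi> \<partial>lborel)"
      by (rule integral_mult_right_zero)
    also have "(\<integral>\<xi>. flow i t \<xi> * gauss_bump (\<sigma> n) y \<xi> \<partial>lborel)
        = ?s * (\<integral>\<eta>. flow i t (y + \<sigma> n *\<^sub>R \<eta>) * of_real (std_gauss \<eta>) \<partial>lborel)"
      unfolding gauss_bump_def
      by (rule gauss_rescale(2)[where B=1]) (use \<sigma>p in \<open>auto simp: flow_norm\<close>)
    finally show ?thesis
      using \<sigma>p[of n] by (simp add: solution_def inv_fourier_def)
  qed
  moreover have "(\<lambda>n. \<integral>\<eta>. flow i t (y + \<sigma> n *\<^sub>R \<eta>) * of_real (std_gauss \<eta>) \<partial>lborel) \<longlonglongrightarrow> flow i t y"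
    by (rule gauss_average_tendsto[where B=1]) (use y \<sigma> in \<open>auto simp: flow_norm intro: flow_continuous\<close>)
  ultimately show ?thesis by simp
qed

text \<open>
  The series with all terms is the imaginary part of \<open>- Ln (1 - w)\<close> at \<open>w = r exp (\<i> x)\<close>, which is at
  most \<open>\<pi>\<close> in modulus; at \<open>x = 0\<close> the series without the sine is \<open>- ln (1 - r)\<close>. The additional \<open>1\<close>
  on both sides pays for truncating to finitely many terms, uniformly in \<open>x\<close>.
\<close>

lemma log_series_bound:
  assumes r: "0 < r" "r < 1"
  obtains N where "\<And>x. \<bar>\<Sum>k=1..N. r ^ k / k * sin (k * x)\<bar> \<le> pi + 1"
    "(\<Sum>k=1..N. r ^ k / k) \<ge> - ln (1 - r) - 1"
proof -
  have log: "(\<lambda>k. w ^ k / of_nat k) sums (- Ln (1 - w))" if "norm w < 1" for w :: complex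
    using sums_minus[OF Ln_series'[of "- w"]] that by simp
  have "summable (\<lambda>k. norm (complex_of_real r ^ k / of_nat k))"
  proof (rule summable_comparison_test)
    show "summable (\<lambda>k. r ^ k)" using r by (intro summable_geometric) simp
    have "r ^ k / real k \<le> r ^ k" for k
      using r by (cases "k = 0") (auto simp: divide_le_eq mult_left_le_one_le mult_le_cancel_left1)
    then show "\<exists>N. \<forall>k\<ge>N. norm (norm (complex_of_real r ^ k / of_nat k)) \<le> r ^ k"
      using r by (auto simp: norm_divide norm_power)
  qed
  then have sr: "summable (\<lambda>k. r ^ k / real k)" using r by (simp add: norm_divide norm_power)
  obtain N0 where "\<And>n. n \<ge> N0 \<Longrightarrow> norm (\<Sum>k. r ^ (k + n) / real (k + n)) < 1"
    using suminf_exist_split[OF zero_less_one sr] by auto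
  then have tail: "(\<Sum>k. r ^ (k + Suc N0) / real (k + Suc N0)) < 1"
    using abs_less_iff[of _ "1::real"] by (metis le_SucI order_refl real_norm_def abs_ge_self order_le_less_trans)
  let ?N = N0
  have part: "norm (- Ln (1 - w) - (\<Sum>k=1..?N. w ^ k / of_nat k)) \<le> 1" if w: "norm w = r" for w :: complex
  proof -
    have sw: "summable (\<lambda>k. w ^ k / of_nat k)" and sumw: "(\<Sum>k. w ^ k / of_nat k) = - Ln (1 - w)"
      using log[of w] w r by (auto simp: sums_iff)
    have "(\<Sum>k<Suc ?N. w ^ k / of_nat k) = (\<Sum>k=1..?N. w ^ k / of_nat k)"
      by (rule sum.mono_neutral_right) auto
    then have "- Ln (1 - w) - (\<Sum>k=1..?N. w ^ k / of_nat k) = (\<Sum>k. w ^ (k + Suc ?N) / of_nat (k + Suc ?N))"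
      using suminf_minus_initial_segment[OF sw, of "Suc ?N"] sumw by simp
    also have "norm \<dots> \<le> (\<Sum>k. norm (w ^ (k + Suc ?N) / of_nat (k + Suc ?N)))"
    proof (rule summable_norm)
      show "summable (\<lambda>k. norm (w ^ (k + Suc ?N) / of_nat (k + Suc ?N)))"
        using summable_ignore_initial_segment[OF sr, of "Suc ?N"] w by (simp add: norm_divide norm_power norm_mult del: of_nat_Suc of_nat_add)
    qed
    also have "\<dots> = (\<Sum>k. r ^ (k + Suc ?N) / real (k + Suc ?N))"
      by (simp add: norm_divide norm_power w norm_mult del: of_nat_Suc of_nat_add)
    also have "\<dots> \<le> 1" using tail by simp
    finally show ?thesis .
  qed
  show ?thesis
  proof (rule that[of ?N])
    fix x :: real
    define w where "w = of_real r * exp (\<i> * of_real x)"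
    have w: "norm w = r" using r by (simp add: w_def norm_mult)
    have wk: "w ^ k = of_real (r ^ k) * exp (\<i> * of_real (real k * x))" for k
      by (simp add: w_def power_mult_distrib mult_ac flip: exp_of_nat_mult)
    have "Im (w ^ k / of_nat k) = r ^ k / k * sin (k * x)" for k
      unfolding wk by (simp add: Im_divide_of_nat Im_exp)
    then have "(\<Sum>k=1..?N. r ^ k / k * sin (k * x)) = Im (\<Sum>k=1..?N. w ^ k / of_nat k)"
      by (simp only: Im_sum)
    also have "\<bar>\<dots>\<bar> \<le> \<bar>Im (- Ln (1 - w))\<bar> + \<bar>Im (- Ln (1 - w) - (\<Sum>k=1..?N. w ^ k / of_nat k))\<bar>"
      by simp
    also have "\<dots> \<le> pi + 1"
    proof (rule add_mono)
      have "1 - w \<noteq> 0" using w r by auto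
      then show "\<bar>Im (- Ln (1 - w))\<bar> \<le> pi"
        using Im_Ln_le_pi[of "1 - w"] mpi_less_Im_Ln[of "1 - w"] by simp
      show "\<bar>Im (- Ln (1 - w) - (\<Sum>k=1..?N. w ^ k / of_nat k))\<bar> \<le> 1"
        using abs_Im_le_cmod part[OF w] order_trans by blast
    qed
    finally show "\<bar>\<Sum>k=1..?N. r ^ k / k * sin (k * x)\<bar> \<le> pi + 1" .
  next
    have "norm (- Ln (1 - of_real r) - (\<Sum>k=1..?N. complex_of_real r ^ k / of_nat k)) \<le> 1"
      by (rule part) (use r in simp)
    moreover have "- Ln (1 - of_real r) - (\<Sum>k=1..?N. complex_of_real r ^ k / of_nat k)
        = of_real (- ln (1 - r) - (\<Sum>k=1..?N. r ^ k / k))"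
      using r Ln_of_real[of "1 - r"] by simp
    ultimately have "\<bar>- ln (1 - r) - (\<Sum>k=1..?N. r ^ k / k)\<bar> \<le> 1"
      by (simp only: norm_of_real)
    then show "(\<Sum>k=1..?N. r ^ k / k) \<ge> - ln (1 - r) - 1" by linarith
  qed
qed

text \<open>
  The initial datum is \<open>A \<Sum> r\<^sup>k sin (k x\<^sub>i) / k\<close> times a wide Gaussian. Its size is governed by \<open>A\<close>
  alone, while the value of the solution at the origin tends to \<open>- A sin t \<Sum> r\<^sup>k / k\<close> as the Gaussian
  widens. Thus \<open>\<epsilon>\<close> fixes \<open>A\<close>, and \<open>r\<close> is then taken close to \<open>1\<close> depending on \<open>A\<close> and \<open>t\<close>.
\<close>

lemma norm_inflation:
  fixes i :: "'n::finite"
  assumes t: "0 < t" "t < pi" and \<epsilon>: "\<epsilon> > 0"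
  obtains C F where "decaying C (F :: 'n cfun)" "\<And>x. norm (inv_fourier F x) \<le> \<epsilon>"
    "norm (solution i F t 0) \<ge> 1 / \<epsilon>"
proof -
  define A where "A = \<epsilon> / (pi + 1)"
  have A: "A > 0" using \<epsilon> by (simp add: A_def add_pos_pos)
  have st: "sin t > 0" using t by (intro sin_gt_zero) auto
  \<comment> \<open>\<open>R = - ln (1 - r)\<close>; the last summand compensates the loss in the truncated series.\<close>
  define R where "R = (1 / \<epsilon> + 1) / (A * sin t) + 1"
  have R: "R > 0" using A st \<epsilon> by (simp add: R_def add_pos_pos)
  define r where "r = 1 - exp (- R)"
  have r: "0 < r" "r < 1" "- ln (1 - r) = R" using R by (auto simp: r_def)
  obtain N where N: "\<And>x. \<bar>\<Sum>k=1..N. r ^ k / k * sin (k * x)\<bar> \<le> pi + 1"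
    "(\<Sum>k=1..N. r ^ k / k) \<ge> - ln (1 - r) - 1"
    using log_series_bound[OF r(1,2)] by blast
  define c where "c k = of_real (A * (r ^ k / k)) / (2 * \<i>)" for k :: nat
  define y where "y k = real k *\<^sub>R (axis i 1 :: real^'n)" for k :: nat
  define F where "F \<sigma> \<xi> = (\<Sum>k=1..N. c k * (wave_packet \<sigma> (y k) \<xi> + (-1) * wave_packet \<sigma> (- y k) \<xi>))" for \<sigma> \<xi>
  have dec0: "\<exists>C. decaying C (\<lambda>\<xi>. wave_packet \<sigma> (y k) \<xi> + (-1) * wave_packet \<sigma> (- y k) \<xi>)" if "\<sigma> > 0" for \<sigma> k
    using decaying_wave_packet[OF that, of "y k"] decaying_wave_packet[OF that, of "- y k"] decaying_add decaying_cmult by blast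
  have dec: "\<exists>C. decaying C (F \<sigma>)" if "\<sigma> > 0" for \<sigma>
    unfolding F_def[abs_def] using dec0[OF that] decaying_cmult by (intro decaying_sum) blast
  have pint: "integrable lborel (wave_packet \<sigma> z)" if "\<sigma> > 0" for \<sigma> and z :: "real^'n"
    using decaying_wave_packet[OF that] decaying_integrable by blast
  have lin: "inv_fourier (\<lambda>\<xi>. m \<xi> * F \<sigma> \<xi>) x =
      (\<Sum>k=1..N. c k * (inv_fourier (\<lambda>\<xi>. m \<xi> * wave_packet \<sigma> (y k) \<xi>) x - inv_fourier (\<lambda>\<xi>. m \<xi> * wave_packet \<sigma> (- y k) \<xi>) x))"
    if m: "\<And>z. integrable lborel (\<lambda>\<xi>. m \<xi> * wave_packet \<sigma> z \<xi>)" for m :: "'n cfun" and \<sigma> x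
  proof -
    have "(\<lambda>\<xi>. m \<xi> * F \<sigma> \<xi>) = (\<lambda>\<xi>. \<Sum>k=1..N. c k * (m \<xi> * wave_packet \<sigma> (y k) \<xi> + (-1) * (m \<xi> * wave_packet \<sigma> (- y k) \<xi>)))"
      by (simp add: F_def fun_eq_iff sum_distrib_left algebra_simps)
    then have "inv_fourier (\<lambda>\<xi>. m \<xi> * F \<sigma> \<xi>) x =
        (\<Sum>k=1..N. c k * inv_fourier (\<lambda>\<xi>. m \<xi> * wave_packet \<sigma> (y k) \<xi> + (-1) * (m \<xi> * wave_packet \<sigma> (- y k) \<xi>)) x)"
      using inv_fourier_sum[of "{1..N}" "\<lambda>k \<xi>. m \<xi> * wave_packet \<sigma> (y k) \<xi> + (-1) * (m \<xi> * wave_packet \<sigma> (- y k) \<xi>)" c x] m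
      by simp
    also have "\<dots> = (\<Sum>k=1..N. c k * (inv_fourier (\<lambda>\<xi>. m \<xi> * wave_packet \<sigma> (y k) \<xi>) x - inv_fourier (\<lambda>\<xi>. m \<xi> * wave_packet \<sigma> (- y k) \<xi>) x))"
    proof (rule sum.cong[OF refl])
      fix k
      have "inv_fourier (\<lambda>\<xi>. m \<xi> * wave_packet \<sigma> (y k) \<xi> + (-1) * (m \<xi> * wave_packet \<sigma> (- y k) \<xi>)) x
          = inv_fourier (\<lambda>\<xi>. m \<xi> * wave_packet \<sigma> (y k) \<xi>) x + (-1) * inv_fourier (\<lambda>\<xi>. m \<xi> * wave_packet \<sigma> (- y k) \<xi>) x"
        by (subst inv_fourier_add[OF m integrable_mult_right[OF m]]) (simp only: inv_fourier_cmult)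
      then show "c k * inv_fourier (\<lambda>\<xi>. m \<xi> * wave_packet \<sigma> (y k) \<xi> + (-1) * (m \<xi> * wave_packet \<sigma> (- y k) \<xi>)) x
          = c k * (inv_fourier (\<lambda>\<xi>. m \<xi> * wave_packet \<sigma> (y k) \<xi>) x - inv_fourier (\<lambda>\<xi>. m \<xi> * wave_packet \<sigma> (- y k) \<xi>) x)"
        by simp
    qed
    finally show ?thesis .
  qed
  have sin_exp: "exp (\<i> * of_real z) - exp (- (\<i> * of_real z)) = 2 * \<i> * of_real (sin z)" for z :: real
    by (simp add: exp_Euler[of "of_real z"] exp_minus_Euler sin_of_real cos_of_real flip: of_real_minus)
  have small: "norm (inv_fourier (F \<sigma>) x) \<le> \<epsilon>" if \<sigma>: "\<sigma> > 0" for \<sigma> x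
  proof -
    let ?E = "exp (- (\<sigma> * norm x)\<^sup>2 / 2)"
    have "inv_fourier (F \<sigma>) x = (\<Sum>k=1..N. c k * (inv_fourier (wave_packet \<sigma> (y k)) x - inv_fourier (wave_packet \<sigma> (- y k)) x))"
      using lin[of "\<lambda>_. 1" \<sigma> x] pint[OF \<sigma>] by simp
    also have "\<dots> = (\<Sum>k=1..N. of_real (A * ?E * (r ^ k / k * sin (k * (x $ i)))))"
    proof (rule sum.cong[OF refl])
      fix k
      have "y k \<bullet> x = k * (x $ i)" by (simp add: y_def inner_axis')
      then have "inv_fourier (wave_packet \<sigma> (y k)) x - inv_fourier (wave_packet \<sigma> (- y k)) x
          = 2 * \<i> * of_real (sin (k * (x $ i))) * of_real ?E"
        unfolding inv_fourier_wave_packet[OF \<sigma>] left_diff_distrib[symmetric]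
        using sin_exp[of "k * (x $ i)"] by (simp only: inner_minus_left of_real_minus mult_minus_right)
      then show "c k * (inv_fourier (wave_packet \<sigma> (y k)) x - inv_fourier (wave_packet \<sigma> (- y k)) x)
          = of_real (A * ?E * (r ^ k / k * sin (k * (x $ i))))"
        by (simp only: c_def) (simp add: field_simps)
    qed
    also have "\<dots> = of_real (A * ?E * (\<Sum>k=1..N. r ^ k / k * sin (k * (x $ i))))"
      by (simp only: sum_distrib_left of_real_sum)
    also have "norm \<dots> = A * ?E * \<bar>\<Sum>k=1..N. r ^ k / k * sin (k * (x $ i))\<bar>"
      using A by (simp only: norm_of_real abs_mult) simp
    also have "\<dots> \<le> A * 1 * (pi + 1)"
      using A N(1)[of "x $ i"] by (intro mult_mono mult_left_mono) auto
    also have "\<dots> = \<epsilon>"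
    proof -
      have "pi + 1 > 0" using pi_gt_zero by linarith
      then show ?thesis by (simp add: A_def)
    qed
    finally show ?thesis .
  qed
  define \<sigma> where "\<sigma> n = inverse (real (Suc n))" for n
  have \<sigma>0: "\<sigma> \<longlonglongrightarrow> 0" unfolding \<sigma>_def by (rule LIMSEQ_inverse_real_of_nat)
  have \<sigma>p: "\<sigma> n > 0" for n by (simp add: \<sigma>_def)
  have "solution i (F (\<sigma> n)) t 0 = (\<Sum>k=1..N. c k * (solution i (wave_packet (\<sigma> n) (y k)) t 0 - solution i (wave_packet (\<sigma> n) (- y k)) t 0))" for n
    unfolding solution_def
  proof (rule lin)
    fix z :: "real^'n"
    obtain C where "decaying C (wave_packet (\<sigma> n) z)" using decaying_wave_packet[OF \<sigma>p[of n]] by blast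
    then show "integrable lborel (\<lambda>\<xi>. flow i t \<xi> * wave_packet (\<sigma> n) z \<xi>)"
      using decaying_integrable[OF decaying_flow] by blast
  qed
  moreover have "(\<lambda>n. \<Sum>k=1..N. c k * (solution i (wave_packet (\<sigma> n) (y k)) t 0 - solution i (wave_packet (\<sigma> n) (- y k)) t 0))
      \<longlonglongrightarrow> (\<Sum>k=1..N. c k * (flow i t (y k) - flow i t (- y k)))"
  proof (intro tendsto_sum tendsto_mult_left tendsto_diff flow_wave_packet_origin \<sigma>0 \<sigma>p)
    show "y k \<noteq> 0" "- y k \<noteq> 0" if "k \<in> {1..N}" for k using that by (auto simp: y_def axis_eq_0_iff)
  qed
  moreover have "(\<Sum>k=1..N. c k * (flow i t (y k) - flow i t (- y k))) = of_real (- (A * sin t * (\<Sum>k=1..N. r ^ k / k)))"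
  proof -
    have "c k * (flow i t (y k) - flow i t (- y k)) = of_real (- (A * sin t * (r ^ k / k)))" if "k \<in> {1..N}" for k
    proof -
      have "direction_cosine i (y k) = 1" "direction_cosine i (- y k) = -1" using that by (auto simp: direction_cosine_def y_def norm_axis_1)
      then have "flow i t (y k) - flow i t (- y k) = exp (\<i> * of_real (- t)) - exp (- (\<i> * of_real (- t)))"
        by (simp add: flow_def riesz_symbol_def mult.commute)
      also have "\<dots> = 2 * \<i> * of_real (sin (- t))" by (rule sin_exp)
      finally show ?thesis by (simp only: c_def) (simp add: field_simps)
    qed
    then have "(\<Sum>k=1..N. c k * (flow i t (y k) - flow i t (- y k))) = (\<Sum>k=1..N. of_real (- (A * sin t * (r ^ k / k))))"
      by (rule sum.cong[OF refl])
    also have "\<dots> = of_real (- (A * sin t * (\<Sum>k=1..N. r ^ k / k)))"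
      by (simp only: sum_distrib_left of_real_sum sum_negf[symmetric])
    finally show ?thesis .
  qed
  ultimately have "(\<lambda>n. solution i (F (\<sigma> n)) t 0) \<longlonglongrightarrow> of_real (- (A * sin t * (\<Sum>k=1..N. r ^ k / k)))"
    by simp
  then have "(\<lambda>n. norm (solution i (F (\<sigma> n)) t 0)) \<longlonglongrightarrow> norm (complex_of_real (- (A * sin t * (\<Sum>k=1..N. r ^ k / k))))"
    by (rule tendsto_norm)
  moreover have "norm (complex_of_real (- (A * sin t * (\<Sum>k=1..N. r ^ k / k)))) > 1 / \<epsilon>"
  proof -
    have "1 / \<epsilon> < 1 / \<epsilon> + 1" by simp
    also have "\<dots> = A * sin t * (R - 1)" using A st by (simp add: R_def)
    also have "\<dots> \<le> A * sin t * (\<Sum>k=1..N. r ^ k / k)"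
      using N(2) r(3) A st by (intro mult_left_mono) auto
    also have "\<dots> \<le> norm (complex_of_real (- (A * sin t * (\<Sum>k=1..N. r ^ k / k))))"
      by (simp only: norm_of_real abs_minus_cancel abs_ge_self)
    finally show ?thesis .
  qed
  ultimately have "\<forall>\<^sub>F n in sequentially. norm (solution i (F (\<sigma> n)) t 0) > 1 / \<epsilon>"
    by (rule order_tendstoD)
  then obtain n where n: "norm (solution i (F (\<sigma> n)) t 0) > 1 / \<epsilon>"
    using eventually_sequentially by auto
  obtain C where "decaying C (F (\<sigma> n))" using dec[OF \<sigma>p] by blast
  then show ?thesis using small[OF \<sigma>p] n that less_imp_le by metis
qed

theorem corollary1p1:
  fixes i :: "'n::finite"
  shows "strongly_ill_posed (riesz_transform i) Linf Linf_norm"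
  unfolding strongly_ill_posed_def
proof (intro exI[of _ decay_space] exI[of _ decay_norm] conjI allI impI)
  show "banach_function_space (decay_space :: 'n cfun set) decay_norm" by (rule banach_decay_space)
  show "continuously_embedded (decay_space :: 'n cfun set) decay_norm Linf Linf_norm" by (rule decay_space_embedded)
  show "\<forall>u\<in>decay_space. \<exists>v. riesz_transform i u v"
    unfolding decay_space_def using riesz_transform_represents by blast
  fix \<epsilon> \<delta> :: real assume \<epsilon>: "\<epsilon> > 0" and \<delta>: "\<delta> > 0"
  \<comment> \<open>The cap \<open>1\<close> keeps \<open>t\<close> within the lifespan \<open>T = 1\<close> and below \<open>\<pi>\<close>.\<close>
  define t where "t = min (\<delta> / 2) 1"
  have t: "0 < t" "t < \<delta>" "t \<le> 1" using \<delta> by (auto simp: t_def)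
  have "t < pi" using t(3) pi_gt3 by linarith
  then obtain C and F :: "'n cfun" where F: "decaying C F"
    and small: "\<And>x. norm (inv_fourier F x) \<le> \<epsilon>" and large: "norm (solution i F t 0) \<ge> 1 / \<epsilon>"
    using norm_inflation[OF t(1) _ \<epsilon>, of i] by metis
  have rep: "represents C F (inv_fourier F)" by (rule represents_inv_fourier[OF F])
  have uniq: "unique_cauchy_solution (riesz_transform i) Linf decay_space decay_norm 1 (inv_fourier F) (solution i F)"
    unfolding unique_cauchy_solution_def
    using solution_cauchy[OF F] cauchy_solution_unique by blast
  have norm: "Linf_norm (inv_fourier F) \<le> \<epsilon>"
    using rep small \<epsilon> by (intro Linf_bound) (auto simp: represents_def)
  have "continuous_on UNIV (solution i F t)"
    unfolding solution_def by (intro inv_fourier_continuous decaying_integrable[OF decaying_flow[OF F]])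
  moreover have "solution i F t \<in> Linf"
    using decay_space_subset_Linf represents_decay_space[OF represents_solution[OF F]] by blast
  ultimately have "1 / \<epsilon> \<le> Linf_norm (solution i F t)"
    using Linf_norm_ge_continuous[of "solution i F t" 0] large by simp
  then show "\<exists>f0\<in>decay_space. Linf_norm f0 \<le> \<epsilon> \<and> (\<exists>T>0. \<exists>f.
      unique_cauchy_solution (riesz_transform i) Linf decay_space decay_norm T f0 f \<and>
      (\<exists>t. 0 < t \<and> t < \<delta> \<and> t \<le> T \<and> 1 / \<epsilon> \<le> Linf_norm (f t)))"
    using represents_decay_space[OF rep] norm uniq t by (intro bexI[of _ "inv_fourier F"] conjI exI[of _ 1] exI) auto
qed

end
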